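(* Consider classical shadow estimation under arbitrary gate-dependent noise: for each Clifford unitary $g$ there is a quantum channel $\Lambda(g)$, the unitary $g$ is drawn uniformly at random from the sampling group, the channel $\omega(g)\Lambda(g)$ is applied to the $n$-qubit state $\rho$, the computational basis is measured with outcome $x$ (probability $\langle x|\omega(g)\Lambda(g)(\rho)|x\rangle$), and the estimator $\hat o(g,x)=(O|S^{-1}\omega(g)^\dagger|E_x)$ is computed, with $S$ the noise-free frame operator. Then: (i) for uniform sampling from the global Clifford group $\mathrm{Cl}_n$, $$\mathbb{V}[\hat o]\le \frac{2(d+1)}{d+2}\lVert O_0\rVert_{\mathrm{st}}^2+\frac{d+1}{d}\lVert O_0\rVert_2^2;$$ (ii) for uniform sampling from the local Clifford group $\mathrm{Cl}_1^{\times n}$, $\mathbb{V}[\hat o]\le 4^k\lVert O_{\mathrm{loc}}\rVert_\infty^2$ for $k$-local observables $O=O_{\mathrm{loc}}\otimes\mathbb 1^{\otimes(n-k)}$ (with $O_{\mathrm{loc}}$ acting on $k$ qubits), and $\mathbb{V}[\hat o]\le 3^{|\mathrm{supp}(\sigma_a)|}$ for Pauli observables $O=\sigma_a$.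
   Context: $d=2^n$; $(A|B)=\mathrm{Tr}(A^\dagger B)$, $|A)(B|$ is the superoperator $C\mapsto(B|C)A$. $\omega(g)(A)=gAg^\dagger$, $\omega(g)^\dagger(A)=g^\dagger Ag$. $E_x=|x\rangle\langle x|$, $M=\sum_{x\in\mathbb{F}_2^n}|E_x)(E_x|$, and the noise-free frame operator is $S=\mathbb{E}_g[\omega(g)^\dagger M\omega(g)]$ with $g$ uniform on the sampling group (global Clifford group $\mathrm{Cl}_n$, or local Clifford group $\mathrm{Cl}_1^{\times n}=\{g_1\otimes\cdots\otimes g_n: g_i\in\mathrm{Cl}_1\}$). $\mathbb V$ denotes variance over the random pair $(g,x)$. $O$ is Hermitian and $O_0=O-\mathrm{Tr}(O)\mathbb 1/d$ its traceless part. Pauli operators $\sigma_a=\sigma_{a_1}\otimes\cdots\otimes\sigma_{a_n}$, $a_i\in\mathbb{F}_2^2$, with $\sigma_{00}=\mathbb 1$; $|\mathrm{supp}(\sigma_a)|=|\{i:a_i\neq 0\}|$. Stabilizer norm $\lVert O\rVert_{\mathrm{st}}=d^{-1}\sum_a|(\sigma_a|O)|$; $\lVert\cdot\rVert_2$ Hilbert–Schmidt norm; $\lVert\cdot\rVert_\infty$ spectral norm. *)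

theory Defs
  imports "Jordan_Normal_Form.Matrix" "Jordan_Normal_Form.Schur_Decomposition"
begin

definition tr :: "complex mat \<Rightarrow> complex" where
  "tr A = (\<Sum>i<dim_row A. A $$ (i,i))"

abbreviation adj :: "complex mat \<Rightarrow> complex mat" where
  "adj A \<equiv> mat_adjoint A"

definition hs_inner :: "complex mat \<Rightarrow> complex mat \<Rightarrow> complex" where
  "hs_inner A B = tr (adj A * B)"

definition hermitian :: "complex mat \<Rightarrow> bool" where
  "hermitian A \<longleftrightarrow> A \<in> carrier_mat (dim_row A) (dim_row A) \<and> adj A = A"

definition unitary :: "complex mat \<Rightarrow> bool" where
  "unitary U \<longleftrightarrow> U \<in> carrier_mat (dim_row U) (dim_row U) \<and> adj U * U = 1\<^sub>m (dim_row U)"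

text \<open>Kronecker (tensor) product; the first factor is the most significant index.\<close>
definition kron :: "complex mat \<Rightarrow> complex mat \<Rightarrow> complex mat" where
  "kron A B = mat (dim_row A * dim_row B) (dim_col A * dim_col B)
     (\<lambda>(i,j). A $$ (i div dim_row B, j div dim_col B) * B $$ (i mod dim_row B, j mod dim_col B))"

definition kron_list :: "complex mat list \<Rightarrow> complex mat" where
  "kron_list Ms = foldr kron Ms (1\<^sub>m 1)"

definition vnorm :: "complex vec \<Rightarrow> real" where
  "vnorm v = sqrt (\<Sum>i<dim_vec v. (cmod (v $ i))\<^sup>2)"

definition hs_norm :: "complex mat \<Rightarrow> real" where
  "hs_norm A = sqrt (\<Sum>i<dim_row A. \<Sum>j<dim_col A. (cmod (A $$ (i,j)))\<^sup>2)"

definition spec_norm :: "complex mat \<Rightarrow> real" where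
  "spec_norm A = Sup {vnorm (A *\<^sub>v v) | v. v \<in> carrier_vec (dim_col A) \<and> vnorm v = 1}"

definition psd :: "complex mat \<Rightarrow> bool" where
  "psd A \<longleftrightarrow> hermitian A \<and>
     (\<forall>v \<in> carrier_vec (dim_row A). 0 \<le> Re (conjugate v \<bullet> (A *\<^sub>v v)))"

definition density :: "nat \<Rightarrow> complex mat \<Rightarrow> bool" where
  "density n \<rho> \<longleftrightarrow> \<rho> \<in> carrier_mat (2^n) (2^n) \<and> psd \<rho> \<and> tr \<rho> = 1"

text \<open>Quantum channels on n qubits, given by a Kraus representation (every CPTP map has one).\<close>
definition apply_kraus :: "complex mat list \<Rightarrow> complex mat \<Rightarrow> complex mat" where
  "apply_kraus Ks A = foldr (\<lambda>K acc. K * A * adj K + acc) Ks (0\<^sub>m (dim_row A) (dim_col A))"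

definition kraus_channel :: "nat \<Rightarrow> complex mat list \<Rightarrow> bool" where
  "kraus_channel n Ks \<longleftrightarrow> (\<forall>K \<in> set Ks. K \<in> carrier_mat (2^n) (2^n)) \<and>
     foldr (\<lambda>K acc. adj K * K + acc) Ks (0\<^sub>m (2^n) (2^n)) = 1\<^sub>m (2^n)"

definition pauli1 :: "bool \<times> bool \<Rightarrow> complex mat" where
  "pauli1 a = (case a of
      (False, False) \<Rightarrow> mat_of_rows_list 2 [[1, 0], [0, 1]]
    | (True, False)  \<Rightarrow> mat_of_rows_list 2 [[0, 1], [1, 0]]
    | (False, True)  \<Rightarrow> mat_of_rows_list 2 [[1, 0], [0, -1]]
    | (True, True)   \<Rightarrow> mat_of_rows_list 2 [[0, -\<i>], [\<i>, 0]])"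

definition pauli :: "(bool \<times> bool) list \<Rightarrow> complex mat" where
  "pauli a = kron_list (map pauli1 a)"

definition pauli_labels :: "nat \<Rightarrow> (bool \<times> bool) list set" where
  "pauli_labels n = {a. length a = n}"

definition supp_size :: "(bool \<times> bool) list \<Rightarrow> nat" where
  "supp_size a = length (filter (\<lambda>p. p \<noteq> (False, False)) a)"

definition stab_norm :: "nat \<Rightarrow> complex mat \<Rightarrow> real" where
  "stab_norm n Obs = (1 / 2^n) * (\<Sum>a\<in>pauli_labels n. cmod (hs_inner (pauli a) Obs))"

definition traceless_part :: "nat \<Rightarrow> complex mat \<Rightarrow> complex mat" where
  "traceless_part n Obs = Obs - (tr Obs / of_nat (2^n)) \<cdot>\<^sub>m 1\<^sub>m (2^n)"

definition hadamard1 :: "complex mat" where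
  "hadamard1 = (1 / of_real (sqrt 2)) \<cdot>\<^sub>m mat_of_rows_list 2 [[1, 1], [1, -1]]"

definition phase1 :: "complex mat" where
  "phase1 = mat_of_rows_list 2 [[1, 0], [0, \<i>]]"

text \<open>Single-qubit gate U acting on qubit i (qubit 0 = most significant tensor factor).\<close>
definition on_qubit :: "nat \<Rightarrow> nat \<Rightarrow> complex mat \<Rightarrow> complex mat" where
  "on_qubit n i U = kron (1\<^sub>m (2^i)) (kron U (1\<^sub>m (2^(n - i - 1))))"

definition qbit :: "nat \<Rightarrow> nat \<Rightarrow> nat \<Rightarrow> bool" where
  "qbit n i x \<longleftrightarrow> odd (x div 2^(n - 1 - i))"

definition flip_bit :: "nat \<Rightarrow> nat \<Rightarrow> nat \<Rightarrow> nat" where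
  "flip_bit n j x = (if qbit n j x then x - 2^(n - 1 - j) else x + 2^(n - 1 - j))"

definition cnot :: "nat \<Rightarrow> nat \<Rightarrow> nat \<Rightarrow> complex mat" where
  "cnot n i j = mat (2^n) (2^n)
     (\<lambda>(r,c). if r = (if qbit n i c then flip_bit n j c else c) then 1 else 0)"

definition clifford_gens :: "nat \<Rightarrow> complex mat set" where
  "clifford_gens n = {on_qubit n i hadamard1 | i. i < n} \<union> {on_qubit n i phase1 | i. i < n}
     \<union> {cnot n i j | i j. i < n \<and> j < n \<and> i \<noteq> j}"

text \<open>The n-qubit Clifford group Cl_n: generated by H, S and CNOT (a finite group of unitaries).\<close>
inductive_set clifford :: "nat \<Rightarrow> complex mat set" for n where
  cl_id: "1\<^sub>m (2^n) \<in> clifford n"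
| cl_mult: "G \<in> clifford_gens n \<Longrightarrow> g \<in> clifford n \<Longrightarrow> G * g \<in> clifford n"

definition local_clifford :: "nat \<Rightarrow> complex mat set" where
  "local_clifford n = {kron_list gs | gs. length gs = n \<and> set gs \<subseteq> clifford 1}"

definition msum :: "nat \<Rightarrow> ('a \<Rightarrow> complex mat) \<Rightarrow> 'a set \<Rightarrow> complex mat" where
  "msum d f S = mat d d (\<lambda>(i,j). \<Sum>x\<in>S. f x $$ (i,j))"

definition Ebasis :: "nat \<Rightarrow> nat \<Rightarrow> complex mat" where
  "Ebasis n x = mat (2^n) (2^n) (\<lambda>(i,j). if i = x \<and> j = x then 1 else 0)"

definition omega :: "complex mat \<Rightarrow> complex mat \<Rightarrow> complex mat" where
  "omega g A = g * A * adj g"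

definition omega_adj :: "complex mat \<Rightarrow> complex mat \<Rightarrow> complex mat" where
  "omega_adj g A = adj g * A * g"

definition Mmeas :: "nat \<Rightarrow> complex mat \<Rightarrow> complex mat" where
  "Mmeas n A = msum (2^n) (\<lambda>x. hs_inner (Ebasis n x) A \<cdot>\<^sub>m Ebasis n x) {..<2^n}"

definition frame_op :: "nat \<Rightarrow> complex mat set \<Rightarrow> complex mat \<Rightarrow> complex mat" where
  "frame_op n G A = (1 / of_nat (card G)) \<cdot>\<^sub>m
     msum (2^n) (\<lambda>g. omega_adj g (Mmeas n (omega g A))) G"

definition frame_inv :: "nat \<Rightarrow> complex mat set \<Rightarrow> complex mat \<Rightarrow> complex mat" where
  "frame_inv n G B = (THE A. A \<in> carrier_mat (2^n) (2^n) \<and> frame_op n G A = B)"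

definition estimator :: "nat \<Rightarrow> complex mat set \<Rightarrow> complex mat \<Rightarrow> complex mat \<Rightarrow> nat \<Rightarrow> complex" where
  "estimator n G Obs g x = hs_inner Obs (frame_inv n G (omega_adj g (Ebasis n x)))"

definition outcome_prob :: "nat \<Rightarrow> complex mat set \<Rightarrow> (complex mat \<Rightarrow> complex mat list)
     \<Rightarrow> complex mat \<Rightarrow> complex mat \<Rightarrow> nat \<Rightarrow> real" where
  "outcome_prob n G \<Lambda> \<rho> g x =
     (1 / real (card G)) * Re ((omega g (apply_kraus (\<Lambda> g) \<rho>)) $$ (x, x))"

definition est_mean :: "nat \<Rightarrow> complex mat set \<Rightarrow> (complex mat \<Rightarrow> complex mat list)
     \<Rightarrow> complex mat \<Rightarrow> complex mat \<Rightarrow> complex" where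
  "est_mean n G \<Lambda> \<rho> Obs = (\<Sum>g\<in>G. \<Sum>x<2^n.
      of_real (outcome_prob n G \<Lambda> \<rho> g x) * estimator n G Obs g x)"

definition est_var :: "nat \<Rightarrow> complex mat set \<Rightarrow> (complex mat \<Rightarrow> complex mat list)
     \<Rightarrow> complex mat \<Rightarrow> complex mat \<Rightarrow> real" where
  "est_var n G \<Lambda> \<rho> Obs = (\<Sum>g\<in>G. \<Sum>x<2^n.
      outcome_prob n G \<Lambda> \<rho> g x * (cmod (estimator n G Obs g x - est_mean n G \<Lambda> \<rho> Obs))\<^sup>2)"

end

theory Submission
  imports Defs
begin

text \<open>
  Conjugation by a Clifford unitary permutes the Pauli operators up to a phase, so the diagonal
  entries of \<open>g \<sigma>\<^sub>a g*\<close> have modulus 1 if the image is a product of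
  \<open>Z\<close>s (\<open>g\<close> hits \<open>a\<close>) and vanish otherwise. The frame operator is therefore
  diagonal in the Pauli basis, with eigenvalue the probability that \<open>a\<close> is hit, and
  expanding the observable gives a bound on \<open>|o(g,x)|\<close> which does not depend on
  \<open>x\<close>. Since the outcome probabilities for fixed \<open>g\<close> sum to \<open>1/|G|\<close> whatever
  the channel is, gate-dependent noise plays no further role: only the probabilities that one or two
  labels are hit matter. These follow by double counting from the transitivity of the global group on
  non-identity Paulis and on commuting pairs of them, and of the local group on Paulis of equal support.
  In the \<open>k\<close>-local case a weighted Cauchy--Schwarz inequality is used, where for each
  \<open>g\<close> the weights \<open>3^|supp a|\<close> of the labels that are hit sum to \<open>4^k\<close>.
\<close>

section \<open>Adjoints and Kronecker products\<close>

text \<open>Phases never have to be computed: having modulus 1, they drop out of every bound. A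
  Clifford unitary is therefore represented by the map it induces on labels, and probabilities
  become counts of labels. The counts explain the constants. Of the d^2 - 1 non-identity labels
  exactly d - 1 are products of \<open>Z\<close>s, so one label is hit with probability 1/(d+1). A
  group element hitting a given label also hits d - 2 of the (d^2 - 4)/2 other non-identity labels
  commuting with it, so two such labels are hit jointly with probability 2/((d+1)(d+2));
  anticommuting labels are never hit together. For the local group, one of the 3^s labels with a
  given support of size s is a product of \<open>Z\<close>s. The variance is bounded by a second
  moment about a chosen constant, because the mean depends on the noise. In the global case this
  constant is the contribution of the identity label, which every group element hits; this is how
  the traceless part enters.\<close>

lemma adj_dim [simp]: "dim_row (adj A) = dim_col A" "dim_col (adj A) = dim_row A"
  by (simp_all add: mat_adjoint_def)

lemma adj_carrier [simp]: "A \<in> carrier_mat m n \<Longrightarrow> adj A \<in> carrier_mat n m"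
  by (intro carrier_matI) simp_all

lemma adj_index [simp]:
  assumes "i < dim_col A" "j < dim_row A"
  shows "adj A $$ (i, j) = cnj (A $$ (j, i))"
  using assms by (simp add: mat_adjoint_def mat_of_rows_index)

lemma adj_adj [simp]: "adj (adj A) = A"
  by (rule eq_matI) simp_all

lemma adj_mult:
  assumes "A \<in> carrier_mat l m" "B \<in> carrier_mat m n"
  shows "adj (A * B) = adj B * adj A"
  using assms by (intro eq_matI) (auto simp: scalar_prod_def intro!: sum.cong)

lemma adj_one [simp]: "adj (1\<^sub>m n) = 1\<^sub>m n"
  by (rule eq_matI) auto

lemma mult_index:
  assumes "A \<in> carrier_mat l m" "B \<in> carrier_mat m n" "i < l" "j < n"
  shows "(A * B) $$ (i, j) = (\<Sum>k<m. A $$ (i, k) * B $$ (k, j))"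
  using assms by (auto simp: scalar_prod_def atLeast0LessThan)

lemma nat_mult_add_less: "i * n + j < m * n" if "i < m" "j < n" for i j m n :: nat
proof -
  have "i * n + j < Suc i * n" using that by simp
  also have "\<dots> \<le> m * n" using that by (intro mult_le_mono1) auto
  finally show ?thesis .
qed

text \<open>A Kronecker index \<open>k\<close> encodes the pair \<open>(k div n, k mod n)\<close>;
  decoding it turns a sum over composite indices into a double sum, which then factorises.\<close>

lemma sum_div_mod:
  fixes f :: "nat \<Rightarrow> nat \<Rightarrow> 'a :: comm_monoid_add"
  assumes "0 < n"
  shows "(\<Sum>k<m * n. f (k div n) (k mod n)) = (\<Sum>i<m. \<Sum>j<n. f i j)"
proof -
  have "bij_betw (\<lambda>k. (k div n, k mod n)) {..<m * n} ({..<m} \<times> {..<n})"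
    using assms
    by (intro bij_betwI[where g = "\<lambda>(i, j). i * n + j"])
       (auto simp: less_mult_imp_div_less mult.commute[of n] intro: nat_mult_add_less)
  then have "(\<Sum>k<m * n. f (k div n) (k mod n)) = (\<Sum>(i, j)\<in>{..<m} \<times> {..<n}. f i j)"
    using sum.reindex_bij_betw[of _ _ _ "\<lambda>(i, j). f i j"] by fastforce
  then show ?thesis by (simp add: sum.cartesian_product)
qed

lemma kron_dim [simp]:
  "dim_row (kron A B) = dim_row A * dim_row B" "dim_col (kron A B) = dim_col A * dim_col B"
  by (simp_all add: kron_def)

lemma kron_carrier [simp]:
  "A \<in> carrier_mat a b \<Longrightarrow> B \<in> carrier_mat c d \<Longrightarrow> kron A B \<in> carrier_mat (a * c) (b * d)"
  by (intro carrier_matI) auto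

lemma kron_index:
  "i < dim_row A * dim_row B \<Longrightarrow> j < dim_col A * dim_col B \<Longrightarrow> kron A B $$ (i, j)
     = A $$ (i div dim_row B, j div dim_col B) * B $$ (i mod dim_row B, j mod dim_col B)"
  by (simp add: kron_def)

lemma kron_mult:
  assumes A: "A \<in> carrier_mat a b" and B: "B \<in> carrier_mat c e"
    and C: "C \<in> carrier_mat b k" and D: "D \<in> carrier_mat e l"
  shows "kron A B * kron C D = kron (A * C) (B * D)"
proof (rule eq_matI)
  fix i j assume "i < dim_row (kron (A * C) (B * D))" "j < dim_col (kron (A * C) (B * D))"
  then have ij: "i < a * c" "j < k * l" using assms by auto
  then have pos: "c > 0" "l > 0" by (auto intro: gr0I)
  have dm: "i div c < a" "i mod c < c" "j div l < k" "j mod l < l"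
    using ij pos by (auto simp: less_mult_imp_div_less)
  show "(kron A B * kron C D) $$ (i, j) = kron (A * C) (B * D) $$ (i, j)"
  \<comment> \<open>\<open>sum_div_mod\<close> asks for a positive inner dimension; for
    \<open>e = 0\<close> both entries vanish because they contain empty sums.\<close>
  proof (cases "e = 0")
    case True
    then show ?thesis using assms ij dm
      by (subst mult_index[OF kron_carrier[OF A B] kron_carrier[OF C D]])
         (auto simp: kron_index scalar_prod_def)
  next
    case False
    have "(kron A B * kron C D) $$ (i, j) = (\<Sum>q<b * e. kron A B $$ (i, q) * kron C D $$ (q, j))"
      by (rule mult_index) (use assms ij in auto)
    also have "\<dots> = (\<Sum>q<b * e. A $$ (i div c, q div e) * B $$ (i mod c, q mod e)
                 * (C $$ (q div e, j div l) * D $$ (q mod e, j mod l)))"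
      using assms ij by (intro sum.cong) (auto simp: kron_index)
    also have "\<dots> = (\<Sum>q<b. \<Sum>r<e. A $$ (i div c, q) * B $$ (i mod c, r)
                 * (C $$ (q, j div l) * D $$ (r, j mod l)))"
      by (rule sum_div_mod) (use False in simp)
    also have "\<dots> = (\<Sum>q<b. A $$ (i div c, q) * C $$ (q, j div l))
                  * (\<Sum>r<e. B $$ (i mod c, r) * D $$ (r, j mod l))"
      by (simp add: sum_product mult_ac)
    also have "\<dots> = kron (A * C) (B * D) $$ (i, j)"
      using assms ij dm mult_index[OF A C dm(1,3)] mult_index[OF B D dm(2,4)]
      by (simp add: kron_index del: index_mult_mat(1))
    finally show ?thesis .
  qed
qed (use assms in auto)

lemma adj_kron: "adj (kron A B) = kron (adj A) (adj B)"
proof (rule eq_matI)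
  fix i j assume *: "i < dim_row (kron (adj A) (adj B))" "j < dim_col (kron (adj A) (adj B))"
  then have "dim_col B > 0" "dim_row B > 0" by (auto intro: gr0I)
  with * show "adj (kron A B) $$ (i, j) = kron (adj A) (adj B) $$ (i, j)"
    by (simp add: kron_index less_mult_imp_div_less)
qed simp_all

lemma kron_assoc: "kron (kron A B) C = kron A (kron B C)"
proof (rule eq_matI)
  fix i j assume *: "i < dim_row (kron A (kron B C))" "j < dim_col (kron A (kron B C))"
  then have pos: "dim_col B > 0" "dim_row B > 0" "dim_col C > 0" "dim_row C > 0"
    by (auto intro!: gr0I)
  \<comment> \<open>Mixed-radix digits: splitting off the last digit and then the middle one agrees
    with splitting off both at once.\<close>
  have div: "i div q div p = i div (p * q)" and mod: "i div q mod p = i mod (p * q) div q" if "q > 0" for i p q :: nat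
    using that by (simp_all add: div_mult2_eq mult.commute[of p] mod_mult2_eq)
  have "i < dim_row A * dim_row B * dim_row C" "j < dim_col A * dim_col B * dim_col C"
    using * by (simp_all add: mult.assoc)
  moreover have "i mod (dim_row B * dim_row C) < dim_row B * dim_row C"
    "j mod (dim_col B * dim_col C) < dim_col B * dim_col C" using pos by simp_all
  ultimately show "kron (kron A B) C $$ (i, j) = kron A (kron B C) $$ (i, j)"
    using * by (simp add: kron_index less_mult_imp_div_less mult.assoc div[OF pos(3)] div[OF pos(4)]
      mod[OF pos(3)] mod[OF pos(4)] mod_mod_cancel)
qed (simp_all add: mult.assoc)

lemma kron_one: "kron (1\<^sub>m a) (1\<^sub>m b) = 1\<^sub>m (a * b)"
proof (rule eq_matI)
  fix i j assume *: "i < dim_row (1\<^sub>m (a * b) :: complex mat)" "j < dim_col (1\<^sub>m (a * b) :: complex mat)"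
  then have "b > 0" by (auto intro!: gr0I)
  moreover have "i = j \<longleftrightarrow> i div b = j div b \<and> i mod b = j mod b"
    by (metis div_mult_mod_eq)
  ultimately show "kron (1\<^sub>m a) (1\<^sub>m b) $$ (i, j) = 1\<^sub>m (a * b) $$ (i, j)"
    using * by (auto simp: kron_index less_mult_imp_div_less)
qed auto

lemma kron_one_left [simp]: "kron (1\<^sub>m 1) A = A"
  by (rule eq_matI) (auto simp: kron_index)

lemma kron_one_right [simp]: "kron A (1\<^sub>m 1) = A"
  by (rule eq_matI) (auto simp: kron_index)

lemma kron_smult_left: "kron (c \<cdot>\<^sub>m A) B = c \<cdot>\<^sub>m kron A B"
proof (rule eq_matI)
  fix i j assume *: "i < dim_row (c \<cdot>\<^sub>m kron A B)" "j < dim_col (c \<cdot>\<^sub>m kron A B)"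
  then have "dim_col B > 0" "dim_row B > 0" by (auto intro: gr0I)
  with * show "kron (c \<cdot>\<^sub>m A) B $$ (i, j) = (c \<cdot>\<^sub>m kron A B) $$ (i, j)"
    by (simp add: kron_index less_mult_imp_div_less)
qed simp_all

lemma kron_smult_right: "kron A (c \<cdot>\<^sub>m B) = c \<cdot>\<^sub>m kron A B"
proof (rule eq_matI)
  fix i j assume *: "i < dim_row (c \<cdot>\<^sub>m kron A B)" "j < dim_col (c \<cdot>\<^sub>m kron A B)"
  then have "dim_col B > 0" "dim_row B > 0" by (auto intro: gr0I)
  with * show "kron A (c \<cdot>\<^sub>m B) $$ (i, j) = (c \<cdot>\<^sub>m kron A B) $$ (i, j)"
    by (simp add: kron_index less_mult_imp_div_less)
qed simp_all

lemma tr_kron: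
  assumes A: "A \<in> carrier_mat a a" and B: "B \<in> carrier_mat b b"
  shows "tr (kron A B) = tr A * tr B"
proof (cases "b = 0")
  case False
  have "tr (kron A B) = (\<Sum>i<a * b. A $$ (i div b, i div b) * B $$ (i mod b, i mod b))"
    using assms by (auto simp: tr_def kron_index intro!: sum.cong)
  also have "\<dots> = (\<Sum>i<a. \<Sum>j<b. A $$ (i, i) * B $$ (j, j))"
    by (rule sum_div_mod) (use False in simp)
  finally show ?thesis using assms by (simp add: tr_def sum_product)
qed (use assms in \<open>auto simp: tr_def\<close>)

lemma tr_mult_commute:
  assumes "A \<in> carrier_mat m n" "B \<in> carrier_mat n m"
  shows "tr (A * B) = tr (B * A)"
proof -
  have "tr (A * B) = (\<Sum>i<m. \<Sum>k<n. A $$ (i, k) * B $$ (k, i))"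
    using assms by (auto simp: tr_def mult_index[OF assms] simp del: index_mult_mat(1) intro!: sum.cong)
  also have "\<dots> = (\<Sum>k<n. \<Sum>i<m. B $$ (k, i) * A $$ (i, k))"
    by (subst sum.swap) (simp add: mult.commute)
  also have "\<dots> = tr (B * A)"
    using assms by (auto simp: tr_def mult_index[OF assms(2,1)] simp del: index_mult_mat(1) intro!: sum.cong)
  finally show ?thesis .
qed

section \<open>Hilbert-Schmidt inner product and norm\<close>

lemma hs_inner_entries:
  assumes "A \<in> carrier_mat m n" "B \<in> carrier_mat m n"
  shows "hs_inner A B = (\<Sum>i<m. \<Sum>j<n. cnj (A $$ (i, j)) * B $$ (i, j))"
proof -
  have "hs_inner A B = (\<Sum>j<n. \<Sum>i<m. cnj (A $$ (i, j)) * B $$ (i, j))"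
    unfolding hs_inner_def tr_def using assms
    by (auto simp: mult_index[OF adj_carrier[OF assms(1)] assms(2)] simp del: index_mult_mat(1)
        intro!: sum.cong)
  then show ?thesis by (subst sum.swap)
qed

lemma hs_inner_kron:
  assumes "A \<in> carrier_mat a a" "C \<in> carrier_mat a a" "B \<in> carrier_mat b b" "D \<in> carrier_mat b b"
  shows "hs_inner (kron A B) (kron C D) = hs_inner A C * hs_inner B D"
  unfolding hs_inner_def adj_kron using assms
  by (subst kron_mult[of _ a a _ b b _ a _ b]) (auto intro!: tr_kron mult_carrier_mat)

lemma hs_inner_commute:
  assumes "A \<in> carrier_mat m n" "B \<in> carrier_mat m n"
  shows "hs_inner A B = cnj (hs_inner B A)"
  using assms by (simp add: hs_inner_entries mult.commute)

lemma hs_norm_sq: 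
  assumes "A \<in> carrier_mat m n"
  shows "(hs_norm A)\<^sup>2 = (\<Sum>i<m. \<Sum>j<n. (cmod (A $$ (i, j)))\<^sup>2)"
  using assms by (auto simp: hs_norm_def intro!: real_sqrt_pow2 sum_nonneg)

lemma hs_norm_sq_inner:
  assumes "A \<in> carrier_mat m n"
  shows "complex_of_real ((hs_norm A)\<^sup>2) = hs_inner A A"
  using assms by (simp add: hs_norm_sq hs_inner_entries complex_norm_square mult.commute del: of_real_power)

section \<open>Unitary conjugation\<close>

lemma mult_square [simp]:
  "A \<in> carrier_mat d d \<Longrightarrow> B \<in> carrier_mat d d \<Longrightarrow> A * B \<in> carrier_mat d d"
  by (rule mult_carrier_mat)

lemma assoc_square:
  assumes "A \<in> carrier_mat d d" "B \<in> carrier_mat d d" "C \<in> carrier_mat d d"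
  shows "(A * B) * C = A * (B * C)"
  using assms by (rule assoc_mult_mat)

text \<open>\<open>unitary\<close> only says that the adjoint is a left inverse; for square matrices
  a left inverse is also a right inverse.\<close>

lemma unitary_mult_adj:
  assumes "g \<in> carrier_mat d d" "unitary g"
  shows "g * adj g = 1\<^sub>m d" "adj g * g = 1\<^sub>m d"
proof -
  show *: "adj g * g = 1\<^sub>m d" using assms by (auto simp: unitary_def)
  show "g * adj g = 1\<^sub>m d"
    by (rule mat_mult_left_right_inverse[OF _ _ *]) (use assms in auto)
qed

lemma unitary_one [simp]: "unitary (1\<^sub>m d)"
  by (simp add: unitary_def)

lemma unitary_mult:
  assumes "g \<in> carrier_mat d d" "unitary g" "h \<in> carrier_mat d d" "unitary h"
  shows "unitary (g * h)"
proof -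
  have "adj (g * h) * (g * h) = adj h * (adj g * g) * h"
    using assms by (simp add: adj_mult[of g d d h d] assoc_square[where d = d])
  then show ?thesis using assms by (simp add: unitary_def unitary_mult_adj[OF assms(1,2)])
qed

lemma unitary_kron:
  assumes "g \<in> carrier_mat a a" "unitary g" "h \<in> carrier_mat b b" "unitary h"
  shows "unitary (kron g h)"
  using assms unitary_mult_adj[OF assms(1,2)] unitary_mult_adj[OF assms(3,4)]
  by (auto simp: unitary_def adj_kron kron_mult[of _ a a _ b b _ a _ b] kron_one)

lemma omega_carrier [simp]:
  "g \<in> carrier_mat d d \<Longrightarrow> A \<in> carrier_mat d d \<Longrightarrow> omega g A \<in> carrier_mat d d"
  "g \<in> carrier_mat d d \<Longrightarrow> A \<in> carrier_mat d d \<Longrightarrow> omega_adj g A \<in> carrier_mat d d"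
  by (auto simp: omega_def omega_adj_def intro!: mult_carrier_mat)

lemma omega_mult:
  assumes "g \<in> carrier_mat d d" "h \<in> carrier_mat d d" "A \<in> carrier_mat d d"
  shows "omega (g * h) A = omega g (omega h A)"
  using assms by (simp add: omega_def adj_mult[of g d d h d] assoc_square[where d = d])

lemma omega_smult:
  assumes "g \<in> carrier_mat d d" "A \<in> carrier_mat d d"
  shows "omega g (c \<cdot>\<^sub>m A) = c \<cdot>\<^sub>m omega g A"
  using assms by (simp add: omega_def mult_smult_assoc_mat[of _ d d _ d] mult_smult_distrib[of _ d d _ d])

lemma omega_id [simp]: "A \<in> carrier_mat d d \<Longrightarrow> omega (1\<^sub>m d) A = A"
  by (simp add: omega_def)

lemma omega_one [simp]: "g \<in> carrier_mat d d \<Longrightarrow> unitary g \<Longrightarrow> omega g (1\<^sub>m d) = 1\<^sub>m d"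
  by (simp add: omega_def unitary_mult_adj)

lemma omega_adj_omega:
  assumes "g \<in> carrier_mat d d" "unitary g" "A \<in> carrier_mat d d"
  shows "omega_adj g (omega g A) = A"
proof -
  have "omega_adj g (omega g A) = (adj g * g) * A * (adj g * g)"
    using assms(1,3) by (simp add: omega_def omega_adj_def assoc_square[where d = d])
  then show ?thesis using assms by (simp add: unitary_mult_adj)
qed

text \<open>The factor \<open>adj g * g\<close> cancels in the middle. Being multiplicative,
  conjugation transports commutation relations between Paulis.\<close>

lemma omega_mult_distrib:
  assumes "g \<in> carrier_mat d d" "unitary g" "A \<in> carrier_mat d d" "B \<in> carrier_mat d d"
  shows "omega g A * omega g B = omega g (A * B)"
proof -
  have "omega g A * omega g B = g * A * (adj g * g) * B * adj g"
    using assms(1,3,4) by (simp add: omega_def assoc_square[where d = d])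
  then show ?thesis using assms by (simp add: unitary_mult_adj omega_def assoc_square[where d = d])
qed

text \<open>Cyclicity of the trace moves \<open>g\<close> to the other side; hence
  \<open>omega_adj g\<close> is indeed the Hilbert-Schmidt adjoint of
  \<open>omega g\<close>.\<close>

lemma hs_inner_omega_adj:
  assumes "g \<in> carrier_mat d d" "A \<in> carrier_mat d d" "B \<in> carrier_mat d d"
  shows "hs_inner A (omega_adj g B) = hs_inner (omega g A) B"
proof -
  have "hs_inner A (omega_adj g B) = tr ((adj A * adj g * B) * g)"
    using assms by (simp add: hs_inner_def omega_adj_def assoc_square[where d = d])
  also have "\<dots> = tr (g * (adj A * adj g * B))"
    using assms by (intro tr_mult_commute) auto
  also have "\<dots> = hs_inner (omega g A) B"
    using assms
    by (simp add: hs_inner_def omega_def adj_mult[of _ d d _ d] assoc_square[where d = d])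
  finally show ?thesis .
qed

lemma hs_inner_omega:
  assumes "g \<in> carrier_mat d d" "unitary g" "A \<in> carrier_mat d d" "B \<in> carrier_mat d d"
  shows "hs_inner (omega g A) (omega g B) = hs_inner A B"
  using hs_inner_omega_adj[of g d A "omega g B"] omega_adj_omega[OF assms(1,2,4)] assms by simp

section \<open>The Pauli basis\<close>

lemma pauli_labels_0 [simp]: "pauli_labels 0 = {[]}"
  by (auto simp: pauli_labels_def)

lemma pauli_labels_Suc: "pauli_labels (Suc n) = (\<lambda>(p, t). p # t) ` (UNIV \<times> pauli_labels n)"
  by (auto simp: pauli_labels_def length_Suc_conv image_iff)

lemma finite_pauli_labels [simp]: "finite (pauli_labels n)"
  by (induction n) (simp_all add: pauli_labels_Suc)

lemma sum_pauli_labels_Suc: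
  "(\<Sum>a\<in>pauli_labels (Suc n). f a) = (\<Sum>p\<in>UNIV. \<Sum>t\<in>pauli_labels n. f (p # t))"
proof -
  have "inj_on (\<lambda>(p, t). p # t) (UNIV \<times> pauli_labels n)" by (auto intro!: inj_onI)
  then show ?thesis
    unfolding pauli_labels_Suc by (simp add: sum.reindex sum.cartesian_product case_prod_unfold)
qed

lemma card_pauli_labels [simp]: "card (pauli_labels n) = 4 ^ n"
proof -
  have "card (UNIV :: (bool \<times> bool) set) = 4" by (simp add: card_UNIV_bool flip: UNIV_Times_UNIV)
  moreover have "pauli_labels n = {a. set a \<subseteq> UNIV \<and> length a = n}" by (auto simp: pauli_labels_def)
  ultimately show ?thesis using card_lists_length_eq[of "UNIV :: (bool \<times> bool) set" n] by simp
qed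

lemma sum_bool_pairs:
  "(\<Sum>p\<in>UNIV. f p) = f (False, False) + f (False, True) + f (True, False) + f (True, True)"
  for f :: "bool \<times> bool \<Rightarrow> 'a :: comm_monoid_add"
  by (simp add: UNIV_bool add_ac flip: UNIV_Times_UNIV)

lemma sum_lessThan_2: "(\<Sum>k<2. f k) = f 0 + f (Suc 0)"
  for f :: "nat \<Rightarrow> 'a :: comm_monoid_add"
  by (simp add: numeral_2_eq_2)

lemma pauli1_dim [simp]: "dim_row (pauli1 p) = 2" "dim_col (pauli1 p) = 2"
  by (cases p; cases "fst p"; cases "snd p"; simp add: pauli1_def mat_of_rows_list_def)+

lemma pauli1_carrier [simp]: "pauli1 p \<in> carrier_mat 2 2"
  by (intro carrier_matI) simp_all

lemma pauli1_index:
  assumes "i < 2" "j < 2"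
  shows "pauli1 (x, z) $$ (i, j) =
    (if x then if i = j then 0 else if z then if i = 0 then - \<i> else \<i> else 1
     else if i \<noteq> j then 0 else if z \<and> i = 1 then - 1 else 1)"
  using assms by (auto simp: pauli1_def mat_of_rows_list_def less_2_cases_iff)

lemma pauli1_zero [simp]: "pauli1 (False, False) = 1\<^sub>m 2"
  by (rule eq_matI) (auto simp: pauli1_index)

lemma pauli_Nil [simp]: "pauli [] = 1\<^sub>m 1"
  by (simp add: pauli_def kron_list_def)

lemma pauli_Cons [simp]: "pauli (p # t) = kron (pauli1 p) (pauli t)"
  by (simp add: pauli_def kron_list_def)

lemma pauli_dim [simp]: "dim_row (pauli a) = 2 ^ length a" "dim_col (pauli a) = 2 ^ length a"
  by (induction a) simp_all

lemma pauli_carrier [simp]: "a \<in> pauli_labels n \<Longrightarrow> pauli a \<in> carrier_mat (2 ^ n) (2 ^ n)"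
  by (auto simp: pauli_labels_def)

lemma pauli_append: "pauli (a @ b) = kron (pauli a) (pauli b)"
  by (induction a) (simp_all add: kron_assoc del: One_nat_def)

lemma pauli_replicate_zero [simp]: "pauli (replicate n (False, False)) = 1\<^sub>m (2 ^ n)"
  by (induction n) (simp_all add: kron_one)

lemma replicate_pauli_labels [simp]: "replicate n p \<in> pauli_labels n"
  by (simp add: pauli_labels_def)

text \<open>Completeness relation for one qubit: summed against their conjugates, the four Pauli
  matrices pick out a single entry. It is the tensor factor in the relation for \<open>n\<close>
  qubits.\<close>

lemma pauli1_completeness:
  assumes "i < 2" "j < 2" "k < 2" "l < 2"
  shows "(\<Sum>p\<in>UNIV. pauli1 p $$ (i, j) * cnj (pauli1 p $$ (k, l))) = (if i = k \<and> j = l then 2 else 0)"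
  using assms by (auto simp: sum_bool_pairs pauli1_index less_2_cases_iff)

lemma pauli_completeness:
  assumes "i < 2 ^ n" "j < 2 ^ n" "k < 2 ^ n" "l < 2 ^ n"
  shows "(\<Sum>a\<in>pauli_labels n. pauli a $$ (i, j) * cnj (pauli a $$ (k, l)))
           = (if i = k \<and> j = l then 2 ^ n else 0)"
  using assms
proof (induction n arbitrary: i j k l)
  case (Suc n)
  let ?D = "2 ^ n :: nat"
  have lt: "x div ?D < 2" "x mod ?D < ?D" if "x < 2 ^ Suc n" for x
    using that by (auto simp: less_mult_imp_div_less)
  have eq: "x = y \<longleftrightarrow> x div ?D = y div ?D \<and> x mod ?D = y mod ?D" for x y
    by (metis div_mult_mod_eq)
  have "(\<Sum>a\<in>pauli_labels (Suc n). pauli a $$ (i, j) * cnj (pauli a $$ (k, l)))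
      = (\<Sum>p\<in>UNIV. \<Sum>t\<in>pauli_labels n.
          (pauli1 p $$ (i div ?D, j div ?D) * cnj (pauli1 p $$ (k div ?D, l div ?D)))
        * (pauli t $$ (i mod ?D, j mod ?D) * cnj (pauli t $$ (k mod ?D, l mod ?D))))"
    unfolding sum_pauli_labels_Suc using Suc.prems
    by (intro sum.cong) (auto simp: kron_index pauli_labels_def)
  also have "\<dots> = (\<Sum>p\<in>UNIV. pauli1 p $$ (i div ?D, j div ?D) * cnj (pauli1 p $$ (k div ?D, l div ?D)))
      * (\<Sum>t\<in>pauli_labels n. pauli t $$ (i mod ?D, j mod ?D) * cnj (pauli t $$ (k mod ?D, l mod ?D)))"
    by (simp only: sum_product)
  also have "\<dots> = (if i = k \<and> j = l then 2 ^ Suc n else 0)"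
    using Suc.IH[OF lt(2)[OF Suc.prems(1)] lt(2)[OF Suc.prems(2)] lt(2)[OF Suc.prems(3)] lt(2)[OF Suc.prems(4)]]
    using pauli1_completeness[OF lt(1)[OF Suc.prems(1)] lt(1)[OF Suc.prems(2)] lt(1)[OF Suc.prems(3)] lt(1)[OF Suc.prems(4)]]
    by (auto simp: eq[of i k] eq[of j l])
  finally show ?case .
qed simp

text \<open>Contract the completeness relation with the entries of \<open>A\<close>: after
  exchanging the sums only the term with \<open>(k, l) = (i, j)\<close> survives.\<close>

lemma pauli_expansion:
  assumes A: "A \<in> carrier_mat (2 ^ n) (2 ^ n)" and ij: "i < 2 ^ n" "j < 2 ^ n"
  shows "(\<Sum>a\<in>pauli_labels n. hs_inner (pauli a) A * pauli a $$ (i, j)) = 2 ^ n * A $$ (i, j)"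
proof -
  have "(\<Sum>a\<in>pauli_labels n. hs_inner (pauli a) A * pauli a $$ (i, j))
      = (\<Sum>a\<in>pauli_labels n. \<Sum>k<2 ^ n. \<Sum>l<2 ^ n.
            A $$ (k, l) * (pauli a $$ (i, j) * cnj (pauli a $$ (k, l))))"
    by (intro sum.cong refl) (simp add: hs_inner_entries[OF pauli_carrier A] sum_distrib_left sum_distrib_right mult_ac)
  also have "\<dots> = (\<Sum>k<2 ^ n. \<Sum>l<2 ^ n. \<Sum>a\<in>pauli_labels n.
            A $$ (k, l) * (pauli a $$ (i, j) * cnj (pauli a $$ (k, l))))"
    by (subst sum.swap, rule sum.cong[OF refl], rule sum.swap)
  also have "\<dots> = (\<Sum>k<2 ^ n. \<Sum>l<2 ^ n. if i = k then if j = l then 2 ^ n * A $$ (k, l) else 0 else 0)"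
    by (intro sum.cong refl) (use ij in \<open>simp add: pauli_completeness flip: sum_distrib_left\<close>)
  also have "\<dots> = (\<Sum>k<2 ^ n. if i = k then \<Sum>l<2 ^ n. if j = l then 2 ^ n * A $$ (k, l) else 0 else 0)"
    by (intro sum.cong refl) auto
  also have "\<dots> = 2 ^ n * A $$ (i, j)"
    using ij by simp
  finally show ?thesis .
qed

text \<open>Pauli coefficients determine all entries by \<open>pauli_expansion\<close>. This is how
  the inverse of the frame operator is pinned down.\<close>

lemma pauli_mat_eqI:
  assumes "A \<in> carrier_mat (2 ^ n) (2 ^ n)" "B \<in> carrier_mat (2 ^ n) (2 ^ n)"
    and "\<And>a. a \<in> pauli_labels n \<Longrightarrow> hs_inner (pauli a) A = hs_inner (pauli a) B"
  shows "A = B"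
proof (rule eq_matI)
  fix i j assume "i < dim_row B" "j < dim_col B"
  then have ij: "i < 2 ^ n" "j < 2 ^ n" using assms by auto
  have "2 ^ n * A $$ (i, j) = 2 ^ n * B $$ (i, j)"
    unfolding pauli_expansion[OF assms(1) ij, symmetric] pauli_expansion[OF assms(2) ij, symmetric]
    using assms(3) by simp
  then show "A $$ (i, j) = B $$ (i, j)" by simp
qed (use assms in auto)

text \<open>Insert the Pauli expansion of \<open>B\<close>. The factor \<open>2 ^ n\<close> is the
  squared Hilbert-Schmidt norm of a Pauli operator: the basis is orthogonal but not
  normalised.\<close>

lemma pauli_parseval:
  assumes A: "A \<in> carrier_mat (2 ^ n) (2 ^ n)" and B: "B \<in> carrier_mat (2 ^ n) (2 ^ n)"
  shows "(\<Sum>a\<in>pauli_labels n. cnj (hs_inner (pauli a) A) * hs_inner (pauli a) B) = 2 ^ n * hs_inner A B"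
proof -
  have "(\<Sum>a\<in>pauli_labels n. cnj (hs_inner (pauli a) A) * hs_inner (pauli a) B)
      = (\<Sum>a\<in>pauli_labels n. \<Sum>i<2 ^ n. \<Sum>j<2 ^ n.
           cnj (A $$ (i, j)) * (hs_inner (pauli a) B * pauli a $$ (i, j)))"
    by (intro sum.cong refl)
       (simp add: hs_inner_entries[OF pauli_carrier A] sum_distrib_right sum_distrib_left mult_ac)
  also have "\<dots> = (\<Sum>i<2 ^ n. \<Sum>j<2 ^ n. \<Sum>a\<in>pauli_labels n.
           cnj (A $$ (i, j)) * (hs_inner (pauli a) B * pauli a $$ (i, j)))"
    by (subst sum.swap, rule sum.cong[OF refl], rule sum.swap)
  also have "\<dots> = (\<Sum>i<2 ^ n. \<Sum>j<2 ^ n. cnj (A $$ (i, j)) * (2 ^ n * B $$ (i, j)))"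
    by (intro sum.cong refl) (simp add: pauli_expansion[OF B] flip: sum_distrib_left)
  also have "\<dots> = 2 ^ n * hs_inner A B"
    by (simp add: hs_inner_entries[OF A B] sum_distrib_left mult_ac)
  finally show ?thesis .
qed

lemma pauli_parseval_norm:
  assumes A: "A \<in> carrier_mat (2 ^ n) (2 ^ n)"
  shows "(\<Sum>a\<in>pauli_labels n. (cmod (hs_inner (pauli a) A))\<^sup>2) = 2 ^ n * (hs_norm A)\<^sup>2"
proof -
  have "complex_of_real (\<Sum>a\<in>pauli_labels n. (cmod (hs_inner (pauli a) A))\<^sup>2)
      = complex_of_real (2 ^ n * (hs_norm A)\<^sup>2)"
  proof -
    have "complex_of_real (2 ^ n * (hs_norm A)\<^sup>2) = 2 ^ n * hs_inner A A"
      using hs_norm_sq_inner[OF A] by simp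
    also have "\<dots> = complex_of_real (\<Sum>a\<in>pauli_labels n. (cmod (hs_inner (pauli a) A))\<^sup>2)"
      using pauli_parseval[OF A A]
      by (simp add: complex_norm_square mult.commute del: of_real_power)
    finally show ?thesis ..
  qed
  then show ?thesis by (simp only: of_real_eq_iff)
qed

lemma pauli1_orthogonal: "hs_inner (pauli1 p) (pauli1 q) = (if p = q then 2 else 0)"
  by (cases p; cases q) (auto simp: hs_inner_entries[of _ 2 2] sum_lessThan_2 pauli1_index)

lemma pauli_orthogonal:
  assumes "a \<in> pauli_labels n" "b \<in> pauli_labels n"
  shows "hs_inner (pauli a) (pauli b) = (if a = b then 2 ^ n else 0)"
  using assms
proof (induction n arbitrary: a b)
  case 0
  then show ?case by (simp add: hs_inner_def tr_def)
next
  case (Suc n)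
  then obtain p s q t where "a = p # s" "b = q # t" "s \<in> pauli_labels n" "t \<in> pauli_labels n"
    by (auto simp: pauli_labels_Suc)
  with Suc.IH[of s t] show ?case
    by (auto simp: hs_inner_kron[of _ 2 _ _ "2 ^ n"] pauli1_orthogonal)
qed

text \<open>The first component of a factor is its \<open>X\<close> part, so these are the labels of
  tensor products of the identity and \<open>Z\<close>, the diagonal Paulis.\<close>

definition ztype :: "(bool \<times> bool) list \<Rightarrow> bool" where
  "ztype a \<longleftrightarrow> (\<forall>p\<in>set a. \<not> fst p)"

lemma ztype_simps [simp]: "ztype []" "ztype (p # t) \<longleftrightarrow> \<not> fst p \<and> ztype t"
  by (auto simp: ztype_def)

lemma pauli_ztype_offdiag:
  assumes "ztype a" "i < 2 ^ length a" "j < 2 ^ length a" "i \<noteq> j"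
  shows "pauli a $$ (i, j) = 0"
  using assms
proof (induction a arbitrary: i j)
  case (Cons p t)
  let ?D = "2 ^ length t :: nat"
  have lt: "i div ?D < 2" "i mod ?D < ?D" "j div ?D < 2" "j mod ?D < ?D"
    using Cons.prems by (auto simp: less_mult_imp_div_less)
  have "i div ?D \<noteq> j div ?D \<or> i mod ?D \<noteq> j mod ?D"
    using Cons.prems(4) by (metis div_mult_mod_eq)
  then show ?case
    using Cons.IH[OF _ lt(2,4)] Cons.prems lt by (cases p) (auto simp: kron_index pauli1_index)
qed simp

text \<open>The diagonals of \<open>X\<close> and \<open>Y\<close> vanish, those of the identity and
  \<open>Z\<close> consist of 1 and -1; a single factor with an \<open>X\<close> part kills the
  whole diagonal.\<close>

lemma cmod_pauli_diag:
  assumes "i < 2 ^ length a"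
  shows "cmod (pauli a $$ (i, i)) = of_bool (ztype a)"
  using assms
proof (induction a arbitrary: i)
  case (Cons p t)
  let ?D = "2 ^ length t :: nat"
  have lt: "i div ?D < 2" "i mod ?D < ?D"
    using Cons.prems by (auto simp: less_mult_imp_div_less)
  show ?case
    using Cons.IH[OF lt(2)] Cons.prems lt
    by (cases p) (auto simp: kron_index pauli1_index norm_mult)
qed simp

lemma pauli1_Z_anticommute:
  assumes "fst p"
  shows "pauli1 (False, True) * pauli1 p = - 1 \<cdot>\<^sub>m (pauli1 p * pauli1 (False, True))"
  using assms
  by (cases p) (auto intro!: eq_matI simp: mult_index[of _ 2 2 _ 2] less_2_cases_iff
      sum_lessThan_2 pauli1_index simp del: index_mult_mat(1))

text \<open>\<open>Z\<close> on the most significant qubit. The argument counts the remaining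
  qubits, so the label has length \<open>n + 1\<close>. It is the normal form of non-identity
  labels.\<close>

abbreviation pauli_Z :: "nat \<Rightarrow> (bool \<times> bool) list" where
  "pauli_Z n \<equiv> (False, True) # replicate n (False, False)"

text \<open>A first factor \<open>X\<close> or \<open>Y\<close> would anticommute with
  \<open>Z\<close>. The product would then equal its own negative and vanish, and multiplying by the
  involution \<open>Z\<close> once more would make the Pauli operator itself zero, contradicting its
  norm.\<close>

lemma pauli_Z_commute_imp:
  assumes comm: "pauli (pauli_Z n) * pauli (p # t) = pauli (p # t) * pauli (pauli_Z n)"
    and t: "t \<in> pauli_labels n"
  shows "\<not> fst p"
proof
  assume p: "fst p"
  let ?Z = "kron (pauli1 (False, True)) (1\<^sub>m (2 ^ n))" and ?B = "kron (pauli1 p) (pauli t)"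
  have B: "?B \<in> carrier_mat (2 * 2 ^ n) (2 * 2 ^ n)" and Z: "?Z \<in> carrier_mat (2 * 2 ^ n) (2 * 2 ^ n)"
    using t by auto
  have "?Z * ?B = kron (pauli1 (False, True) * pauli1 p) (pauli t)"
    using t by (subst kron_mult[of _ 2 2 _ "2 ^ n" "2 ^ n" _ 2 _ "2 ^ n"])
      (auto simp: left_mult_one_mat[OF pauli_carrier])
  also have "\<dots> = - 1 \<cdot>\<^sub>m kron (pauli1 p * pauli1 (False, True)) (pauli t)"
    by (simp add: pauli1_Z_anticommute[OF p] kron_smult_left)
  also have "kron (pauli1 p * pauli1 (False, True)) (pauli t) = ?B * ?Z"
    using t by (subst kron_mult[of _ 2 2 _ "2 ^ n" "2 ^ n" _ 2 _ "2 ^ n"])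
      (auto simp: right_mult_one_mat[OF pauli_carrier])
  finally have "?B * ?Z = - 1 \<cdot>\<^sub>m (?B * ?Z)"
    using comm by simp
  moreover have BZ: "?B * ?Z \<in> carrier_mat (2 * 2 ^ n) (2 * 2 ^ n)" using B Z by simp
  ultimately have 0: "(?B * ?Z) $$ (i, j) = 0" if "i < 2 * 2 ^ n" "j < 2 * 2 ^ n" for i j
  proof -
    have "(?B * ?Z) $$ (i, j) = (- 1 \<cdot>\<^sub>m (?B * ?Z)) $$ (i, j)"
      using \<open>?B * ?Z = - 1 \<cdot>\<^sub>m (?B * ?Z)\<close> by simp
    also have "\<dots> = - (?B * ?Z) $$ (i, j)"
      using that BZ by (subst index_smult_mat) auto
    finally show ?thesis by simp
  qed
  have "?B * ?Z = 0\<^sub>m (2 * 2 ^ n) (2 * 2 ^ n)"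
    using BZ 0 by (intro eq_matI) (auto simp del: index_mult_mat(1))
  moreover have "?Z * ?Z = 1\<^sub>m (2 * 2 ^ n)"
  proof -
    have "pauli1 (False, True) * pauli1 (False, True) = 1\<^sub>m 2"
      by (auto intro!: eq_matI simp: mult_index[of _ 2 2 _ 2] less_2_cases_iff
          sum_lessThan_2 pauli1_index simp del: index_mult_mat(1))
    then show ?thesis
      by (subst kron_mult[of _ 2 2 _ "2 ^ n" "2 ^ n" _ 2 _ "2 ^ n"]) (auto simp: kron_one)
  qed
  moreover have "?B * ?Z * ?Z = ?B * (?Z * ?Z)" using B Z by (intro assoc_square)
  ultimately have "?B = 0\<^sub>m (2 * 2 ^ n) (2 * 2 ^ n)" using right_mult_one_mat[OF B] Z by simp
  then have "hs_inner (pauli (p # t)) (pauli (p # t)) = 0"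
    by (simp add: hs_inner_entries[of _ "2 * 2 ^ n" "2 * 2 ^ n"])
  then show False
    using pauli_orthogonal[of "p # t" "Suc n" "p # t"] t by (simp add: pauli_labels_def)
qed

section \<open>Clifford gates permute the Pauli operators\<close>

text \<open>The phase is quantified separately for each label and not recorded, since only its
  modulus enters the estimates. Outside \<open>pauli_labels n\<close> the map \<open>f\<close> is
  unconstrained, so \<open>g\<close> determines it only on labels of length
  \<open>n\<close>.\<close>

definition pauli_perm ::
  "nat \<Rightarrow> complex mat \<Rightarrow> ((bool \<times> bool) list \<Rightarrow> (bool \<times> bool) list) \<Rightarrow> bool" where
  "pauli_perm n g f \<longleftrightarrow> g \<in> carrier_mat (2 ^ n) (2 ^ n) \<and> unitary g \<and>
     (\<forall>a\<in>pauli_labels n. f a \<in> pauli_labels n \<and>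
        (\<exists>s. cmod s = 1 \<and> omega g (pauli a) = s \<cdot>\<^sub>m pauli (f a)))"

lemma pauli_permD:
  assumes "pauli_perm n g f"
  shows "g \<in> carrier_mat (2 ^ n) (2 ^ n)" "unitary g"
    and "a \<in> pauli_labels n \<Longrightarrow> f a \<in> pauli_labels n"
    and "a \<in> pauli_labels n \<Longrightarrow> \<exists>s. cmod s = 1 \<and> omega g (pauli a) = s \<cdot>\<^sub>m pauli (f a)"
  using assms by (auto simp: pauli_perm_def)

lemma one_smult_mat [simp]: "(1 :: complex) \<cdot>\<^sub>m A = A"
  by (rule eq_matI) simp_all

lemma smult_smult_mat: "(s :: complex) \<cdot>\<^sub>m (t \<cdot>\<^sub>m A) = (s * t) \<cdot>\<^sub>m A"
  by (rule eq_matI) simp_all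

lemma pauli_perm_id: "pauli_perm n (1\<^sub>m (2 ^ n)) id"
  unfolding pauli_perm_def by (auto intro!: exI[of _ "1 :: complex"] simp: omega_id[OF pauli_carrier])

lemma pauli_perm_comp:
  assumes "pauli_perm n g f" "pauli_perm n h f'"
  shows "pauli_perm n (g * h) (f \<circ> f')"
  unfolding pauli_perm_def
proof (intro conjI ballI)
  note g = pauli_permD[OF assms(1)] and h = pauli_permD[OF assms(2)]
  show "g * h \<in> carrier_mat (2 ^ n) (2 ^ n)" "unitary (g * h)"
    using g h by (auto intro: unitary_mult)
  fix a assume a: "a \<in> pauli_labels n"
  then show "(f \<circ> f') a \<in> pauli_labels n" using g h by simp
  obtain s where s: "cmod s = 1" "omega h (pauli a) = s \<cdot>\<^sub>m pauli (f' a)" using h(4) a by blast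
  obtain t where t: "cmod t = 1" "omega g (pauli (f' a)) = t \<cdot>\<^sub>m pauli (f (f' a))"
    using g(4) h(3) a by blast
  have "omega (g * h) (pauli a) = (s * t) \<cdot>\<^sub>m pauli ((f \<circ> f') a)"
    using g h a s t by (simp add: omega_mult[of _ "2 ^ n"] omega_smult[of _ "2 ^ n"] smult_smult_mat)
  then show "\<exists>s. cmod s = 1 \<and> omega (g * h) (pauli a) = s \<cdot>\<^sub>m pauli ((f \<circ> f') a)"
    using s t by (intro exI[of _ "s * t"]) (simp add: norm_mult)
qed

lemma hs_inner_smult:
  assumes "A \<in> carrier_mat m k" "B \<in> carrier_mat m k"
  shows "hs_inner (s \<cdot>\<^sub>m A) (t \<cdot>\<^sub>m B) = cnj s * t * hs_inner A B"
  using assms by (simp add: hs_inner_entries[of _ m k] sum_distrib_left mult_ac)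

lemma hs_inner_smult_right:
  assumes "A \<in> carrier_mat m k" "B \<in> carrier_mat m k"
  shows "hs_inner A (t \<cdot>\<^sub>m B) = t * hs_inner A B"
  using hs_inner_smult[OF assms, of 1 t] by simp

text \<open>Conjugation by a unitary preserves the Hilbert-Schmidt inner product. Labels with a
  common image have parallel images, so they cannot be orthogonal.\<close>

lemma pauli_perm_inj:
  assumes "pauli_perm n g f"
  shows "inj_on f (pauli_labels n)"
proof (rule inj_onI)
  fix a b assume a: "a \<in> pauli_labels n" and b: "b \<in> pauli_labels n" and eq: "f a = f b"
  note g = pauli_permD[OF assms]
  obtain s where s: "cmod s = 1" "omega g (pauli a) = s \<cdot>\<^sub>m pauli (f a)" using g(4) a by blast
  obtain t where t: "cmod t = 1" "omega g (pauli b) = t \<cdot>\<^sub>m pauli (f b)" using g(4) b by blast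
  have "hs_inner (pauli a) (pauli b) = hs_inner (omega g (pauli a)) (omega g (pauli b))"
    using hs_inner_omega[OF g(1,2)] a b by simp
  also have "\<dots> = cnj s * t * 2 ^ n"
    using s t a b g(3)[OF a] g(3)[OF b] eq
    by (simp add: hs_inner_smult[of _ "2 ^ n" "2 ^ n"] pauli_orthogonal)
  also have "\<dots> \<noteq> 0" using s t by auto
  finally show "a = b" using pauli_orthogonal[OF a b] by (auto split: if_splits)
qed

text \<open>Conjugation fixes the identity, which is thus parallel to the Pauli operator of its
  image label; orthogonality leaves only the identity label.\<close>

lemma pauli_perm_zero:
  assumes "pauli_perm n g f"
  shows "f (replicate n (False, False)) = replicate n (False, False)"
proof -
  let ?z = "replicate n (False, False)"
  note g = pauli_permD[OF assms]
  obtain s where s: "cmod s = 1" "omega g (pauli ?z) = s \<cdot>\<^sub>m pauli (f ?z)"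
    using g(4)[OF replicate_pauli_labels] by blast
  then have "pauli ?z = s \<cdot>\<^sub>m pauli (f ?z)" using g(1,2) by simp
  then have "hs_inner (pauli ?z) (pauli ?z) = hs_inner (pauli ?z) (s \<cdot>\<^sub>m pauli (f ?z))"
    by (rule arg_cong)
  also have "\<dots> = s * hs_inner (pauli ?z) (pauli (f ?z))"
    by (rule hs_inner_smult_right[of _ "2 ^ n" "2 ^ n"]) (use g(3) in \<open>auto intro!: pauli_carrier\<close>)
  finally have "hs_inner (pauli ?z) (pauli ?z) = s * hs_inner (pauli ?z) (pauli (f ?z))" .
  then show ?thesis
    using s(1) pauli_orthogonal[OF replicate_pauli_labels, of "f ?z" n "(False, False)"]
      pauli_orthogonal[OF replicate_pauli_labels replicate_pauli_labels, of n "(False, False)" "(False, False)"]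
      g(3)[of ?z] by (auto split: if_splits)
qed

lemma omega_kron:
  assumes "g \<in> carrier_mat a a" "A \<in> carrier_mat a a" "h \<in> carrier_mat b b" "B \<in> carrier_mat b b"
  shows "omega (kron g h) (kron A B) = kron (omega g A) (omega h B)"
  using assms
  by (simp add: omega_def adj_kron kron_mult[of _ a a _ b b _ a _ b])

definition pauli1_perm :: "complex mat \<Rightarrow> (bool \<times> bool \<Rightarrow> bool \<times> bool) \<Rightarrow> bool" where
  "pauli1_perm U \<phi> \<longleftrightarrow> U \<in> carrier_mat 2 2 \<and> unitary U \<and>
     (\<forall>p. \<exists>s. cmod s = 1 \<and> omega U (pauli1 p) = s \<cdot>\<^sub>m pauli1 (\<phi> p))"

lemma pauli1_permD:
  assumes "pauli1_perm U \<phi>"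
  shows "U \<in> carrier_mat 2 2" "unitary U"
    and "\<exists>s. cmod s = 1 \<and> omega U (pauli1 p) = s \<cdot>\<^sub>m pauli1 (\<phi> p)"
  using assms unfolding pauli1_perm_def by blast+

lemma pauli_single: "pauli [p] = pauli1 p"
  by (simp del: One_nat_def)

text \<open>Cut the label at position \<open>i\<close> into three tensor factors; conjugation acts
  factorwise and the phase is pulled out of the Kronecker product.\<close>

lemma pauli_perm_on_qubit:
  assumes U: "pauli1_perm U \<phi>" and i: "i < n"
  shows "pauli_perm n (on_qubit n i U) (\<lambda>a. a[i := \<phi> (a ! i)])"
  unfolding pauli_perm_def
proof (intro conjI ballI)
  note U' = pauli1_permD[OF U]
  let ?m = "n - i - 1"
  have n: "2 ^ n = 2 ^ i * (2 * 2 ^ ?m :: nat)"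
  proof -
    have "2 ^ n = (2 :: nat) ^ (i + Suc ?m)" using i by simp
    then show ?thesis by (simp only: power_add power_Suc)
  qed
  have c: "kron U (1\<^sub>m (2 ^ ?m)) \<in> carrier_mat (2 * 2 ^ ?m) (2 * 2 ^ ?m)" using U'(1) by simp
  show "on_qubit n i U \<in> carrier_mat (2 ^ n) (2 ^ n)"
    unfolding on_qubit_def n using c by simp
  show "unitary (on_qubit n i U)"
    unfolding on_qubit_def using U'(1,2) c by (intro unitary_kron[OF _ _ c] unitary_kron) auto
  fix a assume a: "a \<in> pauli_labels n"
  then show "a[i := \<phi> (a ! i)] \<in> pauli_labels n" by (simp add: pauli_labels_def)
  obtain s where s: "cmod s = 1" "omega U (pauli1 (a ! i)) = s \<cdot>\<^sub>m pauli1 (\<phi> (a ! i))"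
    using U'(3) by blast
  have len: "take i a \<in> pauli_labels i" "drop (Suc i) a \<in> pauli_labels ?m" "i < length a"
    using a i by (auto simp: pauli_labels_def)
  have "omega (on_qubit n i U) (pauli (take i a @ a ! i # drop (Suc i) a))
      = kron (pauli (take i a)) (kron (s \<cdot>\<^sub>m pauli1 (\<phi> (a ! i))) (pauli (drop (Suc i) a)))"
    unfolding on_qubit_def pauli_append pauli_Cons s(2)[symmetric] using len U'(1) c
    by (subst omega_kron[of _ "2 ^ i" _ _ "2 * 2 ^ ?m"])
       (auto simp: omega_kron[of _ 2 _ _ "2 ^ ?m"] omega_id[OF pauli_carrier])
  also have "\<dots> = s \<cdot>\<^sub>m pauli (take i a @ \<phi> (a ! i) # drop (Suc i) a)"
    by (simp add: pauli_append kron_smult_left kron_smult_right)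
  finally have "omega (on_qubit n i U) (pauli a) = s \<cdot>\<^sub>m pauli (a[i := \<phi> (a ! i)])"
    using len(3) by (simp add: upd_conv_take_nth_drop flip: id_take_nth_drop)
  with s(1) show "\<exists>s. cmod s = 1 \<and> omega (on_qubit n i U) (pauli a) = s \<cdot>\<^sub>m pauli (a[i := \<phi> (a ! i)])"
    by blast
qed

section \<open>The Hadamard and phase gates\<close>

lemma hadamard1_carrier [simp]: "hadamard1 \<in> carrier_mat 2 2"
  by (auto simp: hadamard1_def mat_of_rows_list_def)

lemma phase1_carrier [simp]: "phase1 \<in> carrier_mat 2 2"
  by (auto simp: phase1_def mat_of_rows_list_def)

lemma omega_index_2:
  assumes "g \<in> carrier_mat 2 2" "A \<in> carrier_mat 2 2" "i < 2" "j < 2"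
  shows "omega g A $$ (i, j) =
    (g $$ (i, 0) * A $$ (0, 0) + g $$ (i, 1) * A $$ (1, 0)) * cnj (g $$ (j, 0))
  + (g $$ (i, 0) * A $$ (0, 1) + g $$ (i, 1) * A $$ (1, 1)) * cnj (g $$ (j, 1))"
  unfolding omega_def using assms
  by (subst mult_index[of _ 2 2 _ 2])
     (auto simp: sum_lessThan_2 mult_index[OF assms(1,2)] simp del: index_mult_mat(1))

lemma unitary_2I:
  assumes "g \<in> carrier_mat 2 2"
    and "\<And>i j. i < 2 \<Longrightarrow> j < 2 \<Longrightarrow>
      cnj (g $$ (0, i)) * g $$ (0, j) + cnj (g $$ (1, i)) * g $$ (1, j) = (if i = j then 1 else 0)"
  shows "unitary g"
proof -
  have "adj g * g = 1\<^sub>m 2"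
    using assms by (intro eq_matI)
      (auto simp: mult_index[OF adj_carrier[OF assms(1)] assms(1)] sum_lessThan_2 simp del: index_mult_mat(1))
  then show ?thesis using assms by (auto simp: unitary_def)
qed

lemma hadamard1_perm: "pauli1_perm hadamard1 (\<lambda>p. (snd p, fst p))"
proof -
  define c :: complex where "c = 1 / of_real (sqrt 2)"
  have c: "c * c = 1 / 2" "cnj c = c"
    by (simp_all add: c_def flip: of_real_mult)
  then have c': "c * (c * x) = x / 2" for x by (metis mult.assoc mult.left_neutral times_divide_eq_left)
  have H: "hadamard1 $$ (i, j) = (if i = 1 \<and> j = 1 then - c else c)" if "i < 2" "j < 2" for i j
    using that by (auto simp: hadamard1_def mat_of_rows_list_def less_2_cases_iff c_def)
  have "unitary hadamard1"
    by (rule unitary_2I) (auto simp: H c less_2_cases_iff)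
  \<comment> \<open>\<open>H\<close> exchanges \<open>X\<close> and \<open>Z\<close> and sends
    \<open>Y\<close> to \<open>- Y\<close>, the only case with a sign.\<close>
  moreover have "\<exists>s. cmod s = 1 \<and> omega hadamard1 (pauli1 p) = s \<cdot>\<^sub>m pauli1 (snd p, fst p)" for p
    by (rule exI[of _ "if fst p \<and> snd p then - 1 else 1"], cases p)
       (auto intro!: eq_matI simp: omega_index_2 H c c' pauli1_index less_2_cases_iff algebra_simps
          carrier_matD[OF omega_carrier(1)[of _ 2]])
  ultimately show ?thesis by (auto simp: pauli1_perm_def)
qed

lemma phase1_perm: "pauli1_perm phase1 (\<lambda>p. (fst p, fst p \<noteq> snd p))"
proof -
  have S: "phase1 $$ (i, j) = (if i = j then if i = 0 then 1 else \<i> else 0)" if "i < 2" "j < 2" for i j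
    using that by (auto simp: phase1_def mat_of_rows_list_def less_2_cases_iff)
  have "unitary phase1"
    by (rule unitary_2I) (auto simp: S less_2_cases_iff)
  \<comment> \<open>\<open>S\<close> sends \<open>X\<close> to \<open>Y\<close> and \<open>Y\<close>
    to \<open>- X\<close> and fixes \<open>Z\<close>; again only \<open>Y\<close> acquires a
    sign.\<close>
  moreover have "\<exists>s. cmod s = 1 \<and> omega phase1 (pauli1 p) = s \<cdot>\<^sub>m pauli1 (fst p, fst p \<noteq> snd p)" for p
    by (rule exI[of _ "if fst p \<and> snd p then - 1 else 1"], cases p)
       (auto intro!: eq_matI simp: omega_index_2 S pauli1_index less_2_cases_iff
          carrier_matD[OF omega_carrier(1)[of _ 2]])
  ultimately show ?thesis by (auto simp: pauli1_perm_def)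
qed

section \<open>CNOT as a permutation of basis states\<close>

lemma qbit_bit: "qbit n i x \<longleftrightarrow> bit x (n - 1 - i)"
  by (simp add: qbit_def bit_iff_odd)

text \<open>An entry of a tensor product is the product over the qubits of the entries at the row
  bit and the column bit. In this form a permutation of basis states that changes single bits can be
  followed factor by factor.\<close>

lemma pauli_index_prod:
  assumes "length a = n" "r < 2 ^ n" "c < 2 ^ n"
  shows "pauli a $$ (r, c) = (\<Prod>k<n. pauli1 (a ! k) $$ (of_bool (qbit n k r), of_bool (qbit n k c)))"
  using assms
proof (induction a arbitrary: n r c)
  case (Cons p t)
  define m where "m = length t"
  then have n: "n = Suc m" using Cons.prems by simp
  let ?D = "2 ^ m :: nat"
  have hd: "x div ?D = of_bool (qbit n 0 x)" if "x < 2 ^ n" for x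
  proof -
    have "x div ?D < 2" using that by (simp add: n less_mult_imp_div_less)
    then show ?thesis by (auto simp: qbit_def n less_2_cases_iff)
  qed
  have tl: "qbit n (Suc k) x = qbit m k (x mod ?D)" if "k < m" for k x
    using that by (auto simp: qbit_bit n bit_take_bit_iff simp flip: take_bit_eq_mod)
  have "pauli (p # t) $$ (r, c) = pauli1 p $$ (r div ?D, c div ?D) * pauli t $$ (r mod ?D, c mod ?D)"
    using Cons.prems by (auto simp: kron_index m_def)
  also have "pauli t $$ (r mod ?D, c mod ?D)
    = (\<Prod>k<m. pauli1 (t ! k) $$ (of_bool (qbit m k (r mod ?D)), of_bool (qbit m k (c mod ?D))))"
    by (rule Cons.IH) (simp_all add: m_def)
  also have "\<dots> = (\<Prod>k<m. pauli1 ((p # t) ! Suc k) $$ (of_bool (qbit n (Suc k) r), of_bool (qbit n (Suc k) c)))"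
    by (intro prod.cong refl) (simp add: tl)
  finally show ?case
    unfolding hd[OF Cons.prems(2)] hd[OF Cons.prems(3)] unfolding n by (simp only: prod.lessThan_Suc_shift nth_Cons_0 comp_def)
qed simp

lemma flip_bit_lt:
  assumes "x < 2 ^ n" "j < n"
  shows "flip_bit n j x < 2 ^ n"
proof (cases "qbit n j x")
  case False
  have "flip_bit n j x = set_bit (n - 1 - j) x"
    using False by (simp add: flip_bit_def qbit_bit set_bit_eq)
  also have "\<dots> < 2 ^ n"
  proof -
    have "\<not> n \<le> n - 1 - j" using assms by simp
    then have "take_bit n (set_bit (n - 1 - j) x) = set_bit (n - 1 - j) x"
      using assms by (simp add: take_bit_set_bit_eq take_bit_nat_eq_self)
    then show ?thesis by (simp add: take_bit_nat_eq_self_iff)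
  qed
  finally show ?thesis .
qed (use assms in \<open>auto simp: flip_bit_def\<close>)

lemma qbit_flip_bit:
  assumes "j < n" "k < n"
  shows "qbit n k (flip_bit n j x) \<longleftrightarrow> (if k = j then \<not> qbit n j x else qbit n k x)"
proof -
  \<comment> \<open>Adding or subtracting the power of two sets or clears exactly one bit, without a
    carry, so the lemmas on bits apply.\<close>
  have eq: "flip_bit n j x = (if qbit n j x then unset_bit (n - 1 - j) x else set_bit (n - 1 - j) x)"
  proof (cases "qbit n j x")
    case True
    let ?m = "n - 1 - j"
    have "set_bit ?m (unset_bit ?m x) = x"
      using True by (intro bit_eqI) (auto simp: qbit_bit bit_set_bit_iff bit_unset_bit_iff)
    moreover have "set_bit ?m (unset_bit ?m x) = unset_bit ?m x + 2 ^ ?m"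
      by (simp add: set_bit_eq bit_unset_bit_iff)
    ultimately show ?thesis using True by (simp add: flip_bit_def)
  qed (simp add: flip_bit_def qbit_bit set_bit_eq)
  have "n - 1 - k = n - 1 - j \<longleftrightarrow> k = j" using assms by auto
  then show ?thesis unfolding eq by (auto simp: qbit_bit bit_set_bit_iff bit_unset_bit_iff)
qed

lemma flip_bit_flip_bit:
  assumes "j < n"
  shows "flip_bit n j (flip_bit n j x) = x"
proof (cases "qbit n j x")
  case True
  then have "2 ^ (n - 1 - j) \<le> x"
    by (metis qbit_def div_less even_zero not_le)
  then show ?thesis
    using True qbit_flip_bit[OF assms assms, of x] by (simp add: flip_bit_def)
next
  case False
  then show ?thesis
    using qbit_flip_bit[OF assms assms, of x] by (simp add: flip_bit_def)
qed

text \<open>The permutation of basis states whose matrix is \<open>cnot n i j\<close>. It is an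
  involution, so rows and columns of the matrix can be treated alike.\<close>

definition cnot_index :: "nat \<Rightarrow> nat \<Rightarrow> nat \<Rightarrow> nat \<Rightarrow> nat" where
  "cnot_index n i j x = (if qbit n i x then flip_bit n j x else x)"

lemma cnot_index_props:
  assumes "i < n" "j < n" "i \<noteq> j"
  shows "x < 2 ^ n \<Longrightarrow> cnot_index n i j x < 2 ^ n"
    and "cnot_index n i j (cnot_index n i j x) = x"
    and "k < n \<Longrightarrow> qbit n k (cnot_index n i j x) \<longleftrightarrow> (if k = j then qbit n j x \<noteq> qbit n i x else qbit n k x)"
  using assms by (auto simp: cnot_index_def flip_bit_lt qbit_flip_bit flip_bit_flip_bit)

lemma cnot_carrier [simp]: "cnot n i j \<in> carrier_mat (2 ^ n) (2 ^ n)"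
  by (simp add: cnot_def)

lemma cnot_index:
  assumes "i < n" "j < n" "i \<noteq> j" "r < 2 ^ n" "c < 2 ^ n"
  shows "cnot n i j $$ (r, c) = (if r = cnot_index n i j c then 1 else 0)"
    and "cnot n i j $$ (r, c) = (if c = cnot_index n i j r then 1 else 0)"
proof -
  show "cnot n i j $$ (r, c) = (if r = cnot_index n i j c then 1 else 0)"
    using assms by (simp add: cnot_def cnot_index_def)
  moreover have "r = cnot_index n i j c \<longleftrightarrow> c = cnot_index n i j r"
    using cnot_index_props(2)[OF assms(1-3)] by metis
  ultimately show "cnot n i j $$ (r, c) = (if c = cnot_index n i j r then 1 else 0)" by simp
qed

lemma unitary_cnot:
  assumes "i < n" "j < n" "i \<noteq> j"
  shows "unitary (cnot n i j)"
proof -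
  let ?C = "cnot n i j" and ?\<pi> = "cnot_index n i j"
  have "adj ?C * ?C = 1\<^sub>m (2 ^ n)"
  proof (rule eq_matI)
    fix r c assume "r < dim_row (1\<^sub>m (2 ^ n) :: complex mat)" "c < dim_col (1\<^sub>m (2 ^ n) :: complex mat)"
    then have rc: "r < 2 ^ n" "c < 2 ^ n" by auto
    have "(adj ?C * ?C) $$ (r, c) = (\<Sum>k<2 ^ n. adj ?C $$ (r, k) * ?C $$ (k, c))"
      by (rule mult_index) (use rc in auto)
    also have "\<dots> = (\<Sum>k<2 ^ n. if k = ?\<pi> c then if ?\<pi> c = ?\<pi> r then 1 else 0 else 0)"
      using rc by (intro sum.cong refl)
        (auto simp: cnot_index(1)[OF assms] carrier_matD[OF cnot_carrier])
    also have "\<dots> = (if ?\<pi> c = ?\<pi> r then 1 else 0)"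
      using cnot_index_props(1)[OF assms rc(2)] by simp
    also have "?\<pi> c = ?\<pi> r \<longleftrightarrow> r = c" using cnot_index_props(2)[OF assms] by metis
    finally show "(adj ?C * ?C) $$ (r, c) = 1\<^sub>m (2 ^ n) $$ (r, c)" using rc by simp
  qed (simp_all add: carrier_matD[OF cnot_carrier])
  then show ?thesis by (simp add: unitary_def carrier_matD[OF cnot_carrier])
qed

lemma omega_cnot_index:
  assumes ij: "i < n" "j < n" "i \<noteq> j" and A: "A \<in> carrier_mat (2 ^ n) (2 ^ n)"
    and rc: "r < 2 ^ n" "c < 2 ^ n"
  shows "omega (cnot n i j) A $$ (r, c) = A $$ (cnot_index n i j r, cnot_index n i j c)"
proof -
  let ?C = "cnot n i j" and ?\<pi> = "cnot_index n i j"
  have 1: "(?C * A) $$ (r, l) = A $$ (?\<pi> r, l)" if l: "l < 2 ^ n" for l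
  proof -
    have "(?C * A) $$ (r, l) = (\<Sum>k<2 ^ n. ?C $$ (r, k) * A $$ (k, l))"
      by (rule mult_index[OF cnot_carrier A rc(1) l])
    also have "\<dots> = (\<Sum>k<2 ^ n. if k = ?\<pi> r then A $$ (?\<pi> r, l) else 0)"
      using rc by (intro sum.cong refl) (auto simp: cnot_index(2)[OF ij])
    finally show ?thesis using cnot_index_props(1)[OF ij rc(1)] by simp
  qed
  have "omega ?C A $$ (r, c) = (\<Sum>l<2 ^ n. (?C * A) $$ (r, l) * adj ?C $$ (l, c))"
    unfolding omega_def by (rule mult_index) (use A rc in auto)
  also have "\<dots> = (\<Sum>l<2 ^ n. if l = ?\<pi> c then A $$ (?\<pi> r, ?\<pi> c) else 0)"
    using rc by (intro sum.cong refl)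
      (auto simp: 1 cnot_index(2)[OF ij] carrier_matD[OF cnot_carrier] simp del: index_mult_mat(1))
  finally show ?thesis using cnot_index_props(1)[OF ij rc(2)] by simp
qed

text \<open>CNOT copies an \<open>X\<close> part from the control \<open>i\<close> to the target
  \<open>j\<close> and a \<open>Z\<close> part from the target back to the control. Both updates
  read the old label.\<close>

definition cnot_label :: "nat \<Rightarrow> nat \<Rightarrow> (bool \<times> bool) list \<Rightarrow> (bool \<times> bool) list" where
  "cnot_label i j a = a[i := (fst (a ! i), snd (a ! i) \<noteq> snd (a ! j)),
                        j := (fst (a ! j) \<noteq> fst (a ! i), snd (a ! j))]"

text \<open>A check of all cases on two qubits, with \<open>p\<close> at the control and
  \<open>q\<close> at the target. The sign is -1 in exactly two cases: \<open>X\<close> tensor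
  \<open>Z\<close> goes to minus \<open>Y\<close> tensor \<open>Y\<close>, and conversely.\<close>

lemma pauli1_cnot:
  fixes r r' c c' :: bool
  shows "pauli1 p $$ (of_bool r, of_bool c) * pauli1 q $$ (of_bool (r' \<noteq> r), of_bool (c' \<noteq> c))
     = (if fst p \<and> snd q \<and> fst q = snd p then - 1 else 1)
       * (pauli1 (fst p, snd p \<noteq> snd q) $$ (of_bool r, of_bool c)
        * pauli1 (fst q \<noteq> fst p, snd q) $$ (of_bool r', of_bool c'))"
  by (cases p; cases q; cases r; cases r'; cases c; cases c') (auto simp: pauli1_index)

lemma prod_split_two:
  fixes f :: "nat \<Rightarrow> complex"
  assumes "i < n" "j < n" "i \<noteq> j"
  shows "(\<Prod>k<n. f k) = f i * f j * (\<Prod>k\<in>{..<n} - {i, j}. f k)"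
proof -
  have "(\<Prod>k<n. f k) = (\<Prod>k\<in>insert i (insert j ({..<n} - {i, j})). f k)"
    using assms by (intro prod.cong) auto
  then show ?thesis using assms by (simp add: mult.assoc)
qed

lemma pauli_perm_cnot:
  assumes ij: "i < n" "j < n" "i \<noteq> j"
  shows "pauli_perm n (cnot n i j) (cnot_label i j)"
  unfolding pauli_perm_def
proof (intro conjI ballI)
  show "cnot n i j \<in> carrier_mat (2 ^ n) (2 ^ n)" "unitary (cnot n i j)"
    using unitary_cnot[OF ij] by simp_all
  fix a assume a: "a \<in> pauli_labels n"
  then have len: "length a = n" by (simp add: pauli_labels_def)
  show l: "cnot_label i j a \<in> pauli_labels n"
    using a by (simp add: pauli_labels_def cnot_label_def)
  then have len': "length (cnot_label i j a) = n" by (simp add: pauli_labels_def)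
  let ?s = "(if fst (a ! i) \<and> snd (a ! j) \<and> fst (a ! j) = snd (a ! i) then - 1 else 1) :: complex"
  let ?\<pi> = "cnot_index n i j" and ?b = "cnot_label i j a"
  note \<pi> = cnot_index_props[OF ij]
  have "omega (cnot n i j) (pauli a) = ?s \<cdot>\<^sub>m pauli ?b"
  proof (rule eq_matI)
    fix r c assume "r < dim_row (?s \<cdot>\<^sub>m pauli ?b)" "c < dim_col (?s \<cdot>\<^sub>m pauli ?b)"
    then have rc: "r < 2 ^ n" "c < 2 ^ n" using len' by auto
    define F where "F k = pauli1 (a ! k) $$ (of_bool (qbit n k (?\<pi> r)), of_bool (qbit n k (?\<pi> c)))" for k
    define F' where "F' k = pauli1 (?b ! k) $$ (of_bool (qbit n k r), of_bool (qbit n k c))" for k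
    \<comment> \<open>Away from \<open>i\<close> and \<open>j\<close> the factors agree one by one;
      at \<open>i\<close> and \<open>j\<close> they agree only as a product, up to the sign.\<close>
    have rest: "F k = F' k" if "k \<in> {..<n} - {i, j}" for k
      using that by (simp add: F_def F'_def \<pi>(3) cnot_label_def)
    have two: "F i * F j = ?s * (F' i * F' j)"
    proof -
      have b: "?b ! i = (fst (a ! i), snd (a ! i) \<noteq> snd (a ! j))"
        "?b ! j = (fst (a ! j) \<noteq> fst (a ! i), snd (a ! j))"
        using ij len by (simp_all add: cnot_label_def)
      show ?thesis
        unfolding F_def F'_def b using ij pauli1_cnot[of "a ! i" "qbit n i r" "qbit n i c" "a ! j" "qbit n j r" "qbit n j c"]
        by (simp add: \<pi>(3))
    qed
    have "omega (cnot n i j) (pauli a) $$ (r, c) = (\<Prod>k<n. F k)"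
      unfolding omega_cnot_index[OF ij pauli_carrier[OF a] rc] F_def
      by (rule pauli_index_prod[OF len \<pi>(1)[OF rc(1)] \<pi>(1)[OF rc(2)]])
    also have "\<dots> = ?s * (\<Prod>k<n. F' k)"
      unfolding prod_split_two[OF ij] two using rest by simp
    also have "(\<Prod>k<n. F' k) = pauli ?b $$ (r, c)"
      unfolding F'_def by (rule pauli_index_prod[OF len' rc, symmetric])
    finally show "omega (cnot n i j) (pauli a) $$ (r, c) = (?s \<cdot>\<^sub>m pauli ?b) $$ (r, c)"
      using rc len' by simp
  qed (use len' carrier_matD[OF omega_carrier(1)[OF cnot_carrier pauli_carrier[OF a]]] in simp_all)
  then show "\<exists>s. cmod s = 1 \<and> omega (cnot n i j) (pauli a) = s \<cdot>\<^sub>m pauli (cnot_label i j a)"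
    by (intro exI[of _ ?s]) simp
qed

section \<open>The Clifford action on Pauli labels\<close>

text \<open>
  A label \<open>(x, z)\<close> stands for \<open>X\<^sup>xZ\<^sup>z\<close> up to a phase; the maps below are the
  symplectic maps induced by the Hadamard, phase and CNOT gates.
\<close>
definition swap_label :: "nat \<Rightarrow> (bool \<times> bool) list \<Rightarrow> (bool \<times> bool) list" where
  "swap_label i a = a[i := (snd (a ! i), fst (a ! i))]"

definition shear_label :: "nat \<Rightarrow> (bool \<times> bool) list \<Rightarrow> (bool \<times> bool) list" where
  "shear_label i a = a[i := (fst (a ! i), fst (a ! i) \<noteq> snd (a ! i))]"

text \<open>Generated like \<open>clifford\<close>, but acting on lists: transitivity can be proved
  by manipulating labels and then lifted to unitaries.\<close>

inductive_set label_maps :: "nat \<Rightarrow> ((bool \<times> bool) list \<Rightarrow> (bool \<times> bool) list) set" for n where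
  lm_id: "id \<in> label_maps n"
| lm_swap: "f \<in> label_maps n \<Longrightarrow> i < n \<Longrightarrow> swap_label i \<circ> f \<in> label_maps n"
| lm_shear: "f \<in> label_maps n \<Longrightarrow> i < n \<Longrightarrow> shear_label i \<circ> f \<in> label_maps n"
| lm_cnot: "f \<in> label_maps n \<Longrightarrow> i < n \<Longrightarrow> j < n \<Longrightarrow> i \<noteq> j \<Longrightarrow> cnot_label i j \<circ> f \<in> label_maps n"

lemma clifford_label_map:
  assumes "g \<in> clifford n"
  shows "\<exists>f. pauli_perm n g f"
  using assms
proof induction
  case cl_id
  then show ?case using pauli_perm_id by blast
next
  case (cl_mult G g)
  then obtain f where "pauli_perm n g f" by blast
  moreover have "\<exists>f. pauli_perm n G f"
    using cl_mult(1) pauli_perm_on_qubit[OF hadamard1_perm] pauli_perm_on_qubit[OF phase1_perm]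
      pauli_perm_cnot unfolding clifford_gens_def by blast
  ultimately show ?case using pauli_perm_comp by blast
qed

text \<open>The lifting direction: every orbit statement about labels is witnessed by a Clifford
  unitary.\<close>

lemma label_map_clifford:
  assumes "f \<in> label_maps n"
  shows "\<exists>g\<in>clifford n. pauli_perm n g f"
  using assms
proof induction
  case lm_id
  then show ?case using pauli_perm_id clifford.cl_id by blast
next
  case (lm_swap f i)
  then obtain g where "g \<in> clifford n" "pauli_perm n g f" by blast
  moreover have "pauli_perm n (on_qubit n i hadamard1) (swap_label i)"
    using pauli_perm_on_qubit[OF hadamard1_perm lm_swap(2)] by (simp add: swap_label_def[abs_def])
  moreover have "on_qubit n i hadamard1 \<in> clifford_gens n" using lm_swap(2) by (auto simp: clifford_gens_def)
  ultimately show ?case using pauli_perm_comp clifford.cl_mult by blast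
next
  case (lm_shear f i)
  then obtain g where "g \<in> clifford n" "pauli_perm n g f" by blast
  moreover have "pauli_perm n (on_qubit n i phase1) (shear_label i)"
    using pauli_perm_on_qubit[OF phase1_perm lm_shear(2)] by (simp add: shear_label_def[abs_def])
  moreover have "on_qubit n i phase1 \<in> clifford_gens n" using lm_shear(2) by (auto simp: clifford_gens_def)
  ultimately show ?case using pauli_perm_comp clifford.cl_mult by blast
next
  case (lm_cnot f i j)
  then obtain g where "g \<in> clifford n" "pauli_perm n g f" by blast
  moreover have "cnot n i j \<in> clifford_gens n" using lm_cnot by (auto simp: clifford_gens_def)
  ultimately show ?case using pauli_perm_comp pauli_perm_cnot[OF lm_cnot(2-4)] clifford.cl_mult by blast
qed

lemma gens_carrier: "G \<in> clifford_gens n \<Longrightarrow> G \<in> carrier_mat (2 ^ n) (2 ^ n)"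
  using pauli_perm_on_qubit[OF hadamard1_perm] pauli_perm_on_qubit[OF phase1_perm]
  by (auto simp: clifford_gens_def pauli_perm_def)

lemma clifford_carrier: "g \<in> clifford n \<Longrightarrow> g \<in> carrier_mat (2 ^ n) (2 ^ n)"
  using clifford_label_map pauli_permD(1) by blast

text \<open>\<open>clifford\<close> only adds generators on the left, so the induction runs over the
  left factor and reassociates.\<close>

lemma clifford_mult:
  assumes "g \<in> clifford n" "h \<in> clifford n"
  shows "g * h \<in> clifford n"
  using assms(1)
proof induction
  case cl_id
  then show ?case using assms(2) clifford_carrier[OF assms(2)] by simp
next
  case (cl_mult G g)
  then show ?case
    using gens_carrier clifford_carrier assms(2) clifford.cl_mult[of G n "g * h"]
    by (simp add: assoc_square[where d = "2 ^ n"])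
qed

lemma label_maps_comp:
  assumes "f \<in> label_maps n" "g \<in> label_maps n"
  shows "f \<circ> g \<in> label_maps n"
  using assms by (induction) (auto simp: comp_assoc intro: label_maps.intros)

text \<open>Shifting every gate by one qubit turns a map on \<open>n\<close> qubits into one on
  \<open>n + 1\<close> qubits that leaves the first alone.\<close>

lemma label_maps_shift:
  assumes "f \<in> label_maps n"
  shows "\<exists>f'\<in>label_maps (Suc n). \<forall>p t. f' (p # t) = p # f t"
  using assms
proof induction
  case lm_id
  then show ?case by (intro bexI[of _ id]) (auto intro: label_maps.intros)
next
  case (lm_swap f i)
  then obtain f' where "f' \<in> label_maps (Suc n)" "\<And>p t. f' (p # t) = p # f t" by blast
  then show ?case using lm_swap(2)
    by (intro bexI[of _ "swap_label (Suc i) \<circ> f'"]) (auto simp: swap_label_def intro: label_maps.intros)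
next
  case (lm_shear f i)
  then obtain f' where "f' \<in> label_maps (Suc n)" "\<And>p t. f' (p # t) = p # f t" by blast
  then show ?case using lm_shear(2)
    by (intro bexI[of _ "shear_label (Suc i) \<circ> f'"]) (auto simp: shear_label_def intro: label_maps.intros)
next
  case (lm_cnot f i j)
  then obtain f' where "f' \<in> label_maps (Suc n)" "\<And>p t. f' (p # t) = p # f t" by blast
  then show ?case using lm_cnot(2-4)
    by (intro bexI[of _ "cnot_label (Suc i) (Suc j) \<circ> f'"]) (auto simp: cnot_label_def intro: label_maps.intros)
qed

lemma label_maps_gens:
  "i < n \<Longrightarrow> swap_label i \<in> label_maps n" "i < n \<Longrightarrow> shear_label i \<in> label_maps n"
  "i < n \<Longrightarrow> j < n \<Longrightarrow> i \<noteq> j \<Longrightarrow> cnot_label i j \<in> label_maps n"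
  using lm_swap[OF lm_id] lm_shear[OF lm_id] lm_cnot[OF lm_id] by simp_all

text \<open>A Hadamard gate turns \<open>X\<close> into \<open>Z\<close>; a preceding phase gate
  turns \<open>Y\<close> into \<open>X\<close>.\<close>

lemma label_maps_head:
  assumes "p \<noteq> (False, False)"
  shows "\<exists>f\<in>label_maps (Suc n). \<forall>t. f (p # t) = (False, True) # t"
proof -
  consider "p = (False, True)" | "p = (True, False)" | "p = (True, True)"
    using assms by (cases p) auto
  then show ?thesis
  proof cases
    case 1
    then show ?thesis by (intro bexI[of _ id]) (auto intro: label_maps.intros)
  next
    case 2
    then show ?thesis
      by (intro bexI[of _ "swap_label 0"]) (auto simp: swap_label_def intro!: label_maps_gens)
  next
    case 3
    then show ?thesis
      by (intro bexI[of _ "swap_label 0 \<circ> shear_label 0"])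
         (auto simp: swap_label_def shear_label_def intro!: lm_swap label_maps_gens)
  qed
qed

text \<open>Induction on the number of qubits. If the tail is the identity, only the first factor
  has to be normalised. Otherwise the tail is moved to a single \<open>Z\<close>, the first factor
  is made \<open>Z\<close> as well, and a CNOT with control 1 and target 0 erases the second
  \<open>Z\<close>.\<close>

lemma label_maps_to_Z:
  assumes "a \<in> pauli_labels (Suc m)" "a \<noteq> replicate (Suc m) (False, False)"
  shows "\<exists>f\<in>label_maps (Suc m). f a = pauli_Z m"
  using assms
proof (induction m arbitrary: a)
  case 0
  then obtain p where "a = [p]" "p \<noteq> (False, False)" by (auto simp: pauli_labels_Suc)
  then show ?case using label_maps_head[of p 0] by auto
next
  case (Suc m)
  obtain p t where a: "a = p # t" and t: "t \<in> pauli_labels (Suc m)"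
    using Suc.prems(1) by (subst (asm) pauli_labels_Suc) auto
  show ?case
  proof (cases "t = replicate (Suc m) (False, False)")
    case True
    then have "p \<noteq> (False, False)" using Suc.prems(2) a by auto
    then show ?thesis using label_maps_head[of p "Suc m"] a True by auto
  next
    case False
    then obtain f where f: "f \<in> label_maps (Suc m)" "f t = pauli_Z m" using Suc.IH t by blast
    obtain f' where f': "f' \<in> label_maps (Suc (Suc m))" "\<forall>p t. f' (p # t) = p # f t"
      using label_maps_shift[OF f(1)] by blast
    then have f'a: "f' a = p # pauli_Z m" by (simp only: a f(2) f'(2)[rule_format])
    have "\<exists>h\<in>label_maps (Suc (Suc m)). h (p # pauli_Z m) = (False, True) # pauli_Z m"
    proof (cases "p = (False, False)")
      case True
      \<comment> \<open>The \<open>Z\<close> of the target 1 is copied to the control 0, where the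
        label is trivial.\<close>
      then show ?thesis
        by (intro bexI[of _ "cnot_label 0 1"]) (auto simp: cnot_label_def intro!: label_maps_gens)
    next
      case False
      then show ?thesis using label_maps_head[of p "Suc m"] by auto
    qed
    then obtain h where h: "h \<in> label_maps (Suc (Suc m))" "h (p # pauli_Z m) = (False, True) # pauli_Z m"
      by blast
    have "cnot_label 1 0 ((False, True) # pauli_Z m) = pauli_Z (Suc m)"
      by (simp add: cnot_label_def)
    then have "(cnot_label 1 0 \<circ> (h \<circ> f')) a = pauli_Z (Suc m)" using f'a h by simp
    moreover have "cnot_label 1 0 \<circ> (h \<circ> f') \<in> label_maps (Suc (Suc m))"
      using f' h by (intro lm_cnot label_maps_comp) auto
    ultimately show ?thesis by blast
  qed
qed

lemma label_maps_zero:
  assumes "f \<in> label_maps n"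
  shows "f (replicate n (False, False)) = replicate n (False, False)"
  using label_map_clifford[OF assms] pauli_perm_zero by blast

text \<open>The label \<open>(False, e) # t\<close> is a general partner commuting with
  \<open>Z\<close> on the first qubit and different from it and from the identity. Acting on the
  tail keeps \<open>Z\<close> fixed; if \<open>e\<close> holds, the surplus \<open>Z\<close> at
  qubit 0 is removed by a CNOT whose target carries a \<open>Z\<close> only in the partner.\<close>

lemma label_maps_pair_to_Z:
  assumes t: "t \<in> pauli_labels (Suc m)" "t \<noteq> replicate (Suc m) (False, False)"
  shows "\<exists>f\<in>label_maps (Suc (Suc m)). f (pauli_Z (Suc m)) = pauli_Z (Suc m)
            \<and> f ((False, e) # t) = (False, False) # pauli_Z m"
proof -
  obtain f where f: "f \<in> label_maps (Suc m)" "f t = pauli_Z m" using label_maps_to_Z t by blast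
  obtain f' where f': "f' \<in> label_maps (Suc (Suc m))" "\<And>p t. f' (p # t) = p # f t"
    using label_maps_shift[OF f(1)] by blast
  show ?thesis
  proof (cases e)
    case False
    then show ?thesis using f f' label_maps_zero[OF f(1)] by (intro bexI[of _ f']) auto
  next
    case True
    moreover have "cnot_label 0 1 \<circ> f' \<in> label_maps (Suc (Suc m))"
      using f' by (intro lm_cnot) auto
    ultimately show ?thesis using f f' label_maps_zero[OF f(1)]
      by (intro bexI[of _ "cnot_label 0 1 \<circ> f'"]) (auto simp: cnot_label_def)
  qed
qed

section \<open>Measurement statistics\<close>

lemma tr_add:
  assumes "A \<in> carrier_mat d d" "B \<in> carrier_mat d d"
  shows "tr (A + B) = tr A + tr B"
  using assms by (simp add: tr_def sum.distrib)

lemma tr_omega: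
  assumes "g \<in> carrier_mat d d" "A \<in> carrier_mat d d"
  shows "tr (omega g A) = tr (adj g * g * A)"
  using assms tr_mult_commute[of "g * A" d d "adj g"]
  by (simp add: omega_def assoc_square[where d = d])

lemma omega_add:
  assumes "g \<in> carrier_mat d d" "A \<in> carrier_mat d d" "B \<in> carrier_mat d d"
  shows "omega g (A + B) = omega g A + omega g B"
  using assms
  by (simp add: omega_def mult_add_distrib_mat[of _ d d _ d] add_mult_distrib_mat[of _ d d _ _ d])

lemma omega_zero: "g \<in> carrier_mat d d \<Longrightarrow> omega g (0\<^sub>m d d) = 0\<^sub>m d d"
  by (simp add: omega_def)

lemma apply_kraus_simps:
  "apply_kraus [] A = 0\<^sub>m (dim_row A) (dim_col A)"
  "apply_kraus (K # Ks) A = omega K A + apply_kraus Ks A"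
  by (simp_all add: apply_kraus_def omega_def)

lemma apply_kraus_carrier:
  assumes "\<forall>K\<in>set Ks. K \<in> carrier_mat d d" "A \<in> carrier_mat d d"
  shows "apply_kraus Ks A \<in> carrier_mat d d"
  using assms by (induction Ks) (auto simp: apply_kraus_simps)

lemma kraus_sum_carrier:
  assumes "\<forall>K\<in>set Ks. K \<in> carrier_mat d d"
  shows "foldr (\<lambda>K acc. adj K * K + acc) Ks (0\<^sub>m d d) \<in> carrier_mat d d"
  using assms by (induction Ks) auto

text \<open>Cyclicity turns each \<open>K * A * adj K\<close> into \<open>adj K * K * A\<close>
  under the trace, where the trace-preservation condition can be applied.\<close>

lemma tr_apply_kraus:
  assumes "\<forall>K\<in>set Ks. K \<in> carrier_mat d d" and A: "A \<in> carrier_mat d d"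
  shows "tr (apply_kraus Ks A) = tr (foldr (\<lambda>K acc. adj K * K + acc) Ks (0\<^sub>m d d) * A)"
  using assms(1)
proof (induction Ks)
  case Nil
  then show ?case using A by (simp add: apply_kraus_simps)
next
  case (Cons K Ks)
  let ?S = "foldr (\<lambda>K acc. adj K * K + acc) Ks (0\<^sub>m d d)"
  have K: "K \<in> carrier_mat d d" and Ks: "\<forall>K\<in>set Ks. K \<in> carrier_mat d d" using Cons.prems by auto
  have "tr (apply_kraus (K # Ks) A) = tr (adj K * K * A) + tr (?S * A)"
    using K A Ks Cons.IH apply_kraus_carrier[OF Ks A]
    by (simp add: apply_kraus_simps tr_add[of _ d] tr_omega[of _ d])
  also have "\<dots> = tr ((adj K * K + ?S) * A)"
    using K A kraus_sum_carrier[OF Ks]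
    by (simp add: add_mult_distrib_mat[of _ d d _ _ d] tr_add[of _ d])
  finally show ?case by simp
qed

lemma omega_diag_nonneg:
  assumes g: "g \<in> carrier_mat d d" and A: "A \<in> carrier_mat d d" "psd A" and x: "x < d"
  shows "0 \<le> Re (omega g A $$ (x, x))"
proof -
  \<comment> \<open>The conjugated row \<open>x\<close> of \<open>g\<close>: the diagonal entry is
    the quadratic form of \<open>A\<close> at this vector.\<close>
  define v where "v = vec d (\<lambda>k. cnj (g $$ (x, k)))"
  have "omega g A $$ (x, x) = (\<Sum>k<d. (\<Sum>l<d. g $$ (x, l) * A $$ (l, k)) * cnj (g $$ (x, k)))"
    unfolding omega_def using g A(1) x
    by (subst mult_index[of _ d d _ d])
       (auto simp: mult_index[OF g A(1)] simp del: index_mult_mat(1) intro!: sum.cong)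
  also have "\<dots> = (\<Sum>k<d. \<Sum>l<d. cnj (v $ l) * (A $$ (l, k) * v $ k))"
    by (simp add: v_def sum_distrib_right sum_distrib_left mult_ac)
  also have "\<dots> = (\<Sum>l<d. cnj (v $ l) * (\<Sum>k<d. A $$ (l, k) * v $ k))"
    by (subst sum.swap) (simp add: sum_distrib_left)
  also have "\<dots> = conjugate v \<bullet> (A *\<^sub>v v)"
    using A(1) by (auto simp: scalar_prod_def v_def atLeast0LessThan intro!: sum.cong)
  finally show ?thesis using A by (auto simp: psd_def v_def)
qed

lemma omega_kraus_diag_nonneg:
  assumes g: "g \<in> carrier_mat d d" and "\<forall>K\<in>set Ks. K \<in> carrier_mat d d"
    and A: "A \<in> carrier_mat d d" "psd A" and x: "x < d"
  shows "0 \<le> Re (omega g (apply_kraus Ks A) $$ (x, x))"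
  using assms(2)
proof (induction Ks)
  case Nil
  then show ?case using g A(1) x by (simp add: apply_kraus_simps omega_zero)
next
  case (Cons K Ks)
  have K: "K \<in> carrier_mat d d" and Ks: "\<forall>K\<in>set Ks. K \<in> carrier_mat d d" using Cons.prems by auto
  have c: "omega K A \<in> carrier_mat d d" "apply_kraus Ks A \<in> carrier_mat d d"
    using K A apply_kraus_carrier[OF Ks A(1)] by auto
  \<comment> \<open>Each Kraus term merges with \<open>g\<close> into one conjugation by
    \<open>g * K\<close>, to which \<open>omega_diag_nonneg\<close> applies.\<close>
  have "omega g (apply_kraus (K # Ks) A) = omega (g * K) A + omega g (apply_kraus Ks A)"
    using g K A c by (simp add: apply_kraus_simps omega_add[of _ d] omega_mult[of _ d])
  then show ?case
    using Cons.IH[OF Ks] omega_diag_nonneg[of "g * K" d A x] g K A x c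
      carrier_matD[OF omega_carrier(1)[OF g c(2)]]
    by simp
qed

lemma outcome_prob_nonneg:
  assumes "g \<in> carrier_mat (2 ^ n) (2 ^ n)" "density n \<rho>" "kraus_channel n (\<Lambda> g)" "x < 2 ^ n"
  shows "0 \<le> outcome_prob n G \<Lambda> \<rho> g x"
  using assms omega_kraus_diag_nonneg[of g "2 ^ n" "\<Lambda> g" \<rho> x]
  by (auto simp: outcome_prob_def density_def kraus_channel_def)

lemma sum_outcome_prob:
  assumes g: "g \<in> carrier_mat (2 ^ n) (2 ^ n)" "unitary g" and \<rho>: "density n \<rho>"
    and \<Lambda>: "kraus_channel n (\<Lambda> g)"
  shows "(\<Sum>x<2 ^ n. outcome_prob n G \<Lambda> \<rho> g x) = 1 / real (card G)"
proof -
  let ?A = "apply_kraus (\<Lambda> g) \<rho>"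
  have Ks: "\<forall>K\<in>set (\<Lambda> g). K \<in> carrier_mat (2 ^ n) (2 ^ n)" using \<Lambda> by (simp add: kraus_channel_def)
  have r: "\<rho> \<in> carrier_mat (2 ^ n) (2 ^ n)" "tr \<rho> = 1" using \<rho> by (simp_all add: density_def)
  have A: "?A \<in> carrier_mat (2 ^ n) (2 ^ n)" by (rule apply_kraus_carrier[OF Ks r(1)])
  have "tr (omega g ?A) = 1"
    using tr_omega[OF g(1) A] unitary_mult_adj[OF g] A tr_apply_kraus[OF Ks r(1)] \<Lambda> r
    by (simp add: kraus_channel_def)
  then have "(\<Sum>x<2 ^ n. Re (omega g ?A $$ (x, x))) = 1"
    using carrier_matD[OF omega_carrier(1)[OF g(1) A]] by (simp add: tr_def flip: Re_sum)
  then show ?thesis unfolding outcome_prob_def by (simp flip: sum_divide_distrib)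
qed

text \<open>The mean minimises the second moment, so any centre \<open>c\<close> gives an upper
  bound: the cross term vanishes because deviations from the mean average to zero.\<close>

lemma variance_le_second_moment:
  fixes p :: "'i \<Rightarrow> real" and X :: "'i \<Rightarrow> complex"
  assumes "finite I" "\<And>i. i \<in> I \<Longrightarrow> 0 \<le> p i" "(\<Sum>i\<in>I. p i) = 1"
  shows "(\<Sum>i\<in>I. p i * (cmod (X i - (\<Sum>j\<in>I. of_real (p j) * X j)))\<^sup>2) \<le> (\<Sum>i\<in>I. p i * (cmod (X i - c))\<^sup>2)"
proof -
  define m where "m = (\<Sum>j\<in>I. of_real (p j) * X j)"
  have sq: "(cmod (X i - c))\<^sup>2 = (cmod (X i - m))\<^sup>2 + (cmod (m - c))\<^sup>2 + 2 * Re ((X i - m) * cnj (m - c))" for i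
  proof -
    have "(cmod (u + w))\<^sup>2 = (cmod u)\<^sup>2 + (cmod w)\<^sup>2 + 2 * Re (u * cnj w)" for u w
      unfolding cmod_power2 by (simp add: power2_eq_square algebra_simps)
    from this[of "X i - m" "m - c"] show ?thesis by simp
  qed
  have "(\<Sum>i\<in>I. complex_of_real (p i) * (X i - m)) = m - complex_of_real (\<Sum>i\<in>I. p i) * m"
    by (simp add: m_def algebra_simps sum_subtractf sum_distrib_right)
  then have 0: "(\<Sum>i\<in>I. complex_of_real (p i) * (X i - m)) = 0" using assms(3) by simp
  have "(\<Sum>i\<in>I. p i * Re ((X i - m) * cnj (m - c)))
      = Re ((\<Sum>i\<in>I. complex_of_real (p i) * (X i - m)) * cnj (m - c))"
    unfolding sum_distrib_right Re_sum by (intro sum.cong refl) (simp add: algebra_simps)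
  then have cross: "(\<Sum>i\<in>I. p i * Re ((X i - m) * cnj (m - c))) = 0" unfolding 0 by simp
  have "(\<Sum>i\<in>I. p i * (cmod (X i - c))\<^sup>2)
      = (\<Sum>i\<in>I. p i * (cmod (X i - m))\<^sup>2) + (\<Sum>i\<in>I. p i) * (cmod (m - c))\<^sup>2
        + 2 * (\<Sum>i\<in>I. p i * Re ((X i - m) * cnj (m - c)))"
    unfolding sq by (simp add: distrib_left sum.distrib sum_distrib_right sum_distrib_left mult_ac)
  also have "\<dots> \<ge> (\<Sum>i\<in>I. p i * (cmod (X i - m))\<^sup>2)" unfolding cross using assms(3) by simp
  finally show ?thesis by (simp add: m_def)
qed

text \<open>The bound \<open>B g\<close> may depend on \<open>g\<close> but not on \<open>x\<close>:
  the conditional distribution of \<open>x\<close>, which carries the noise, then sums out to the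
  uniform weight of \<open>g\<close>.\<close>

lemma est_var_le:
  assumes fin: "finite G" and ne: "G \<noteq> {}"
    and G: "\<And>g. g \<in> G \<Longrightarrow> g \<in> carrier_mat (2 ^ n) (2 ^ n)" "\<And>g. g \<in> G \<Longrightarrow> unitary g"
    and \<rho>: "density n \<rho>" and \<Lambda>: "\<And>g. g \<in> G \<Longrightarrow> kraus_channel n (\<Lambda> g)"
    and bound: "\<And>g x. g \<in> G \<Longrightarrow> x < 2 ^ n \<Longrightarrow> cmod (estimator n G Obs g x - c) \<le> B g"
  shows "est_var n G \<Lambda> \<rho> Obs \<le> (\<Sum>g\<in>G. (B g)\<^sup>2) / real (card G)"
proof -
  let ?I = "G \<times> {..<2 ^ n :: nat}"
  define p where "p i = outcome_prob n G \<Lambda> \<rho> (fst i) (snd i)" for i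
  define X where "X i = estimator n G Obs (fst i) (snd i)" for i
  have nonneg: "0 \<le> outcome_prob n G \<Lambda> \<rho> g x" if "g \<in> G" "x < 2 ^ n" for g x
    using that G \<Lambda> \<rho> by (intro outcome_prob_nonneg) auto
  have card: "real (card G) > 0" using fin ne by (simp add: card_gt_0_iff)
  have norm: "(\<Sum>x<2 ^ n. outcome_prob n G \<Lambda> \<rho> g x) = 1 / real (card G)" if "g \<in> G" for g
    using that G \<Lambda> \<rho> by (intro sum_outcome_prob) auto
  have sum1: "(\<Sum>i\<in>?I. p i) = 1"
    using card by (simp add: p_def norm sum.cartesian_product' case_prod_unfold)
  have "est_var n G \<Lambda> \<rho> Obs
      = (\<Sum>i\<in>?I. p i * (cmod (X i - (\<Sum>j\<in>?I. of_real (p j) * X j)))\<^sup>2)"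
    by (simp add: est_var_def est_mean_def p_def X_def sum.cartesian_product case_prod_unfold)
  also have "\<dots> \<le> (\<Sum>i\<in>?I. p i * (cmod (X i - c))\<^sup>2)"
    using fin nonneg sum1 by (intro variance_le_second_moment) (auto simp: p_def)
  also have "\<dots> = (\<Sum>g\<in>G. \<Sum>x<2 ^ n. outcome_prob n G \<Lambda> \<rho> g x * (cmod (estimator n G Obs g x - c))\<^sup>2)"
    by (simp add: p_def X_def sum.cartesian_product case_prod_unfold)
  also have "\<dots> \<le> (\<Sum>g\<in>G. \<Sum>x<2 ^ n. outcome_prob n G \<Lambda> \<rho> g x * (B g)\<^sup>2)"
    using bound nonneg by (intro sum_mono mult_left_mono power_mono) auto
  also have "\<dots> = (\<Sum>g\<in>G. (B g)\<^sup>2) / real (card G)"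
    by (simp add: norm sum_divide_distrib flip: sum_distrib_right)
  finally show ?thesis .
qed

section \<open>Twirling over a group of Pauli-permuting unitaries\<close>

lemma Ebasis_carrier [simp]: "Ebasis n x \<in> carrier_mat (2 ^ n) (2 ^ n)"
  by (simp add: Ebasis_def)

lemma Ebasis_index:
  "i < 2 ^ n \<Longrightarrow> j < 2 ^ n \<Longrightarrow> Ebasis n x $$ (i, j) = (if i = x \<and> j = x then 1 else 0)"
  by (simp add: Ebasis_def)

lemma hs_inner_Ebasis:
  assumes "A \<in> carrier_mat (2 ^ n) (2 ^ n)" "x < 2 ^ n"
  shows "hs_inner (Ebasis n x) A = A $$ (x, x)"
proof -
  have "hs_inner (Ebasis n x) A = (\<Sum>i<2 ^ n. \<Sum>j<2 ^ n. if i = x then if j = x then A $$ (x, x) else 0 else 0)"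
    unfolding hs_inner_entries[OF Ebasis_carrier assms(1)]
    by (intro sum.cong refl) (auto simp: Ebasis_index)
  also have "\<dots> = (\<Sum>i<2 ^ n. if i = x then \<Sum>j<2 ^ n. if j = x then A $$ (x, x) else 0 else 0)"
    by (intro sum.cong refl) auto
  also have "\<dots> = A $$ (x, x)" using assms(2) by simp
  finally show ?thesis .
qed

lemma Mmeas_carrier [simp]: "Mmeas n A \<in> carrier_mat (2 ^ n) (2 ^ n)"
  by (simp add: Mmeas_def msum_def)

lemma Mmeas_index:
  assumes "A \<in> carrier_mat (2 ^ n) (2 ^ n)" "i < 2 ^ n" "j < 2 ^ n"
  shows "Mmeas n A $$ (i, j) = (if i = j then A $$ (i, i) else 0)"
proof -
  have "Mmeas n A $$ (i, j) = (\<Sum>x<2 ^ n. A $$ (x, x) * (if i = x \<and> j = x then 1 else 0))"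
    unfolding Mmeas_def msum_def using assms
    by (simp add: hs_inner_Ebasis Ebasis_index carrier_matD[OF Ebasis_carrier])
  also have "\<dots> = (\<Sum>x<2 ^ n. if x = i then if i = j then A $$ (i, i) else 0 else 0)"
    by (intro sum.cong) auto
  finally show ?thesis using assms by simp
qed

lemma hs_inner_Mmeas:
  assumes "A \<in> carrier_mat (2 ^ n) (2 ^ n)" "B \<in> carrier_mat (2 ^ n) (2 ^ n)"
  shows "hs_inner A (Mmeas n B) = (\<Sum>x<2 ^ n. cnj (A $$ (x, x)) * B $$ (x, x))"
proof -
  have "hs_inner A (Mmeas n B) = (\<Sum>i<2 ^ n. \<Sum>j<2 ^ n. if j = i then cnj (A $$ (i, i)) * B $$ (i, i) else 0)"
    unfolding hs_inner_entries[OF assms(1) Mmeas_carrier]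
    by (intro sum.cong refl) (auto simp: Mmeas_index[OF assms(2)])
  then show ?thesis by simp
qed

lemma msum_carrier [simp]: "msum d f S \<in> carrier_mat d d"
  by (simp add: msum_def)

lemma hs_inner_msum:
  assumes "A \<in> carrier_mat d d" "\<And>x. x \<in> S \<Longrightarrow> f x \<in> carrier_mat d d"
  shows "hs_inner A (msum d f S) = (\<Sum>x\<in>S. hs_inner A (f x))"
proof -
  have "hs_inner A (msum d f S) = (\<Sum>i<d. \<Sum>j<d. \<Sum>x\<in>S. cnj (A $$ (i, j)) * f x $$ (i, j))"
    unfolding hs_inner_entries[OF assms(1) msum_carrier]
    by (intro sum.cong refl) (simp add: msum_def sum_distrib_left)
  also have "\<dots> = (\<Sum>i<d. \<Sum>x\<in>S. \<Sum>j<d. cnj (A $$ (i, j)) * f x $$ (i, j))"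
    by (intro sum.cong refl sum.swap)
  also have "\<dots> = (\<Sum>x\<in>S. \<Sum>i<d. \<Sum>j<d. cnj (A $$ (i, j)) * f x $$ (i, j))"
    by (rule sum.swap)
  also have "\<dots> = (\<Sum>x\<in>S. hs_inner A (f x))"
    using assms by (intro sum.cong refl) (simp add: hs_inner_entries[of _ d d])
  finally show ?thesis .
qed

text \<open>
  For the unitaries considered here the diagonal of \<^term>\<open>omega g (pauli a)\<close> is either zero or
  has only entries of modulus 1, so that its first entry decides.
\<close>
definition diag_hit :: "complex mat \<Rightarrow> (bool \<times> bool) list \<Rightarrow> bool" where
  "diag_hit g a \<longleftrightarrow> omega g (pauli a) $$ (0, 0) \<noteq> 0"

text \<open>For \<open>a = b\<close> this is the probability that one label is hit, the eigenvalue
  of the frame operator at that label.\<close>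

definition pair_prob :: "complex mat set \<Rightarrow> (bool \<times> bool) list \<Rightarrow> (bool \<times> bool) list \<Rightarrow> real" where
  "pair_prob G a b = real (card {g \<in> G. diag_hit g a \<and> diag_hit g b}) / real (card G)"

lemma cmod_omega_pauli_diag:
  assumes "pauli_perm n g f" "a \<in> pauli_labels n" "x < 2 ^ n"
  shows "cmod (omega g (pauli a) $$ (x, x)) = of_bool (ztype (f a))"
proof -
  note g = pauli_permD[OF assms(1)]
  obtain s where s: "cmod s = 1" "omega g (pauli a) = s \<cdot>\<^sub>m pauli (f a)" using g(4) assms(2) by blast
  have "length (f a) = n" using g(3)[OF assms(2)] by (simp add: pauli_labels_def)
  then show ?thesis using s assms(3) by (simp add: norm_mult cmod_pauli_diag)
qed

lemma diag_hit_iff: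
  assumes "pauli_perm n g f" "a \<in> pauli_labels n"
  shows "diag_hit g a \<longleftrightarrow> ztype (f a)"
proof -
  have "cmod (omega g (pauli a) $$ (0, 0)) = of_bool (ztype (f a))"
    using cmod_omega_pauli_diag[OF assms, of 0] by simp
  then show ?thesis by (cases "ztype (f a)") (auto simp: diag_hit_def)
qed

text \<open>Multiplying by \<open>h\<close> on the right moves the label by \<open>f\<close> before
  \<open>g\<close> acts; this makes hit probabilities invariant along orbits.\<close>

lemma diag_hit_mult:
  assumes g: "g \<in> carrier_mat (2 ^ n) (2 ^ n)" and h: "pauli_perm n h f" and a: "a \<in> pauli_labels n"
  shows "diag_hit (g * h) a \<longleftrightarrow> diag_hit g (f a)"
proof -
  note h' = pauli_permD[OF h]
  obtain s where s: "cmod s = 1" "omega h (pauli a) = s \<cdot>\<^sub>m pauli (f a)" using h'(4) a by blast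
  have "omega (g * h) (pauli a) = s \<cdot>\<^sub>m omega g (pauli (f a))"
    using g h'(1,3) a s by (simp add: omega_mult[of _ "2 ^ n"] omega_smult[of _ "2 ^ n"])
  then show ?thesis
    using s(1) carrier_matD[OF omega_carrier(1)[OF g pauli_carrier[OF h'(3)[OF a]]]]
    by (auto simp: diag_hit_def)
qed

text \<open>The frame operator, its inverse and the estimator are treated once, from these
  properties, for both sampling groups.\<close>

locale pauli_group =
  fixes n :: nat and G :: "complex mat set"
  assumes finite_G: "finite G" and nonempty: "G \<noteq> {}"
    and mult_closed: "g \<in> G \<Longrightarrow> h \<in> G \<Longrightarrow> g * h \<in> G"
    and perm: "g \<in> G \<Longrightarrow> \<exists>f. pauli_perm n g f"
begin

lemma G_carrier: "g \<in> G \<Longrightarrow> g \<in> carrier_mat (2 ^ n) (2 ^ n)"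
  and G_unitary: "g \<in> G \<Longrightarrow> unitary g"
  using perm pauli_permD(1,2) by blast+

lemma card_G_pos: "real (card G) > 0"
  using finite_G nonempty by (simp add: card_gt_0_iff)

lemma cmod_diag:
  assumes "g \<in> G" "a \<in> pauli_labels n" "x < 2 ^ n"
  shows "cmod (omega g (pauli a) $$ (x, x)) = of_bool (diag_hit g a)"
proof -
  obtain f where f: "pauli_perm n g f" using perm assms(1) by blast
  show ?thesis unfolding cmod_omega_pauli_diag[OF f assms(2,3)] diag_hit_iff[OF f assms(2)] ..
qed

text \<open>Right translation by the unitary \<open>h\<close> is injective, and an injection of the
  finite set \<open>G\<close> into itself is a bijection. Closure under products thus already gives
  translation invariance of the uniform distribution.\<close>

lemma card_translate:
  assumes h: "h \<in> G"
  shows "card {g \<in> G. Q (g * h)} = card {g \<in> G. Q g}"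
proof -
  have inj: "inj_on (\<lambda>g. g * h) G"
  proof (rule inj_onI)
    fix g g' assume g: "g \<in> G" "g' \<in> G" "g * h = g' * h"
    have "(g * h) * adj h = (g' * h) * adj h" using g by simp
    then show "g = g'"
      using G_carrier[OF g(1)] G_carrier[OF g(2)] G_carrier[OF h] unitary_mult_adj[OF G_carrier[OF h] G_unitary[OF h]]
      by (simp add: assoc_square[where d = "2 ^ n"])
  qed
  have surj: "(\<lambda>g. g * h) ` G = G"
    using finite_G inj mult_closed h by (intro endo_inj_surj) auto
  have image: "(\<lambda>g. g * h) ` {g \<in> G. Q (g * h)} = {g \<in> G. Q g}" using surj by auto
  have "inj_on (\<lambda>g. g * h) {g \<in> G. Q (g * h)}" using inj by (rule inj_on_subset) auto
  from card_image[OF this] show ?thesis unfolding image by simp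
qed

lemma pair_prob_invariant:
  assumes "h \<in> G" "pauli_perm n h f" "a \<in> pauli_labels n" "b \<in> pauli_labels n"
  shows "pair_prob G (f a) (f b) = pair_prob G a b"
proof -
  have "{g \<in> G. diag_hit g (f a) \<and> diag_hit g (f b)} = {g \<in> G. diag_hit (g * h) a \<and> diag_hit (g * h) b}"
    using diag_hit_mult[OF G_carrier assms(2)] assms by blast
  then show ?thesis
    unfolding pair_prob_def using card_translate[OF assms(1), of "\<lambda>g. diag_hit g a \<and> diag_hit g b"] by simp
qed

lemma pair_prob_sum: "pair_prob G a b = (\<Sum>g\<in>G. of_bool (diag_hit g a) * of_bool (diag_hit g b)) / real (card G)"
proof -
  have "(\<Sum>g\<in>G. of_bool (diag_hit g a) * of_bool (diag_hit g b))
      = (\<Sum>g\<in>G. of_bool (diag_hit g a \<and> diag_hit g b) :: real)"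
    by (simp only: of_bool_conj)
  also have "\<dots> = real (card {g \<in> G. diag_hit g a \<and> diag_hit g b})"
    using finite_G by (simp add: Int_def)
  finally show ?thesis by (simp only: pair_prob_def)
qed

lemma pair_prob_diag: "pair_prob G a a = (\<Sum>g\<in>G. of_bool (diag_hit g a)) / real (card G)"
  unfolding pair_prob_sum by (intro arg_cong2[where f = "(/)"] sum.cong) auto

text \<open>The map induced by \<open>g\<close> permutes \<open>A\<close> and sends the labels hit
  by \<open>g\<close> to those satisfying \<open>ztype\<close>, so the number of hits in
  \<open>A\<close> is the same for every such \<open>g\<close>.\<close>

lemma card_diag_hit:
  assumes A: "A \<subseteq> pauli_labels n" and g: "g \<in> G"
    and inv: "\<And>f. pauli_perm n g f \<Longrightarrow> f ` A \<subseteq> A"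
  shows "card {a \<in> A. diag_hit g a} = card {a \<in> A. ztype a}"
proof -
  obtain f where f: "pauli_perm n g f" using perm g by blast
  have inj: "inj_on f A" using pauli_perm_inj[OF f] A by (rule inj_on_subset)
  have "finite A" using finite_subset[OF A] by simp
  then have surj: "f ` A = A" using inj inv[OF f] by (intro endo_inj_surj)
  have 1: "{a \<in> A. diag_hit g a} = {a \<in> A. ztype (f a)}"
    using diag_hit_iff[OF f] A by blast
  have 2: "f ` {a \<in> A. ztype (f a)} = {b \<in> f ` A. ztype b}" by blast
  have image: "f ` {a \<in> A. diag_hit g a} = {a \<in> A. ztype a}" unfolding 1 2 surj ..
  have "inj_on f {a \<in> A. diag_hit g a}" using inj by (rule inj_on_subset) auto
  from card_image[OF this] show ?thesis unfolding image by simp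
qed

text \<open>Double counting of the pairs \<open>(g, b)\<close> with \<open>b\<close> in
  \<open>A\<close> hit by \<open>g\<close>: transitivity makes the probability independent of
  \<open>b\<close>, and \<open>card_diag_hit\<close> makes the number of hits independent of
  \<open>g\<close>. The label \<open>z\<close> is a common image through which the elements of
  \<open>A\<close> are compared.\<close>

lemma pair_prob_orbit:
  assumes A: "A \<subseteq> pauli_labels n"
    and inv: "\<And>g f. g \<in> G \<Longrightarrow> pauli_perm n g f \<Longrightarrow> f ` A \<subseteq> A"
    and trans: "\<And>a. a \<in> A \<Longrightarrow> \<exists>g\<in>G. \<exists>f. pauli_perm n g f \<and> f a = z"
    and a: "a \<in> A"
  shows "real (card A) * pair_prob G a a = real (card {b \<in> A. ztype b})"
proof -
  have const: "pair_prob G b b = pair_prob G z z" if "b \<in> A" for b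
  proof -
    obtain g f where gf: "g \<in> G" "pauli_perm n g f" "f b = z" using trans[OF \<open>b \<in> A\<close>] by blast
    have "b \<in> pauli_labels n" using \<open>b \<in> A\<close> A by blast
    from pair_prob_invariant[OF gf(1,2) this this] show ?thesis by (simp only: gf(3))
  qed
  have "real (card A) * pair_prob G a a = (\<Sum>b\<in>A. pair_prob G b b)"
    using const a by simp
  also have "\<dots> = (\<Sum>g\<in>G. \<Sum>b\<in>A. of_bool (diag_hit g b)) / real (card G)"
    unfolding pair_prob_diag by (subst sum.swap) (simp add: sum_divide_distrib)
  also have "\<dots> = (\<Sum>g\<in>G. real (card {b \<in> A. ztype b})) / real (card G)"
  proof -
    have "finite A" using finite_subset[OF A] by simp
    then have "(\<Sum>b\<in>A. of_bool (diag_hit g b)) = real (card {b \<in> A. ztype b})" if "g \<in> G" for g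
      using card_diag_hit[OF A that inv[OF that]] by (simp add: Int_def)
    then show ?thesis by simp
  qed
  finally show ?thesis using card_G_pos by simp
qed

text \<open>If \<open>g\<close> hits \<open>a\<close>, the conjugated Pauli operator is diagonal and
  the measurement loses nothing of the coefficient; otherwise its diagonal is zero and the summand
  vanishes. Averaging over \<open>g\<close> leaves the hit probability.\<close>

lemma hs_inner_pauli_frame_op:
  assumes A: "A \<in> carrier_mat (2 ^ n) (2 ^ n)" and a: "a \<in> pauli_labels n"
  shows "hs_inner (pauli a) (frame_op n G A) = of_real (pair_prob G a a) * hs_inner (pauli a) A"
proof -
  let ?c = "\<lambda>g. omega_adj g (Mmeas n (omega g A))"
  have c: "?c g \<in> carrier_mat (2 ^ n) (2 ^ n)" if "g \<in> G" for g using G_carrier[OF that] by simp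
  have summand: "hs_inner (pauli a) (?c g) = of_bool (diag_hit g a) * hs_inner (pauli a) A" if g: "g \<in> G" for g
  proof -
    obtain f where f: "pauli_perm n g f" using perm g by blast
    note f' = pauli_permD[OF f]
    obtain s where s: "cmod s = 1" "omega g (pauli a) = s \<cdot>\<^sub>m pauli (f a)" using f'(4) a by blast
    have len: "length (f a) = n" using f'(3)[OF a] by (simp add: pauli_labels_def)
    have oc: "omega g (pauli a) \<in> carrier_mat (2 ^ n) (2 ^ n)" "omega g A \<in> carrier_mat (2 ^ n) (2 ^ n)"
      using f'(1) A a by auto
    have 1: "hs_inner (pauli a) (?c g) = (\<Sum>x<2 ^ n. cnj (omega g (pauli a) $$ (x, x)) * omega g A $$ (x, x))"
      using f'(1) A a oc by (simp add: hs_inner_omega_adj[of _ "2 ^ n"] hs_inner_Mmeas)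
    show ?thesis
    proof (cases "diag_hit g a")
      case True
      then have z: "ztype (f a)" using diag_hit_iff[OF f a] by simp
      have "hs_inner (omega g (pauli a)) (omega g A)
          = (\<Sum>i<2 ^ n. \<Sum>j<2 ^ n. if j = i then cnj (omega g (pauli a) $$ (i, i)) * omega g A $$ (i, i) else 0)"
        unfolding hs_inner_entries[OF oc]
        by (intro sum.cong refl) (auto simp: s(2) len pauli_ztype_offdiag[OF z])
      then show ?thesis using 1 True hs_inner_omega[OF f'(1,2) pauli_carrier[OF a] A] by simp
    next
      case False
      then have "cnj (omega g (pauli a) $$ (x, x)) = 0" if "x < 2 ^ n" for x
        using cmod_diag[OF g a that] by simp
      then show ?thesis using 1 False by simp
    qed
  qed
  have "hs_inner (pauli a) (frame_op n G A) = (1 / of_nat (card G)) * (\<Sum>g\<in>G. hs_inner (pauli a) (?c g))"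
    unfolding frame_op_def using a c
    by (simp add: hs_inner_smult_right[of _ "2 ^ n" "2 ^ n"] hs_inner_msum)
  also have "\<dots> = of_real (pair_prob G a a) * hs_inner (pauli a) A"
  proof -
    have "complex_of_real (of_bool b) = of_bool b" for b by (cases b) simp_all
    then show ?thesis by (simp add: summand pair_prob_diag flip: sum_distrib_right)
  qed
  finally show ?thesis .
qed

lemma frame_op_carrier [simp]: "frame_op n G A \<in> carrier_mat (2 ^ n) (2 ^ n)"
  by (simp add: frame_op_def)

text \<open>\<open>frame_inv\<close> is a definite description, so a preimage has to be exhibited
  and shown to be unique. Both work because the frame operator multiplies each Pauli coefficient by
  a nonzero number.\<close>

lemma frame_inv_coeff:
  assumes pos: "\<And>a. a \<in> pauli_labels n \<Longrightarrow> pair_prob G a a \<noteq> 0"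
    and B: "B \<in> carrier_mat (2 ^ n) (2 ^ n)"
  shows "frame_inv n G B \<in> carrier_mat (2 ^ n) (2 ^ n)"
    and "a \<in> pauli_labels n \<Longrightarrow>
      hs_inner (pauli a) (frame_inv n G B) = hs_inner (pauli a) B / of_real (pair_prob G a a)"
proof -
  let ?q = "\<lambda>a. complex_of_real (pair_prob G a a)"
  \<comment> \<open>Each coefficient of \<open>B\<close> is divided by its eigenvalue; the factor
    \<open>2 ^ n\<close> accounts for the unnormalised Pauli basis.\<close>
  define A where "A = msum (2 ^ n) (\<lambda>b. (hs_inner (pauli b) B / ?q b / 2 ^ n) \<cdot>\<^sub>m pauli b) (pauli_labels n)"
  have A: "A \<in> carrier_mat (2 ^ n) (2 ^ n)" by (simp add: A_def)
  have coeff: "hs_inner (pauli a) A = hs_inner (pauli a) B / ?q a" if a: "a \<in> pauli_labels n" for a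
  proof -
    have "hs_inner (pauli a) A
        = (\<Sum>b\<in>pauli_labels n. (hs_inner (pauli b) B / ?q b / 2 ^ n) * hs_inner (pauli a) (pauli b))"
      unfolding A_def using a
      by (subst hs_inner_msum) (auto simp: hs_inner_smult_right[of _ "2 ^ n" "2 ^ n"])
    also have "\<dots> = (\<Sum>b\<in>pauli_labels n. if a = b then hs_inner (pauli b) B / ?q b else 0)"
      using a by (intro sum.cong refl) (simp add: pauli_orthogonal)
    finally show ?thesis using a by simp
  qed
  have A_inv: "frame_op n G A = B"
    using pos by (intro pauli_mat_eqI[OF frame_op_carrier B])
      (simp add: hs_inner_pauli_frame_op[OF A] coeff)
  have "A' = A" if "A' \<in> carrier_mat (2 ^ n) (2 ^ n)" "frame_op n G A' = B" for A'
  proof (rule pauli_mat_eqI[OF that(1) A])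
    fix a assume a: "a \<in> pauli_labels n"
    have "?q a * hs_inner (pauli a) A' = ?q a * hs_inner (pauli a) A"
      by (simp only: hs_inner_pauli_frame_op[OF that(1) a, symmetric]
          hs_inner_pauli_frame_op[OF A a, symmetric] that(2) A_inv)
    then show "hs_inner (pauli a) A' = hs_inner (pauli a) A" using pos[OF a] by simp
  qed
  then have "frame_inv n G B = A"
    unfolding frame_inv_def using A A_inv by (intro the_equality) blast+
  then show "frame_inv n G B \<in> carrier_mat (2 ^ n) (2 ^ n)"
    and "a \<in> pauli_labels n \<Longrightarrow>
      hs_inner (pauli a) (frame_inv n G B) = hs_inner (pauli a) B / ?q a"
    using A coeff by auto
qed

lemma estimator_expansion:
  assumes pos: "\<And>a. a \<in> pauli_labels n \<Longrightarrow> pair_prob G a a \<noteq> 0"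
    and Obs: "Obs \<in> carrier_mat (2 ^ n) (2 ^ n)" and g: "g \<in> G" and x: "x < 2 ^ n"
  shows "2 ^ n * estimator n G Obs g x = (\<Sum>a\<in>pauli_labels n.
    cnj (hs_inner (pauli a) Obs * omega g (pauli a) $$ (x, x)) / of_real (pair_prob G a a))"
proof -
  let ?B = "omega_adj g (Ebasis n x)"
  note g' = G_carrier[OF g]
  have B: "?B \<in> carrier_mat (2 ^ n) (2 ^ n)" using g' by simp
  have coeff: "hs_inner (pauli a) ?B = cnj (omega g (pauli a) $$ (x, x))" if a: "a \<in> pauli_labels n" for a
    using g' a x hs_inner_commute[of "omega g (pauli a)" "2 ^ n" "2 ^ n" "Ebasis n x"]
    by (simp add: hs_inner_omega_adj[of _ "2 ^ n"] hs_inner_Ebasis)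
  have "2 ^ n * estimator n G Obs g x
      = (\<Sum>a\<in>pauli_labels n. cnj (hs_inner (pauli a) Obs) * hs_inner (pauli a) (frame_inv n G ?B))"
    unfolding estimator_def by (rule pauli_parseval[OF Obs frame_inv_coeff(1)[OF pos B], symmetric])
  also have "\<dots> = (\<Sum>a\<in>pauli_labels n.
    cnj (hs_inner (pauli a) Obs * omega g (pauli a) $$ (x, x)) / of_real (pair_prob G a a))"
    by (intro sum.cong refl) (simp add: frame_inv_coeff(2)[OF pos B] coeff)
  finally show ?thesis .
qed

text \<open>Labels outside \<open>A\<close> are collected in the constant \<open>c\<close>: the
  identity in the global case, labels with vanishing coefficient in the local case. The bound is
  free of \<open>x\<close> because the diagonal entries of a hit label all have modulus 1.\<close>

lemma estimator_bound:
  assumes pos: "\<And>a. a \<in> pauli_labels n \<Longrightarrow> pair_prob G a a > 0"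
    and Obs: "Obs \<in> carrier_mat (2 ^ n) (2 ^ n)" and g: "g \<in> G" and x: "x < 2 ^ n"
    and A: "A \<subseteq> pauli_labels n"
    and c: "c = (\<Sum>a\<in>pauli_labels n - A.
      cnj (hs_inner (pauli a) Obs * omega g (pauli a) $$ (x, x)) / of_real (pair_prob G a a)) / 2 ^ n"
  shows "cmod (estimator n G Obs g x - c)
    \<le> (\<Sum>a\<in>A. of_bool (diag_hit g a) * cmod (hs_inner (pauli a) Obs) / pair_prob G a a) / 2 ^ n"
proof -
  let ?t = "\<lambda>a. cnj (hs_inner (pauli a) Obs * omega g (pauli a) $$ (x, x)) / of_real (pair_prob G a a)"
  define T where "T = sum ?t"
  have "2 ^ n * estimator n G Obs g x = T (pauli_labels n)"
    unfolding T_def by (rule estimator_expansion[OF _ Obs g x]) (use pos in fastforce)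
  also have "\<dots> = T (pauli_labels n - A) + T A"
    unfolding T_def by (rule sum.subset_diff[OF A]) simp
  finally have "estimator n G Obs g x = (T (pauli_labels n - A) + T A) / 2 ^ n"
    by (simp add: eq_divide_eq mult.commute)
  moreover have "c = T (pauli_labels n - A) / 2 ^ n" unfolding c T_def ..
  ultimately have "estimator n G Obs g x - c = T A / 2 ^ n"
    by (simp add: add_divide_distrib)
  then have eq: "cmod (estimator n G Obs g x - c) = cmod (\<Sum>a\<in>A. ?t a) / 2 ^ n"
    unfolding T_def by (simp only: norm_divide norm_power norm_numeral)
  have "cmod (\<Sum>a\<in>A. ?t a) \<le> (\<Sum>a\<in>A. cmod (?t a))" by (rule norm_sum)
  also have "\<dots> = (\<Sum>a\<in>A. of_bool (diag_hit g a) * cmod (hs_inner (pauli a) Obs) / pair_prob G a a)"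
  proof (intro sum.cong refl)
    fix a assume "a \<in> A"
    then have a: "a \<in> pauli_labels n" using A by auto
    show "cmod (?t a) = of_bool (diag_hit g a) * cmod (hs_inner (pauli a) Obs) / pair_prob G a a"
      using cmod_diag[OF g a x] pos[OF a] by (simp add: norm_divide norm_mult)
  qed
  finally show ?thesis unfolding eq by (rule divide_right_mono) simp
qed

end

section \<open>The global Clifford group\<close>

lemma diagonal_mult_commute:
  fixes A B :: "complex mat"
  assumes A: "A \<in> carrier_mat d d" "\<And>i j. i < d \<Longrightarrow> j < d \<Longrightarrow> i \<noteq> j \<Longrightarrow> A $$ (i, j) = 0"
    and B: "B \<in> carrier_mat d d" "\<And>i j. i < d \<Longrightarrow> j < d \<Longrightarrow> i \<noteq> j \<Longrightarrow> B $$ (i, j) = 0"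
  shows "A * B = B * A"
proof -
  have prod: "(X * Y) $$ (i, j) = X $$ (i, i) * Y $$ (i, j)"
    if "X \<in> carrier_mat d d" "Y \<in> carrier_mat d d" "i < d" "j < d"
      and X: "\<And>i j. i < d \<Longrightarrow> j < d \<Longrightarrow> i \<noteq> j \<Longrightarrow> X $$ (i, j) = 0" for X Y :: "complex mat" and i j
  proof -
    have "(X * Y) $$ (i, j) = (\<Sum>k<d. if k = i then X $$ (i, i) * Y $$ (i, j) else 0)"
      unfolding mult_index[OF that(1-4)] using that(3) X by (intro sum.cong refl) auto
    then show ?thesis using that(3) by simp
  qed
  show ?thesis
  proof (rule eq_matI)
    fix i j assume "i < dim_row (B * A)" "j < dim_col (B * A)"
    then have ij: "i < d" "j < d" using A(1) B(1) by auto
    show "(A * B) $$ (i, j) = (B * A) $$ (i, j)"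
    proof -
      have "(A * B) $$ (i, j) = A $$ (i, i) * B $$ (i, j)"
        by (rule prod[OF A(1) B(1) ij]) (rule A(2))
      moreover have "(B * A) $$ (i, j) = B $$ (i, i) * A $$ (i, j)"
        by (rule prod[OF B(1) A(1) ij]) (rule B(2))
      ultimately show ?thesis using A(2)[OF ij] B(2)[OF ij] by (cases "i = j") simp_all
    qed
  qed (use A(1) B(1) in auto)
qed

lemma card_ztype: "card {a \<in> pauli_labels n. ztype a} = 2 ^ n"
proof -
  have "{a \<in> pauli_labels n. ztype a} = {a. set a \<subseteq> {(False, False), (False, True)} \<and> length a = n}"
    by (auto simp: pauli_labels_def ztype_def)
  then show ?thesis using card_lists_length_eq[of "{(False, False), (False, True)}" n] by (simp add: numeral_2_eq_2)
qed

lemma ztype_replicate_zero [simp]: "ztype (replicate n (False, False))"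
  by (auto simp: ztype_def)

abbreviation pauli_zero :: "nat \<Rightarrow> (bool \<times> bool) list" where
  "pauli_zero n \<equiv> replicate n (False, False)"

context pauli_group
begin

lemma diag_hit_zero: "g \<in> G \<Longrightarrow> diag_hit g (pauli_zero n)"
  using perm[of g] pauli_perm_zero diag_hit_iff[OF _ replicate_pauli_labels] by fastforce

lemma pair_prob_zero: "pair_prob G (pauli_zero n) (pauli_zero n) = 1"
proof -
  have "{g \<in> G. diag_hit g (pauli_zero n) \<and> diag_hit g (pauli_zero n)} = G"
    using diag_hit_zero by auto
  then show ?thesis using card_G_pos unfolding pair_prob_def by simp
qed

text \<open>Two labels hit by the same \<open>g\<close> are diagonalised simultaneously, and
  diagonal matrices commute. Anticommuting labels therefore have joint probability 0.\<close>

lemma diag_hit_commute: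
  assumes g: "g \<in> G" and a: "a \<in> pauli_labels n" "diag_hit g a" and b: "b \<in> pauli_labels n" "diag_hit g b"
  shows "pauli a * pauli b = pauli b * pauli a"
proof -
  obtain f where f: "pauli_perm n g f" using perm g by blast
  note f' = pauli_permD[OF f]
  have off: "omega g (pauli x) $$ (i, j) = 0"
    if "x \<in> pauli_labels n" "diag_hit g x" "i < 2 ^ n" "j < 2 ^ n" "i \<noteq> j" for x i j
  proof -
    obtain s where s: "cmod s = 1" "omega g (pauli x) = s \<cdot>\<^sub>m pauli (f x)" using f'(4) \<open>x \<in> _\<close> by blast
    have "ztype (f x)" "length (f x) = n"
      using that diag_hit_iff[OF f] f'(3)[of x] by (auto simp: pauli_labels_def)
    then show ?thesis using s that by (simp add: pauli_ztype_offdiag)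
  qed
  have c: "omega g (pauli x) \<in> carrier_mat (2 ^ n) (2 ^ n)" if "x \<in> pauli_labels n" for x
    using f'(1) that by simp
  have "omega g (pauli a) * omega g (pauli b) = omega g (pauli b) * omega g (pauli a)"
    by (rule diagonal_mult_commute[OF c[OF a(1)] _ c[OF b(1)]]) (use off a b in auto)
  then have "omega g (pauli a * pauli b) = omega g (pauli b * pauli a)"
    using omega_mult_distrib[OF f'(1,2)] a b by simp
  then have "omega_adj g (omega g (pauli a * pauli b)) = omega_adj g (omega g (pauli b * pauli a))"
    by (rule arg_cong)
  then show ?thesis
    using f'(1,2) a b by (simp add: omega_adj_omega[of _ "2 ^ n"])
qed

lemma second_moment_sum:
  "(\<Sum>g\<in>G. (\<Sum>a\<in>A. of_bool (diag_hit g a) * v a)\<^sup>2) / real (card G)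
     = (\<Sum>a\<in>A. \<Sum>b\<in>A. v a * v b * pair_prob G a b)"
proof -
  have "(\<Sum>g\<in>G. (\<Sum>a\<in>A. of_bool (diag_hit g a) * v a)\<^sup>2)
      = (\<Sum>g\<in>G. \<Sum>a\<in>A. \<Sum>b\<in>A. v a * v b * (of_bool (diag_hit g a) * of_bool (diag_hit g b)))"
    unfolding power2_eq_square sum_product by (intro sum.cong refl) (simp add: mult_ac)
  also have "\<dots> = (\<Sum>a\<in>A. \<Sum>g\<in>G. \<Sum>b\<in>A. v a * v b * (of_bool (diag_hit g a) * of_bool (diag_hit g b)))"
    by (rule sum.swap)
  also have "\<dots> = (\<Sum>a\<in>A. \<Sum>b\<in>A. \<Sum>g\<in>G. v a * v b * (of_bool (diag_hit g a) * of_bool (diag_hit g b)))"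
    by (intro sum.cong refl) (rule sum.swap)
  also have "\<dots> = (\<Sum>a\<in>A. \<Sum>b\<in>A. v a * v b * (\<Sum>g\<in>G. of_bool (diag_hit g a) * of_bool (diag_hit g b)))"
    by (simp only: sum_distrib_left)
  finally show ?thesis
    by (simp only: pair_prob_sum sum_divide_distrib[where A = A] times_divide_eq_right)
qed

end

text \<open>Counting arguments over the group need its finiteness, which is carried as a locale
  assumption and discharged by a case distinction at the end.\<close>

locale finite_clifford =
  fixes n :: nat
  assumes finite_clifford: "finite (clifford n)"
begin

sublocale pauli_group n "clifford n"
  by unfold_locales
    (use finite_clifford clifford.cl_id clifford_mult clifford_label_map in blast)+

lemma pair_prob_label_map:
  assumes "f \<in> label_maps n" "a \<in> pauli_labels n" "b \<in> pauli_labels n"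
  shows "pair_prob (clifford n) (f a) (f b) = pair_prob (clifford n) a b"
  using label_map_clifford[OF assms(1)] pair_prob_invariant assms(2,3) by blast

text \<open>The d^2 - 1 non-identity labels form one orbit, and d - 1 of them satisfy
  \<open>ztype\<close>; double counting gives the quotient (d - 1) / (d^2 - 1).\<close>

lemma pair_prob_nonzero:
  assumes "a \<in> pauli_labels n" "a \<noteq> pauli_zero n"
  shows "pair_prob (clifford n) a a = 1 / (2 ^ n + 1)"
proof -
  obtain m where n: "n = Suc m" using assms by (cases n) auto
  let ?A = "pauli_labels n - {pauli_zero n}"
  have inv: "f ` ?A \<subseteq> ?A" if "pauli_perm n g f" for g f
    using pauli_permD(3)[OF that] pauli_perm_zero[OF that] pauli_perm_inj[OF that]
    by (auto simp: inj_on_def)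
  have trans: "\<exists>g\<in>clifford n. \<exists>f. pauli_perm n g f \<and> f b = pauli_Z m" if "b \<in> ?A" for b
  proof -
    obtain f where f: "f \<in> label_maps n" "f b = pauli_Z m"
      using label_maps_to_Z[of b m] \<open>b \<in> ?A\<close> unfolding n by blast
    show ?thesis using label_map_clifford[OF f(1)] f(2) by blast
  qed
  have "real (card ?A) * pair_prob (clifford n) a a = real (card {b \<in> ?A. ztype b})"
    by (rule pair_prob_orbit[OF _ inv trans]) (use assms in auto)
  moreover have "card ?A = 4 ^ n - 1" by (simp add: card_Diff_singleton)
  moreover have "{b \<in> ?A. ztype b} = {b \<in> pauli_labels n. ztype b} - {pauli_zero n}" by auto
  then have "card {b \<in> ?A. ztype b} = 2 ^ n - 1" by (simp add: card_Diff_singleton card_ztype)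
  ultimately have eq: "(4 ^ n - 1) * pair_prob (clifford n) a a = 2 ^ n - 1"
    by (simp add: of_nat_diff)
  define D :: real where "D = 2 ^ n"
  have "D > 1" unfolding D_def n by (rule one_less_power) simp_all
  moreover have "(4 :: real) ^ n = D * D" by (simp add: D_def flip: power_mult_distrib)
  ultimately have "(D - 1) * ((D + 1) * pair_prob (clifford n) a a) = (D - 1) * 1"
    using eq by (simp add: D_def algebra_simps)
  then have "(D + 1) * pair_prob (clifford n) a a = 1" using \<open>D > 1\<close> by simp
  then show ?thesis using \<open>D > 1\<close> unfolding D_def[symmetric] by (simp add: field_simps)
qed

lemma pair_prob_pos:
  assumes "a \<in> pauli_labels n"
  shows "pair_prob (clifford n) a a > 0"
proof (cases "a = pauli_zero n")
  case True
  then show ?thesis using pair_prob_zero by simp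
next
  case False
  then show ?thesis using pair_prob_nonzero[OF assms] by (simp add: add_pos_pos)
qed

text \<open>Double counting over the set \<open>?C\<close> of labels that commute with
  \<open>Z\<close> and differ from it and from the identity, (d^2 - 4) / 2 in number. An element
  hitting \<open>Z\<close>, which has probability 1 / (d + 1), hits d labels altogether and hence d
  - 2 in \<open>?C\<close>. So each joint probability is (d - 2) / (d + 1) divided by (d^2 - 4) /
  2.\<close>

lemma pair_prob_Z:
  assumes n: "n = Suc (Suc m)" and t: "t \<in> pauli_labels (Suc m)" "t \<noteq> pauli_zero (Suc m)"
  shows "pair_prob (clifford n) (pauli_Z (Suc m)) ((False, e) # t) = 2 / ((2 ^ n + 1) * (2 ^ n + 2))"
proof -
  let ?P = "pair_prob (clifford n)" and ?Z = "pauli_Z (Suc m)"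
  let ?w = "(False, False) # pauli_Z m"
  let ?T = "pauli_labels (Suc m) - {pauli_zero (Suc m)}"
  let ?C = "(\<lambda>(e, t). (False, e) # t) ` (UNIV \<times> ?T)"
  have Z: "?Z \<in> pauli_labels n" by (simp add: pauli_labels_def n)
  have const: "?P ?Z ((False, e) # t) = ?P ?Z ?w" if "t \<in> ?T" for e t
  proof -
    obtain f where f: "f \<in> label_maps n" "f ?Z = ?Z" "f ((False, e) # t) = ?w"
      using label_maps_pair_to_Z[of t m e] \<open>t \<in> ?T\<close> unfolding n by blast
    have "(False, e) # t \<in> pauli_labels n" using \<open>t \<in> ?T\<close> by (simp add: pauli_labels_def n)
    from pair_prob_label_map[OF f(1) Z this] show ?thesis by (simp only: f(2,3))
  qed
  have card_C: "card ?C = 2 * (4 ^ Suc m - 1)"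
  proof -
    have "inj_on (\<lambda>(e, t). (False, e) # t) (UNIV \<times> ?T)" by (auto intro!: inj_onI)
    then have "card ?C = card (UNIV \<times> ?T :: (bool \<times> _) set)" by (rule card_image)
    also have "\<dots> = 2 * (4 ^ Suc m - 1)"
      by (simp only: card_cartesian_product card_Diff_singleton[OF replicate_pauli_labels]
          card_pauli_labels card_UNIV_bool)
    finally show ?thesis .
  qed
  \<comment> \<open>Labels that are hit together with \<open>Z\<close> commute with it, hence lie in \<open>C\<close> or are \<open>1\<close> or \<open>Z\<close> itself.\<close>
  have count: "card {c \<in> ?C. diag_hit g c} = 2 ^ n - 2" if g: "g \<in> clifford n" and hit: "diag_hit g ?Z" for g
  proof -
    have "{c \<in> ?C. diag_hit g c} = {c \<in> pauli_labels n. diag_hit g c} - {pauli_zero n, ?Z}"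
    proof (intro equalityI subsetI)
      fix c assume "c \<in> {c \<in> ?C. diag_hit g c}"
      then show "c \<in> {c \<in> pauli_labels n. diag_hit g c} - {pauli_zero n, ?Z}"
        by (auto simp: pauli_labels_def n)
    next
      fix c assume c: "c \<in> {c \<in> pauli_labels n. diag_hit g c} - {pauli_zero n, ?Z}"
      then obtain p t where pt: "c = p # t" "t \<in> pauli_labels (Suc m)"
        by (auto simp: pauli_labels_Suc[of "Suc m"] n)
      have "pauli ?Z * pauli (p # t) = pauli (p # t) * pauli ?Z"
        using diag_hit_commute[OF g Z hit, of c] c pt by (auto simp del: pauli_Cons)
      then have "\<not> fst p" using pauli_Z_commute_imp pt(2) by blast
      moreover have "t \<noteq> pauli_zero (Suc m)"
        using c pt \<open>\<not> fst p\<close> by (cases p; cases "snd p") (auto simp: n)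
      ultimately show "c \<in> {c \<in> ?C. diag_hit g c}"
        using c pt by (cases p) (auto intro!: image_eqI[of _ _ "(snd p, t)"])
    qed
    moreover have "card {c \<in> pauli_labels n. diag_hit g c} = 2 ^ n"
      using card_diag_hit[OF order_refl g] pauli_permD(3) by (auto simp: card_ztype)
    moreover have "{pauli_zero n, ?Z} \<subseteq> {c \<in> pauli_labels n. diag_hit g c}"
      using Z hit diag_hit_zero[OF g] by auto
    moreover have "card {pauli_zero n, ?Z} = 2" by (simp add: n)
    ultimately show ?thesis by (simp add: card_Diff_subset)
  qed
  have finC: "finite ?C" by simp
  have "real (card ?C) * ?P ?Z ?w = (\<Sum>c\<in>?C. ?P ?Z c)"
  proof -
    have "(\<Sum>c\<in>?C. ?P ?Z c) = (\<Sum>c\<in>?C. ?P ?Z ?w)"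
      by (rule sum.cong) (use const in auto)
    then show ?thesis by simp
  qed
  also have "\<dots> = (\<Sum>g\<in>clifford n. \<Sum>c\<in>?C. of_bool (diag_hit g ?Z) * of_bool (diag_hit g c)) / real (card (clifford n))"
    unfolding pair_prob_sum by (subst sum.swap) (simp only: sum_divide_distrib)
  also have "\<dots> = (\<Sum>g\<in>clifford n. of_bool (diag_hit g ?Z) * (2 ^ n - 2)) / real (card (clifford n))"
  proof -
    have "(\<Sum>c\<in>?C. of_bool (diag_hit g ?Z) * of_bool (diag_hit g c)) = of_bool (diag_hit g ?Z) * (2 ^ n - 2 :: real)"
      if g: "g \<in> clifford n" for g
    proof (cases "diag_hit g ?Z")
      case True
      have "(\<Sum>c\<in>?C. of_bool (diag_hit g c)) = real (card {c \<in> ?C. diag_hit g c})"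
        using finC by (simp add: Int_def)
      also have "\<dots> = 2 ^ n - 2" unfolding count[OF g True] by (simp add: n of_nat_diff)
      finally show ?thesis using True by (simp del: sum_of_bool_eq)
    qed simp
    then show ?thesis by (intro arg_cong2[where f = "(/)"] sum.cong refl)
  qed
  also have "\<dots> = ?P ?Z ?Z * (2 ^ n - 2)"
    unfolding pair_prob_diag by (simp only: sum_distrib_right[symmetric] times_divide_eq_left)
  also have "?P ?Z ?Z = 1 / (2 ^ n + 1)"
    by (rule pair_prob_nonzero[OF Z]) (simp add: n)
  finally have eq: "2 * (4 ^ Suc m - 1) * ?P ?Z ?w = (2 ^ n - 2) / (2 ^ n + 1)"
    unfolding card_C by (simp add: of_nat_diff del: power_Suc)
  define D :: real where "D = 2 ^ n"
  have D: "D > 2" unfolding D_def n power_Suc using one_le_power[of "2 :: real" m] by linarith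
  have "(4 :: real) ^ Suc m = (2 ^ Suc m) * (2 ^ Suc m)" by (simp only: power_mult_distrib[symmetric]) simp
  then have 4: "2 * ((4 :: real) ^ Suc m - 1) = (D - 2) * (D + 2) / 2" by (simp add: D_def n algebra_simps)
  have ne: "D - 2 \<noteq> 0" using D by simp
  have "(D - 2) * ((D + 2) / 2 * ?P ?Z ?w) = (D - 2) * (1 / (D + 1))"
    using eq unfolding 4 D_def[symmetric] by simp
  then have eq': "(D + 2) / 2 * ?P ?Z ?w = 1 / (D + 1)" by (rule iffD1[OF mult_left_cancel[OF ne]])
  have "?P ?Z ?w = (D + 2) / 2 * ?P ?Z ?w * (2 / (D + 2))" using D by simp
  also have "\<dots> = 2 / ((D + 1) * (D + 2))" unfolding eq' by simp
  finally have "?P ?Z ?w = 2 / ((D + 1) * (D + 2))" .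
  then show ?thesis using const[of t e] t unfolding D_def by simp
qed

text \<open>Unless the probability is 0, some group element hits both labels. After moving
  \<open>a\<close> to \<open>Z\<close>, the image of \<open>b\<close> commutes with
  \<open>Z\<close>, which is the situation of \<open>pair_prob_Z\<close>.\<close>

lemma pair_prob_le:
  assumes a: "a \<in> pauli_labels n" "a \<noteq> pauli_zero n" and b: "b \<in> pauli_labels n" "b \<noteq> pauli_zero n"
    and ab: "a \<noteq> b"
  shows "pair_prob (clifford n) a b \<le> 2 / ((2 ^ n + 1) * (2 ^ n + 2))"
proof (cases "pair_prob (clifford n) a b = 0")
  case False
  obtain k where n: "n = Suc k" using a by (cases n) auto
  obtain f where f: "f \<in> label_maps n" "f a = pauli_Z k"
    using label_maps_to_Z[of a k] a unfolding n by blast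
  obtain h where h: "pauli_perm n h f" using label_map_clifford[OF f(1)] by blast
  have Z: "pauli_Z k \<in> pauli_labels n" by (simp add: pauli_labels_def n)
  have fb: "f b \<in> pauli_labels n" "f b \<noteq> pauli_Z k" "f b \<noteq> pauli_zero n"
  proof -
    note inj = inj_onD[OF pauli_perm_inj[OF h] _ b(1)]
    show "f b \<in> pauli_labels n" by (rule pauli_permD(3)[OF h b(1)])
    show "f b \<noteq> pauli_Z k" using inj[of a] a(1) ab f(2) by metis
    show "f b \<noteq> pauli_zero n"
      using inj[of "pauli_zero n"] b(2) pauli_perm_zero[OF h] replicate_pauli_labels by metis
  qed
  have eq: "pair_prob (clifford n) a b = pair_prob (clifford n) (pauli_Z k) (f b)"
    using pair_prob_label_map[OF f(1) a(1) b(1)] unfolding f(2) by simp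
  then have "{g \<in> clifford n. diag_hit g (pauli_Z k) \<and> diag_hit g (f b)} \<noteq> {}"
    using False unfolding pair_prob_def by (metis card.empty div_0 of_nat_0)
  then obtain g where g: "g \<in> clifford n" "diag_hit g (pauli_Z k)" "diag_hit g (f b)" by blast
  obtain p t where pt: "f b = p # t" "t \<in> pauli_labels k"
    using fb(1) by (auto simp: pauli_labels_Suc n)
  have "pauli (pauli_Z k) * pauli (p # t) = pauli (p # t) * pauli (pauli_Z k)"
    using diag_hit_commute[OF g(1) Z g(2) fb(1) g(3)] unfolding pt(1) .
  then have p: "\<not> fst p" using pauli_Z_commute_imp pt(2) by blast
  then have p': "p = (False, snd p)" by (cases p) auto
  have t: "t \<noteq> pauli_zero k"
    using fb(2,3) p' pt(1) by (cases "snd p") (auto simp: n)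
  \<comment> \<open>A nontrivial tail exists only if there are at least two qubits.\<close>
  then obtain m where k: "k = Suc m" using pt(2) by (cases k) auto
  have "pair_prob (clifford n) (pauli_Z k) ((False, snd p) # t) = 2 / ((2 ^ n + 1) * (2 ^ n + 2))"
    using pair_prob_Z[of m t "snd p"] n k pt(2) t by simp
  then show ?thesis unfolding eq pt(1) using p' by simp
qed (simp add: add_pos_pos less_imp_le)

lemma est_var_global:
  assumes \<rho>: "density n \<rho>" and \<Lambda>: "\<forall>g\<in>clifford n. kraus_channel n (\<Lambda> g)"
    and Obs: "Obs \<in> carrier_mat (2 ^ n) (2 ^ n)"
  shows "est_var n (clifford n) \<Lambda> \<rho> Obs
    \<le> 2 * (2 ^ n + 1) / (2 ^ n + 2) * (stab_norm n (traceless_part n Obs))\<^sup>2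
      + (2 ^ n + 1) / 2 ^ n * (hs_norm (traceless_part n Obs))\<^sup>2"
proof -
  define D :: real where "D = 2 ^ n"
  have D: "D \<ge> 1" by (simp add: D_def)
  let ?A = "pauli_labels n - {pauli_zero n}" and ?O = "traceless_part n Obs"
  define w where "w a = cmod (hs_inner (pauli a) Obs)" for a
  have O: "?O \<in> carrier_mat (2 ^ n) (2 ^ n)" using Obs by (auto simp: traceless_part_def)
  have tr: "tr Obs = hs_inner (pauli (pauli_zero n)) Obs"
    using Obs by (simp add: hs_inner_def)
  have coeff: "hs_inner (pauli a) ?O = hs_inner (pauli a) Obs - tr Obs / 2 ^ n * hs_inner (pauli a) (pauli (pauli_zero n))"
    if "a \<in> pauli_labels n" for a
  proof -
    have c: "1\<^sub>m (2 ^ n) \<in> carrier_mat (2 ^ n) (2 ^ n)" by simp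
    show ?thesis
      unfolding hs_inner_entries[OF pauli_carrier[OF that] O] hs_inner_entries[OF pauli_carrier[OF that] Obs]
        pauli_replicate_zero hs_inner_entries[OF pauli_carrier[OF that] c] sum_distrib_left sum_subtractf[symmetric]
      by (intro sum.cong refl) (simp add: traceless_part_def algebra_simps)
  qed
  have coeff_zero: "hs_inner (pauli (pauli_zero n)) ?O = 0"
    unfolding coeff[OF replicate_pauli_labels] pauli_orthogonal[OF replicate_pauli_labels replicate_pauli_labels]
    by (simp add: tr)
  have coeff_A: "cmod (hs_inner (pauli a) ?O) = w a" if "a \<in> ?A" for a
    using that coeff[of a] pauli_orthogonal[of a n "pauli_zero n"] by (auto simp: w_def simp del: pauli_replicate_zero)
  have split: "(\<Sum>a\<in>pauli_labels n. f a) = f (pauli_zero n) + (\<Sum>a\<in>?A. f a)" for f :: "_ \<Rightarrow> real"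
    by (rule sum.remove) auto
  have st: "(\<Sum>a\<in>?A. w a) = D * stab_norm n ?O"
  proof -
    have "(\<Sum>a\<in>?A. cmod (hs_inner (pauli a) ?O)) = (\<Sum>a\<in>?A. w a)"
      by (intro sum.cong refl coeff_A)
    then show ?thesis unfolding stab_norm_def split coeff_zero by (simp add: D_def)
  qed
  have hs: "(\<Sum>a\<in>?A. (w a)\<^sup>2) = D * (hs_norm ?O)\<^sup>2"
  proof -
    have "(\<Sum>a\<in>?A. (cmod (hs_inner (pauli a) ?O))\<^sup>2) = (\<Sum>a\<in>?A. (w a)\<^sup>2)"
      by (intro sum.cong refl) (simp only: coeff_A)
    then show ?thesis using pauli_parseval_norm[OF O] unfolding split coeff_zero by (simp add: D_def)
  qed
  have "est_var n (clifford n) \<Lambda> \<rho> Obs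
    \<le> (\<Sum>g\<in>clifford n. ((\<Sum>a\<in>?A. of_bool (diag_hit g a) * ((D + 1) / D * w a)))\<^sup>2) / real (card (clifford n))"
  \<comment> \<open>The centre is the contribution of the identity label, which is the same for
    every \<open>g\<close> and \<open>x\<close>.\<close>
  proof (rule est_var_le[where c = "cnj (hs_inner (pauli (pauli_zero n)) Obs) / 2 ^ n"])
    fix g x assume g: "g \<in> clifford n" and x: "x < (2 :: nat) ^ n"
    have "cmod (estimator n (clifford n) Obs g x - cnj (hs_inner (pauli (pauli_zero n)) Obs) / 2 ^ n)
      \<le> (\<Sum>a\<in>?A. of_bool (diag_hit g a) * cmod (hs_inner (pauli a) Obs) / pair_prob (clifford n) a a) / 2 ^ n"
    proof (rule estimator_bound[OF pair_prob_pos Obs g x])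
      have "pauli_labels n - ?A = {pauli_zero n}" by auto
      then show "cnj (hs_inner (pauli (pauli_zero n)) Obs) / 2 ^ n = (\<Sum>a\<in>pauli_labels n - ?A.
        cnj (hs_inner (pauli a) Obs * omega g (pauli a) $$ (x, x)) / of_real (pair_prob (clifford n) a a)) / 2 ^ n"
        using G_carrier[OF g] G_unitary[OF g] x by (simp add: pair_prob_zero)
    qed auto
    \<comment> \<open>The factor (D + 1) / D is the inverse eigenvalue D + 1 over the normalisation
      \<open>2 ^ n\<close>.\<close>
    also have "\<dots> = (\<Sum>a\<in>?A. of_bool (diag_hit g a) * ((D + 1) / D * w a))"
      unfolding sum_divide_distrib
      by (intro sum.cong refl) (simp add: pair_prob_nonzero w_def D_def)
    finally show "cmod (estimator n (clifford n) Obs g x - cnj (hs_inner (pauli (pauli_zero n)) Obs) / 2 ^ n)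
      \<le> (\<Sum>a\<in>?A. of_bool (diag_hit g a) * ((D + 1) / D * w a))" .
  qed (use finite_G nonempty G_carrier G_unitary \<rho> \<Lambda> in auto)
  also have "\<dots> = (\<Sum>a\<in>?A. \<Sum>b\<in>?A. ((D + 1) / D * w a) * ((D + 1) / D * w b) * pair_prob (clifford n) a b)"
    by (rule second_moment_sum)
  \<comment> \<open>The bound for distinct labels is used on the diagonal too, with 1 / (D + 1)
    added there. This small excess completes the double sum to a full square, which gives the
    stabilizer norm; the added term gives the Hilbert-Schmidt norm.\<close>
  also have "\<dots> \<le> (\<Sum>a\<in>?A. \<Sum>b\<in>?A. ((D + 1) / D * w a) * ((D + 1) / D * w b)
      * (2 / ((D + 1) * (D + 2)) + (if b = a then 1 / (D + 1) else 0)))"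
  proof (intro sum_mono mult_left_mono)
    fix a b assume "a \<in> ?A" "b \<in> ?A"
    then show "pair_prob (clifford n) a b \<le> 2 / ((D + 1) * (D + 2)) + (if b = a then 1 / (D + 1) else 0)"
      using pair_prob_le[of a b] pair_prob_nonzero[of a] D by (auto simp: D_def)
    show "0 \<le> ((D + 1) / D * w a) * ((D + 1) / D * w b)" using D by (simp add: w_def)
  qed
  also have "\<dots> = ((D + 1) / D)\<^sup>2 * (2 / ((D + 1) * (D + 2)) * (\<Sum>a\<in>?A. w a)\<^sup>2 + 1 / (D + 1) * (\<Sum>a\<in>?A. (w a)\<^sup>2))"
  proof -
    have "(\<Sum>a\<in>?A. \<Sum>b\<in>?A. ((D + 1) / D * w a) * ((D + 1) / D * w b)
      * (2 / ((D + 1) * (D + 2)) + (if b = a then 1 / (D + 1) else 0)))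
      = (\<Sum>a\<in>?A. \<Sum>b\<in>?A. ((D + 1) / D)\<^sup>2 * (2 / ((D + 1) * (D + 2)) * (w a * w b)
           + 1 / (D + 1) * (if b = a then (w a)\<^sup>2 else 0)))"
    proof -
      have "(c * w a) * (c * w b) * (\<alpha> + (if b = a then \<beta> else 0))
        = c\<^sup>2 * (\<alpha> * (w a * w b) + \<beta> * (if b = a then (w a)\<^sup>2 else 0))" for a b c \<alpha> \<beta>
        by (cases "b = a") (simp_all add: power2_eq_square algebra_simps)
      then show ?thesis by (intro sum.cong refl)
    qed
    also have "\<dots> = ((D + 1) / D)\<^sup>2 * (2 / ((D + 1) * (D + 2)) * (\<Sum>a\<in>?A. \<Sum>b\<in>?A. w a * w b)
           + 1 / (D + 1) * (\<Sum>a\<in>?A. \<Sum>b\<in>?A. if b = a then (w a)\<^sup>2 else 0))"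
      by (simp only: sum_distrib_left sum.distrib distrib_left)
    also have "(\<Sum>a\<in>?A. \<Sum>b\<in>?A. w a * w b) = (\<Sum>a\<in>?A. w a)\<^sup>2"
      by (simp only: power2_eq_square sum_product)
    also have "(\<Sum>a\<in>?A. \<Sum>b\<in>?A. if b = a then (w a)\<^sup>2 else 0) = (\<Sum>a\<in>?A. (w a)\<^sup>2)"
      by (intro sum.cong refl) simp
    finally show ?thesis .
  qed
  also have "\<dots> = 2 * (D + 1) / (D + 2) * (stab_norm n ?O)\<^sup>2 + (D + 1) / D * (hs_norm ?O)\<^sup>2"
  proof -
    have "((D + 1) / D)\<^sup>2 * (2 / ((D + 1) * (D + 2)) * (D * s)\<^sup>2 + 1 / (D + 1) * (D * h))
      = 2 * (D + 1) / (D + 2) * s\<^sup>2 + (D + 1) / D * h" for s h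
      using D by (simp add: power2_eq_square divide_simps) (simp add: algebra_simps)
    then show ?thesis unfolding st hs .
  qed
  finally show ?thesis unfolding D_def .
qed

end

section \<open>The local Clifford group\<close>

text \<open>The invariant that separates the orbits of the local group; \<open>supp_size\<close>
  retains only the number of its true positions.\<close>

definition supp_pattern :: "(bool \<times> bool) list \<Rightarrow> bool list" where
  "supp_pattern a = map (\<lambda>p. p \<noteq> (False, False)) a"

lemma supp_pattern_simps [simp]:
  "supp_pattern [] = []" "supp_pattern (p # a) = (p \<noteq> (False, False)) # supp_pattern a"
  by (simp_all add: supp_pattern_def)

lemma supp_size_pattern: "supp_size a = length (filter id (supp_pattern a))"
  by (induction a) (simp_all add: supp_size_def)

text \<open>The two image Paulis are parallel, while distinct Paulis are orthogonal. A property
  shown for one induced map thus transfers to all of them.\<close>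

lemma pauli_perm_unique:
  assumes "pauli_perm n g f" "pauli_perm n g f'" "a \<in> pauli_labels n"
  shows "f a = f' a"
proof -
  note f = pauli_permD[OF assms(1)] and f' = pauli_permD[OF assms(2)]
  obtain s where s: "cmod s = 1" "omega g (pauli a) = s \<cdot>\<^sub>m pauli (f a)" using f(4) assms(3) by blast
  obtain t where t: "cmod t = 1" "omega g (pauli a) = t \<cdot>\<^sub>m pauli (f' a)" using f'(4) assms(3) by blast
  have "hs_inner (pauli (f a)) (s \<cdot>\<^sub>m pauli (f a)) = hs_inner (pauli (f a)) (t \<cdot>\<^sub>m pauli (f' a))"
    using s t by simp
  then have "s * 2 ^ n = t * (if f a = f' a then 2 ^ n else 0)"
    using f(3)[OF assms(3)] f'(3)[OF assms(3)]
    by (simp add: hs_inner_smult_right[of _ "2 ^ n" "2 ^ n"] pauli_orthogonal[of _ n])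
  then show ?thesis using s(1) by (auto split: if_splits)
qed

lemma clifford_1_perm:
  assumes "g \<in> clifford 1"
  shows "\<exists>\<phi>. pauli1_perm g \<phi> \<and> (\<forall>p. \<phi> p = (False, False) \<longleftrightarrow> p = (False, False))"
proof -
  obtain f where f: "pauli_perm 1 g f" using clifford_label_map[OF assms] by blast
  note f' = pauli_permD[OF f]
  define \<phi> where "\<phi> p = hd (f [p])" for p
  have single: "[p] \<in> pauli_labels 1" for p by (simp add: pauli_labels_def)
  have eq: "f [p] = [\<phi> p]" for p
    using f'(3)[OF single, of p] by (auto simp: pauli_labels_def \<phi>_def length_Suc_conv)
  have "\<exists>s. cmod s = 1 \<and> omega g (pauli1 p) = s \<cdot>\<^sub>m pauli1 (\<phi> p)" for p
    using f'(4)[OF single, of p] unfolding eq pauli_single .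
  then have "pauli1_perm g \<phi>" using f'(1,2) by (simp add: pauli1_perm_def)
  moreover have "\<phi> p = (False, False) \<longleftrightarrow> p = (False, False)" for p
  proof -
    have z: "f [(False, False)] = [(False, False)]" using pauli_perm_zero[OF f] by simp
    have "\<phi> p = (False, False) \<longleftrightarrow> f [p] = f [(False, False)]" unfolding z by (simp add: eq)
    also have "\<dots> \<longleftrightarrow> p = (False, False)"
      using inj_on_eq_iff[OF pauli_perm_inj[OF f] single single] by simp
    finally show ?thesis .
  qed
  ultimately show ?thesis by blast
qed

lemma label_map_1_clifford:
  assumes "f \<in> label_maps 1" "f [p] = [q]"
  shows "\<exists>g\<in>clifford 1. \<exists>\<phi>. pauli1_perm g \<phi> \<and> \<phi> p = q"
proof -
  obtain g where g: "g \<in> clifford 1" "pauli_perm 1 g f" using label_map_clifford[OF assms(1)] by blast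
  note f' = pauli_permD[OF g(2)]
  have single: "[p] \<in> pauli_labels 1" for p by (simp add: pauli_labels_def)
  have eq: "f [p] = [hd (f [p])]" for p
    using f'(3)[OF single, of p] by (auto simp: pauli_labels_def length_Suc_conv)
  have "\<exists>s. cmod s = 1 \<and> omega g (pauli1 p) = s \<cdot>\<^sub>m pauli1 (hd (f [p]))" for p
    using f'(4)[OF single, of p] by (subst (asm) eq) (simp only: pauli_single)
  then have "pauli1_perm g (\<lambda>p. hd (f [p]))" using f'(1,2) by (simp add: pauli1_perm_def)
  then show ?thesis using g(1) assms(2) by force
qed

lemma clifford_1_to_Z: "\<exists>g\<in>clifford 1. \<exists>\<phi>. pauli1_perm g \<phi> \<and> \<phi> p = (False, p \<noteq> (False, False))"
proof (cases "p = (False, False)")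
  case True
  then show ?thesis using label_map_1_clifford[OF lm_id, of p p] by auto
next
  case False
  obtain f where f: "f \<in> label_maps 1" "f [p] = [(False, True)]"
    using label_maps_head[OF False, of 0] by auto
  show ?thesis using label_map_1_clifford[OF f] False by simp
qed

lemma kron_list_simps [simp]: "kron_list [] = 1\<^sub>m 1" "kron_list (g # gs) = kron g (kron_list gs)"
  by (simp_all add: kron_list_def)

lemma pauli_perm_kron:
  assumes U: "pauli1_perm U \<phi>" and h: "pauli_perm m h f"
  shows "pauli_perm (Suc m) (kron U h) (\<lambda>a. \<phi> (hd a) # f (tl a))"
  unfolding pauli_perm_def
proof (intro conjI ballI)
  note U' = pauli1_permD[OF U] and h' = pauli_permD[OF h]
  show "kron U h \<in> carrier_mat (2 ^ Suc m) (2 ^ Suc m)" using U'(1) h'(1) by auto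
  show "unitary (kron U h)" using U' h' by (intro unitary_kron)
  fix a assume "a \<in> pauli_labels (Suc m)"
  then obtain p t where a: "a = p # t" "t \<in> pauli_labels m" by (auto simp: pauli_labels_Suc)
  then show "\<phi> (hd a) # f (tl a) \<in> pauli_labels (Suc m)" using h'(3)[of t] by (simp add: pauli_labels_def)
  obtain s where s: "cmod s = 1" "omega U (pauli1 p) = s \<cdot>\<^sub>m pauli1 (\<phi> p)" using U'(3) by blast
  obtain r where r: "cmod r = 1" "omega h (pauli t) = r \<cdot>\<^sub>m pauli (f t)" using h'(4) a(2) by blast
  have "omega (kron U h) (pauli a) = (s * r) \<cdot>\<^sub>m pauli (\<phi> (hd a) # f (tl a))"
    using U'(1) h'(1) a
    by (simp add: omega_kron[of _ 2 _ _ "2 ^ m"] s(2) r(2) kron_smult_left kron_smult_right smult_smult_mat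
        mult.commute[of r s])
  then show "\<exists>s. cmod s = 1 \<and> omega (kron U h) (pauli a) = s \<cdot>\<^sub>m pauli (\<phi> (hd a) # f (tl a))"
    using s r by (intro exI[of _ "s * r"]) (simp add: norm_mult)
qed

lemma kron_list_perm:
  assumes "set gs \<subseteq> clifford 1"
  shows "\<exists>f. pauli_perm (length gs) (kron_list gs) f \<and>
           (\<forall>a\<in>pauli_labels (length gs). supp_pattern (f a) = supp_pattern a)"
  using assms
proof (induction gs)
  case Nil
  then show ?case using pauli_perm_id[of 0] by auto
next
  case (Cons g gs)
  then obtain f where f: "pauli_perm (length gs) (kron_list gs) f"
    "\<forall>a\<in>pauli_labels (length gs). supp_pattern (f a) = supp_pattern a" by auto
  obtain \<phi> where \<phi>: "pauli1_perm g \<phi>" "\<forall>p. \<phi> p = (False, False) \<longleftrightarrow> p = (False, False)"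
    using clifford_1_perm[of g] Cons.prems by auto
  have "supp_pattern (\<phi> (hd a) # f (tl a)) = supp_pattern a" if "a \<in> pauli_labels (length (g # gs))" for a
    using that f(2) \<phi>(2) by (auto simp: pauli_labels_Suc)
  then show ?case
    using pauli_perm_kron[OF \<phi>(1) f(1)] by (intro exI[of _ "\<lambda>a. \<phi> (hd a) # f (tl a)"]) auto
qed

text \<open>A one-qubit Clifford element can be chosen for each factor separately; the normal form
  has \<open>Z\<close> exactly on the support.\<close>

lemma kron_list_to_Z:
  "\<exists>gs f. length gs = length a \<and> set gs \<subseteq> clifford 1 \<and> pauli_perm (length a) (kron_list gs) f
      \<and> f a = map (Pair False) (supp_pattern a)"
proof (induction a)
  case Nil
  have "pauli_perm 0 (1\<^sub>m 1) (\<lambda>a. a)" using pauli_perm_id[of 0] by (simp add: id_def)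
  then show ?case by (intro exI[of _ "[]"] exI[of _ "\<lambda>a. a"]) auto
next
  case (Cons p t)
  then obtain gs f where gs: "length gs = length t" "set gs \<subseteq> clifford 1"
    "pauli_perm (length t) (kron_list gs) f" "f t = map (Pair False) (supp_pattern t)" by blast
  obtain g \<phi> where g: "g \<in> clifford 1" "pauli1_perm g \<phi>" "\<phi> p = (False, p \<noteq> (False, False))"
    using clifford_1_to_Z by blast
  show ?case
    using gs g pauli_perm_kron[OF g(2) gs(3)]
    by (intro exI[of _ "g # gs"] exI[of _ "\<lambda>a. \<phi> (hd a) # f (tl a)"]) auto
qed

lemma clifford_1_carrier: "g \<in> clifford 1 \<Longrightarrow> g \<in> carrier_mat 2 2"
  using clifford_carrier[of g 1] by simp

lemma kron_list_carrier:
  "set gs \<subseteq> clifford 1 \<Longrightarrow> kron_list gs \<in> carrier_mat (2 ^ length gs) (2 ^ length gs)"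
  using kron_list_perm pauli_permD(1) by blast

lemma kron_list_mult:
  assumes "length gs = length hs" "set gs \<subseteq> clifford 1" "set hs \<subseteq> clifford 1"
  shows "kron_list gs * kron_list hs = kron_list (map2 (*) gs hs)"
  using assms
proof (induction gs hs rule: list_induct2)
  case (Cons g gs h hs)
  then have "kron_list gs \<in> carrier_mat (2 ^ length gs) (2 ^ length gs)"
    "kron_list hs \<in> carrier_mat (2 ^ length gs) (2 ^ length gs)"
    using kron_list_carrier[of gs] kron_list_carrier[of hs] by auto
  then show ?case
    using Cons clifford_1_carrier by (simp add: kron_mult[of _ 2 2 _ "2 ^ length gs" "2 ^ length gs" _ 2 _ "2 ^ length gs"])
qed simp

lemma local_clifford_mult:
  assumes "g \<in> local_clifford n" "h \<in> local_clifford n"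
  shows "g * h \<in> local_clifford n"
proof -
  obtain gs hs where gs: "g = kron_list gs" "length gs = n" "set gs \<subseteq> clifford 1"
    and hs: "h = kron_list hs" "length hs = n" "set hs \<subseteq> clifford 1"
    using assms by (auto simp: local_clifford_def)
  have "set (map2 (*) gs hs) \<subseteq> clifford 1"
  proof
    fix x assume "x \<in> set (map2 (*) gs hs)"
    then obtain a b where ab: "(a, b) \<in> set (zip gs hs)" and x: "x = a * b" by auto
    have "a \<in> clifford 1" "b \<in> clifford 1"
      using set_zip_leftD[OF ab] set_zip_rightD[OF ab] gs(3) hs(3) by auto
    then show "x \<in> clifford 1" unfolding x by (rule clifford_mult)
  qed
  moreover have "g * h = kron_list (map2 (*) gs hs)" "length (map2 (*) gs hs) = n"
    using gs hs kron_list_mult[of gs hs] by simp_all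
  ultimately show ?thesis unfolding local_clifford_def by blast
qed

lemma local_clifford_nonempty: "local_clifford n \<noteq> {}"
proof -
  have "kron_list (replicate n (1\<^sub>m (2 ^ 1))) \<in> local_clifford n"
    unfolding local_clifford_def using clifford.cl_id[of 1]
    by (intro CollectI exI[of _ "replicate n (1\<^sub>m (2 ^ 1))"]) (auto simp: set_replicate_conv_if)
  then show ?thesis by blast
qed

text \<open>Each position in the support offers three Paulis, every other position only the
  identity.\<close>

lemma card_supp_class: "card {a. supp_pattern a = s} = 3 ^ length (filter id s)"
proof (induction s)
  case Nil
  then show ?case by (simp add: supp_pattern_def)
next
  case (Cons b s)
  have eq: "{a. supp_pattern a = b # s}
      = (\<lambda>(p, t). p # t) ` ({p. (p \<noteq> (False, False)) = b} \<times> {a. supp_pattern a = s})"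
    by (auto simp: supp_pattern_def Cons_eq_map_conv image_iff) 
  have "inj_on (\<lambda>(p, t). p # t) X" for X :: "((bool \<times> bool) \<times> (bool \<times> bool) list) set"
    by (auto intro!: inj_onI)
  then have "card {a. supp_pattern a = b # s} = card {p. (p \<noteq> (False, False)) = b} * card {a. supp_pattern a = s}"
    unfolding eq by (simp only: card_image card_cartesian_product)
  moreover have "card {p. (p \<noteq> (False, False)) = b} = (if b then 3 else 1)"
  proof -
    have "{p. (p \<noteq> (False, False)) = b} = (if b then {(False, True), (True, False), (True, True)} else {(False, False)})"
      by auto
    then show ?thesis by simp
  qed
  ultimately show ?case using Cons by auto
qed

text \<open>A diagonal label must have \<open>Z\<close> at every position of its support, so each
  support class contains exactly one.\<close>

lemma ztype_supp_class: "{a. supp_pattern a = s \<and> ztype a} = {map (Pair False) s}"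
proof -
  have "a = map (Pair False) (supp_pattern a)" if "ztype a" for a
    using that by (induction a) (auto simp: prod_eq_iff)
  moreover have "supp_pattern (map (Pair False) s) = s \<and> ztype (map (Pair False) s)"
    by (induction s) auto
  ultimately show ?thesis by auto
qed

section \<open>Cauchy-Schwarz and comparison of norms\<close>

lemma weighted_Cauchy_Schwarz:
  fixes u v :: "'i \<Rightarrow> real"
  assumes "\<And>i. i \<in> I \<Longrightarrow> 0 \<le> u i"
  shows "(\<Sum>i\<in>I. u i * v i)\<^sup>2 \<le> (\<Sum>i\<in>I. u i) * (\<Sum>i\<in>I. u i * (v i)\<^sup>2)"
proof -
  \<comment> \<open>Lagrange's form of the inequality: this double sum is twice the difference of
    the two sides.\<close>
  have "0 \<le> (\<Sum>i\<in>I. \<Sum>j\<in>I. u i * u j * (v i - v j)\<^sup>2)"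
    using assms by (intro sum_nonneg) auto
  also have "\<dots> = (\<Sum>i\<in>I. \<Sum>j\<in>I. (u i * (v i)\<^sup>2) * u j + u i * (u j * (v j)\<^sup>2) - 2 * ((u i * v i) * (u j * v j)))"
    by (intro sum.cong refl) (simp add: power2_eq_square algebra_simps)
  also have "\<dots> = (\<Sum>i\<in>I. u i * (v i)\<^sup>2) * (\<Sum>j\<in>I. u j) + (\<Sum>i\<in>I. u i) * (\<Sum>j\<in>I. u j * (v j)\<^sup>2)
      - 2 * ((\<Sum>i\<in>I. u i * v i) * (\<Sum>j\<in>I. u j * v j))"
    by (simp only: sum_subtractf sum.distrib sum_product sum_distrib_left[where r = 2])
  finally show ?thesis by (simp add: power2_eq_square mult.commute)
qed

lemma vnorm_sq: "(vnorm v)\<^sup>2 = (\<Sum>i<dim_vec v. (cmod (v $ i))\<^sup>2)"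
  by (simp add: vnorm_def sum_nonneg)

text \<open>\<open>spec_norm\<close> is a supremum of reals and bounds its members only if the set
  is bounded. Entries of a unit vector have modulus at most 1, which gives a crude bound by absolute
  row sums.\<close>

lemma bdd_above_spec_norm:
  assumes A: "A \<in> carrier_mat m d"
  shows "bdd_above {vnorm (A *\<^sub>v v) |v. v \<in> carrier_vec (dim_col A) \<and> vnorm v = 1}"
proof (rule bdd_aboveI)
  fix y assume "y \<in> {vnorm (A *\<^sub>v v) |v. v \<in> carrier_vec (dim_col A) \<and> vnorm v = 1}"
  then obtain v where y: "y = vnorm (A *\<^sub>v v)" and v: "v \<in> carrier_vec d" "vnorm v = 1"
    using A by auto
  have le1: "cmod (v $ j) \<le> 1" if "j < d" for j
  proof -
    have "(cmod (v $ j))\<^sup>2 \<le> (\<Sum>i<dim_vec v. (cmod (v $ i))\<^sup>2)"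
      using v(1) that by (intro member_le_sum) auto
    then have "(cmod (v $ j))\<^sup>2 \<le> 1\<^sup>2" using v(2) vnorm_sq[of v] by simp
    then show ?thesis by (rule power2_le_imp_le) simp
  qed
  have entry: "cmod ((A *\<^sub>v v) $ i) \<le> (\<Sum>j<d. cmod (A $$ (i, j)))" if "i < m" for i
  proof -
    have "(A *\<^sub>v v) $ i = (\<Sum>j<d. A $$ (i, j) * v $ j)"
      using A v(1) that by (auto simp: scalar_prod_def atLeast0LessThan)
    also have "cmod \<dots> \<le> (\<Sum>j<d. cmod (A $$ (i, j) * v $ j))" by (rule norm_sum)
    also have "\<dots> \<le> (\<Sum>j<d. cmod (A $$ (i, j)))"
      using le1 by (intro sum_mono) (auto simp: norm_mult intro: mult_left_le)
    finally show ?thesis .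
  qed
  show "y \<le> sqrt (\<Sum>i<m. (\<Sum>j<d. cmod (A $$ (i, j)))\<^sup>2)"
    unfolding y vnorm_def using A entry by (auto intro!: sum_mono power_mono)
qed

text \<open>Column \<open>j\<close> is the image of \<open>unit_vec d j\<close>, so each of the
  \<open>d\<close> columns has norm at most \<open>spec_norm A\<close>.\<close>

lemma hs_norm_le_spec_norm:
  assumes A: "A \<in> carrier_mat m d"
  shows "(hs_norm A)\<^sup>2 \<le> real d * (spec_norm A)\<^sup>2"
proof -
  have col: "(\<Sum>i<m. (cmod (A $$ (i, j)))\<^sup>2) \<le> (spec_norm A)\<^sup>2" if j: "j < d" for j
  proof -
    let ?e = "unit_vec d j :: complex vec"
    have "(\<Sum>i<d. (cmod (?e $ i))\<^sup>2) = (\<Sum>i<d. if i = j then 1 else 0)"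
      using j by (intro sum.cong refl) auto
    then have e: "vnorm ?e = 1" using j by (simp add: vnorm_def)
    have Ae: "(A *\<^sub>v ?e) $ i = A $$ (i, j)" if "i < m" for i using A that j by simp
    have "vnorm (A *\<^sub>v ?e) \<le> spec_norm A"
      unfolding spec_norm_def using A e by (intro cSup_upper bdd_above_spec_norm[OF A]) auto
    then have "(vnorm (A *\<^sub>v ?e))\<^sup>2 \<le> (spec_norm A)\<^sup>2"
      by (intro power_mono) (simp_all add: vnorm_def sum_nonneg)
    then show ?thesis using A Ae by (simp add: vnorm_sq)
  qed
  have "(hs_norm A)\<^sup>2 = (\<Sum>j<d. \<Sum>i<m. (cmod (A $$ (i, j)))\<^sup>2)"
    unfolding hs_norm_sq[OF A] by (rule sum.swap)
  also have "\<dots> \<le> (\<Sum>j<d. (spec_norm A)\<^sup>2)" using col by (intro sum_mono) auto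
  finally show ?thesis by simp
qed

section \<open>Labels supported on the first k qubits\<close>

lemma ztype_append [simp]: "ztype (a @ b) \<longleftrightarrow> ztype a \<and> ztype b"
  by (auto simp: ztype_def)

lemma supp_size_simps [simp]:
  "supp_size [] = 0" "supp_size (p # a) = of_bool (p \<noteq> (False, False)) + supp_size a"
  "supp_size (a @ b) = supp_size a + supp_size b" "supp_size (pauli_zero m) = 0"
  by (simp_all add: supp_size_def)

text \<open>The sum factorises over the qubits, each contributing 1 for the identity and 3 for
  \<open>Z\<close>. This is the origin of the constant \<open>4 ^ k\<close>.\<close>

lemma sum_ztype_supp: "(\<Sum>a\<in>pauli_labels k. of_bool (ztype a) * 3 ^ supp_size a) = (4 ^ k :: real)"
proof (induction k)
  case (Suc k)
  have "(\<Sum>a\<in>pauli_labels (Suc k). of_bool (ztype a) * 3 ^ supp_size a)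
    = (\<Sum>p\<in>UNIV. \<Sum>t\<in>pauli_labels k. (of_bool (\<not> fst p) * 3 ^ of_bool (p \<noteq> (False, False)))
        * (of_bool (ztype t) * 3 ^ supp_size t) :: real)"
    unfolding sum_pauli_labels_Suc by (intro sum.cong refl) (simp add: power_add)
  also have "\<dots> = (\<Sum>p\<in>UNIV. of_bool (\<not> fst p) * 3 ^ of_bool (p \<noteq> (False, False))) * 4 ^ k"
    unfolding sum_distrib_left[symmetric] Suc.IH by (simp only: sum_distrib_right)
  finally show ?case by (simp add: sum_bool_pairs)
qed simp

definition local_labels :: "nat \<Rightarrow> nat \<Rightarrow> (bool \<times> bool) list set" where
  "local_labels n k = (\<lambda>u. u @ pauli_zero (n - k)) ` pauli_labels k"

lemma local_labels_subset: "k \<le> n \<Longrightarrow> local_labels n k \<subseteq> pauli_labels n"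
  by (auto simp: local_labels_def pauli_labels_def)

text \<open>Expressed through \<open>supp_pattern\<close>, membership is visibly invariant under the
  local group.\<close>

lemma local_labels_iff:
  assumes "k \<le> n"
  shows "a \<in> local_labels n k \<longleftrightarrow> a \<in> pauli_labels n \<and> drop k (supp_pattern a) = replicate (n - k) False"
proof
  assume "a \<in> local_labels n k"
  then show "a \<in> pauli_labels n \<and> drop k (supp_pattern a) = replicate (n - k) False"
    using assms by (auto simp: local_labels_def pauli_labels_def supp_pattern_def)
next
  assume a: "a \<in> pauli_labels n \<and> drop k (supp_pattern a) = replicate (n - k) False"
  then have len: "length a = n" by (simp add: pauli_labels_def)
  have "drop k a = pauli_zero (n - k)"
  proof (rule nth_equalityI)
    fix i assume i: "i < length (drop k a)"
    then have "drop k (supp_pattern a) ! i = False" using a by (simp add: pauli_labels_def)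
    then show "drop k a ! i = pauli_zero (n - k) ! i"
      using i len by (simp add: supp_pattern_def)
  qed (use a in \<open>simp add: pauli_labels_def\<close>)
  then have "a = take k a @ pauli_zero (n - k)" by (metis append_take_drop_id)
  moreover have "take k a \<in> pauli_labels k" using a assms by (simp add: pauli_labels_def)
  ultimately show "a \<in> local_labels n k" unfolding local_labels_def by blast
qed

lemma sum_local_labels_ztype:
  "(\<Sum>a\<in>local_labels n k. of_bool (ztype a) * 3 ^ supp_size a) = (4 ^ k :: real)"
  unfolding local_labels_def
  by (subst sum.reindex) (auto simp: inj_on_def sum_ztype_supp)

text \<open>The inner product factorises, and a nontrivial Pauli operator on the last
  \<open>n - k\<close> qubits is orthogonal to the identity there.\<close>

lemma hs_inner_pauli_local_zero:
  assumes k: "k \<le> n" and O: "Oloc \<in> carrier_mat (2 ^ k) (2 ^ k)"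
    and a: "a \<in> pauli_labels n" "a \<notin> local_labels n k"
  shows "hs_inner (pauli a) (kron Oloc (1\<^sub>m (2 ^ (n - k)))) = 0"
proof -
  have t: "take k a \<in> pauli_labels k" and d: "drop k a \<in> pauli_labels (n - k)"
    using a(1) k by (auto simp: pauli_labels_def)
  have ne: "drop k a \<noteq> pauli_zero (n - k)"
    using a(2) t unfolding local_labels_def by (metis append_take_drop_id image_eqI)
  have "hs_inner (pauli (take k a @ drop k a)) (kron Oloc (1\<^sub>m (2 ^ (n - k))))
      = hs_inner (pauli (take k a)) Oloc * hs_inner (pauli (drop k a)) (1\<^sub>m (2 ^ (n - k)))"
    unfolding pauli_append using t d O by (intro hs_inner_kron[of _ "2 ^ k" _ _ "2 ^ (n - k)"]) auto
  also have "hs_inner (pauli (drop k a)) (1\<^sub>m (2 ^ (n - k))) = 0"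
    using pauli_orthogonal[OF d replicate_pauli_labels, of "(False, False)"] ne by simp
  finally show ?thesis by simp
qed

lemma hs_norm_kron_one:
  assumes O: "A \<in> carrier_mat m m"
  shows "(hs_norm (kron A (1\<^sub>m (2 ^ l))))\<^sup>2 = 2 ^ l * (hs_norm A)\<^sup>2"
proof -
  have "hs_inner (1\<^sub>m (2 ^ l)) (1\<^sub>m (2 ^ l)) = 2 ^ l"
    using pauli_orthogonal[OF replicate_pauli_labels replicate_pauli_labels, of l "(False, False)" "(False, False)"]
    by simp
  moreover have "hs_inner (kron A (1\<^sub>m (2 ^ l))) (kron A (1\<^sub>m (2 ^ l))) = hs_inner A A * hs_inner (1\<^sub>m (2 ^ l)) (1\<^sub>m (2 ^ l))"
    using O by (intro hs_inner_kron) auto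
  moreover have c: "kron A (1\<^sub>m (2 ^ l)) \<in> carrier_mat (m * 2 ^ l) (m * 2 ^ l)" using O by simp
  ultimately have "complex_of_real ((hs_norm (kron A (1\<^sub>m (2 ^ l))))\<^sup>2) = complex_of_real (2 ^ l * (hs_norm A)\<^sup>2)"
    unfolding hs_norm_sq_inner[OF c] of_real_mult hs_norm_sq_inner[OF O] by simp
  then show ?thesis by (simp only: of_real_eq_iff)
qed

section \<open>Variance bounds for the local group\<close>

locale finite_local_clifford =
  fixes n :: nat
  assumes finite_local_clifford: "finite (local_clifford n)"
begin

lemma local_clifford_perm:
  assumes "g \<in> local_clifford n"
  shows "\<exists>f. pauli_perm n g f \<and> (\<forall>a\<in>pauli_labels n. supp_pattern (f a) = supp_pattern a)"
  using assms kron_list_perm by (auto simp: local_clifford_def)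

sublocale pauli_group n "local_clifford n"
  by unfold_locales
    (use finite_local_clifford local_clifford_nonempty local_clifford_mult local_clifford_perm in blast)+

lemma supp_pattern_perm:
  assumes "g \<in> local_clifford n" "pauli_perm n g f" "a \<in> pauli_labels n"
  shows "supp_pattern (f a) = supp_pattern a"
  using local_clifford_perm[OF assms(1)] pauli_perm_unique[OF assms(2) _ assms(3)] assms(3) by metis

text \<open>The labels sharing the support pattern of \<open>a\<close> form one orbit of
  \<open>3 ^ supp_size a\<close> elements, exactly one of which satisfies
  \<open>ztype\<close>.\<close>

lemma pair_prob_local:
  assumes a: "a \<in> pauli_labels n"
  shows "pair_prob (local_clifford n) a a = 1 / 3 ^ supp_size a"
proof -
  let ?s = "supp_pattern a"
  let ?A = "{b. supp_pattern b = ?s}"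
  have sub: "?A \<subseteq> pauli_labels n"
    using a by (auto simp: pauli_labels_def supp_pattern_def dest: map_eq_imp_length_eq)
  have inv: "f ` ?A \<subseteq> ?A" if "g \<in> local_clifford n" "pauli_perm n g f" for g f
    using supp_pattern_perm[OF that] sub by auto
  have trans: "\<exists>g\<in>local_clifford n. \<exists>f. pauli_perm n g f \<and> f b = map (Pair False) ?s" if "b \<in> ?A" for b
  proof -
    have b: "length b = n" "supp_pattern b = ?s" using that sub by (auto simp: pauli_labels_def)
    obtain gs f where "length gs = n" "set gs \<subseteq> clifford 1" "pauli_perm n (kron_list gs) f"
      "f b = map (Pair False) ?s" using kron_list_to_Z[of b] unfolding b by blast
    then show ?thesis unfolding local_clifford_def by blast
  qed
  have "real (card ?A) * pair_prob (local_clifford n) a a = real (card {b \<in> ?A. ztype b})"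
    by (rule pair_prob_orbit[OF sub inv trans]) auto
  moreover have "{b \<in> ?A. ztype b} = {map (Pair False) ?s}" using ztype_supp_class[of ?s] by simp
  ultimately have "3 ^ supp_size a * pair_prob (local_clifford n) a a = 1"
    unfolding card_supp_class supp_size_pattern by simp
  then show ?thesis by (simp add: field_simps)
qed

lemma pair_prob_local_pos: "a \<in> pauli_labels n \<Longrightarrow> pair_prob (local_clifford n) a a > 0"
  by (simp add: pair_prob_local)

text \<open>The second moment is taken about 0; the factor \<open>3 ^ supp_size a\<close> is the
  inverse eigenvalue of the frame operator.\<close>

lemma est_var_local:
  assumes \<rho>: "density n \<rho>" and \<Lambda>: "\<forall>g\<in>local_clifford n. kraus_channel n (\<Lambda> g)"
    and Obs: "Obs \<in> carrier_mat (2 ^ n) (2 ^ n)" and A: "A \<subseteq> pauli_labels n"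
    and outside: "\<And>a. a \<in> pauli_labels n - A \<Longrightarrow> hs_inner (pauli a) Obs = 0"
  shows "est_var n (local_clifford n) \<Lambda> \<rho> Obs \<le> (\<Sum>g\<in>local_clifford n.
    ((\<Sum>a\<in>A. of_bool (diag_hit g a) * 3 ^ supp_size a * cmod (hs_inner (pauli a) Obs)) / 2 ^ n)\<^sup>2)
      / real (card (local_clifford n))"
proof (rule est_var_le[where c = 0])
  fix g x assume g: "g \<in> local_clifford n" and x: "x < (2 :: nat) ^ n"
  have "cmod (estimator n (local_clifford n) Obs g x - 0)
    \<le> (\<Sum>a\<in>A. of_bool (diag_hit g a) * cmod (hs_inner (pauli a) Obs) / pair_prob (local_clifford n) a a) / 2 ^ n"
    by (rule estimator_bound[OF pair_prob_local_pos Obs g x A]) (simp_all add: outside)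
  also have "(\<Sum>a\<in>A. of_bool (diag_hit g a) * cmod (hs_inner (pauli a) Obs) / pair_prob (local_clifford n) a a)
    = (\<Sum>a\<in>A. of_bool (diag_hit g a) * 3 ^ supp_size a * cmod (hs_inner (pauli a) Obs))"
    using A by (intro sum.cong refl) (auto simp: pair_prob_local subset_iff)
  finally show "cmod (estimator n (local_clifford n) Obs g x - 0)
    \<le> (\<Sum>a\<in>A. of_bool (diag_hit g a) * 3 ^ supp_size a * cmod (hs_inner (pauli a) Obs)) / 2 ^ n" .
qed (use finite_G nonempty G_carrier G_unitary \<rho> \<Lambda> in auto)

text \<open>A single label remains. The estimator has modulus at most
  \<open>3 ^ supp_size a\<close>, and it vanishes unless the label is hit; the hit probability
  cancels one of the two factors in the square.\<close>

lemma est_var_pauli: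
  assumes \<rho>: "density n \<rho>" and \<Lambda>: "\<forall>g\<in>local_clifford n. kraus_channel n (\<Lambda> g)"
    and a: "a \<in> pauli_labels n"
  shows "est_var n (local_clifford n) \<Lambda> \<rho> (pauli a) \<le> 3 ^ supp_size a"
proof -
  let ?G = "local_clifford n"
  have "est_var n ?G \<Lambda> \<rho> (pauli a) \<le> (\<Sum>g\<in>?G.
    ((\<Sum>b\<in>{a}. of_bool (diag_hit g b) * 3 ^ supp_size b * cmod (hs_inner (pauli b) (pauli a))) / 2 ^ n)\<^sup>2)
      / real (card ?G)"
    by (rule est_var_local[OF \<rho> \<Lambda>]) (use a in \<open>auto simp: pauli_orthogonal\<close>)
  also have "\<dots> = (\<Sum>g\<in>?G. (3 ^ supp_size a)\<^sup>2 * of_bool (diag_hit g a)) / real (card ?G)"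
  proof -
    have "(of_bool b)\<^sup>2 = (of_bool b :: real)" for b by (cases b) simp_all
    then show ?thesis using a by (simp add: pauli_orthogonal norm_power power_mult_distrib mult.commute)
  qed
  also have "\<dots> = (3 ^ supp_size a)\<^sup>2 * pair_prob ?G a a"
    unfolding pair_prob_diag by (simp only: sum_distrib_left[symmetric] times_divide_eq_right)
  also have "\<dots> = 3 ^ supp_size a"
    unfolding pair_prob_local[OF a] by (simp add: power2_eq_square)
  finally show ?thesis .
qed

text \<open>Cauchy-Schwarz splits off the total weight of the hit labels. Averaging the other factor
  over \<open>g\<close> cancels the weights and leaves the squared Pauli coefficients, which
  Parseval and the spectral norm control.\<close>

lemma est_var_k_local:
  assumes \<rho>: "density n \<rho>" and \<Lambda>: "\<forall>g\<in>local_clifford n. kraus_channel n (\<Lambda> g)"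
    and k: "k \<le> n" and O: "Oloc \<in> carrier_mat (2 ^ k) (2 ^ k)"
  shows "est_var n (local_clifford n) \<Lambda> \<rho> (kron Oloc (1\<^sub>m (2 ^ (n - k)))) \<le> 4 ^ k * (spec_norm Oloc)\<^sup>2"
proof -
  let ?G = "local_clifford n" and ?A = "local_labels n k" and ?O = "kron Oloc (1\<^sub>m (2 ^ (n - k)))"
  define w where "w a = cmod (hs_inner (pauli a) ?O)" for a
  have pow: "2 ^ k * 2 ^ (n - k) = (2 ^ n :: nat)" "2 ^ k * 2 ^ (n - k) = (2 ^ n :: real)"
    using k by (simp_all flip: power_add)
  have Obs: "?O \<in> carrier_mat (2 ^ n) (2 ^ n)" using O by (auto simp flip: pow(1))
  note sub = local_labels_subset[OF k]
  have finA: "finite ?A" using finite_subset[OF sub] by simp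
  \<comment> \<open>The map induced by \<open>g\<close> permutes \<open>?A\<close> and preserves the
    weights, so the sum over hit labels becomes the sum over labels satisfying \<open>ztype\<close>,
    whatever \<open>g\<close> is.\<close>
  have weight: "(\<Sum>a\<in>?A. of_bool (diag_hit g a) * 3 ^ supp_size a) = (4 ^ k :: real)" if g: "g \<in> ?G" for g
  proof -
    obtain f where f: "pauli_perm n g f" using perm g by blast
    have supp: "supp_pattern (f a) = supp_pattern a" if "a \<in> ?A" for a
      using supp_pattern_perm[OF g f] sub that by blast
    have "f a \<in> ?A" if "a \<in> ?A" for a
      using that supp[OF that] pauli_permD(3)[OF f] unfolding local_labels_iff[OF k] by simp
    moreover have inj: "inj_on f ?A" using pauli_perm_inj[OF f] sub by (rule inj_on_subset)
    ultimately have surj: "f ` ?A = ?A" using finA by (intro endo_inj_surj) auto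
    have "(\<Sum>a\<in>?A. of_bool (diag_hit g a) * 3 ^ supp_size a)
        = (\<Sum>a\<in>?A. of_bool (ztype (f a)) * 3 ^ supp_size (f a) :: real)"
    proof (intro sum.cong refl)
      fix a assume a: "a \<in> ?A"
      then have "a \<in> pauli_labels n" using sub by blast
      then show "of_bool (diag_hit g a) * 3 ^ supp_size a = (of_bool (ztype (f a)) * 3 ^ supp_size (f a) :: real)"
        unfolding supp_size_pattern supp[OF a] by (simp add: diag_hit_iff[OF f])
    qed
    also have "\<dots> = (\<Sum>a\<in>f ` ?A. of_bool (ztype a) * 3 ^ supp_size a)"
      by (simp add: sum.reindex[OF inj])
    finally show ?thesis unfolding surj sum_local_labels_ztype .
  qed
  have "est_var n ?G \<Lambda> \<rho> ?O \<le> (\<Sum>g\<in>?G.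
    ((\<Sum>a\<in>?A. of_bool (diag_hit g a) * 3 ^ supp_size a * w a) / 2 ^ n)\<^sup>2) / real (card ?G)"
    unfolding w_def
    by (rule est_var_local[OF \<rho> \<Lambda> Obs sub]) (use hs_inner_pauli_local_zero[OF k O] in blast)
  also have "\<dots> \<le> (\<Sum>g\<in>?G. 4 ^ k / (2 ^ n)\<^sup>2 *
      (\<Sum>a\<in>?A. 3 ^ supp_size a * (w a)\<^sup>2 * of_bool (diag_hit g a))) / real (card ?G)"
  proof (intro divide_right_mono sum_mono)
    fix g assume g: "g \<in> ?G"
    have "(\<Sum>a\<in>?A. of_bool (diag_hit g a) * 3 ^ supp_size a * w a)\<^sup>2
      \<le> (\<Sum>a\<in>?A. of_bool (diag_hit g a) * 3 ^ supp_size a)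
        * (\<Sum>a\<in>?A. of_bool (diag_hit g a) * 3 ^ supp_size a * (w a)\<^sup>2)"
      by (rule weighted_Cauchy_Schwarz) simp
    then show "((\<Sum>a\<in>?A. of_bool (diag_hit g a) * 3 ^ supp_size a * w a) / 2 ^ n)\<^sup>2
      \<le> 4 ^ k / (2 ^ n)\<^sup>2 * (\<Sum>a\<in>?A. 3 ^ supp_size a * (w a)\<^sup>2 * of_bool (diag_hit g a))"
      unfolding weight[OF g] power_divide by (simp add: divide_right_mono mult_ac)
  qed simp
  also have "\<dots> = 4 ^ k / (2 ^ n)\<^sup>2 * (\<Sum>a\<in>?A. 3 ^ supp_size a * (w a)\<^sup>2 * pair_prob ?G a a)"
  proof -
    have "(\<Sum>g\<in>?G. \<Sum>a\<in>?A. 3 ^ supp_size a * (w a)\<^sup>2 * of_bool (diag_hit g a)) / real (card ?G)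
      = (\<Sum>a\<in>?A. 3 ^ supp_size a * (w a)\<^sup>2 * pair_prob ?G a a)"
      unfolding pair_prob_diag
      by (subst sum.swap) (simp only: sum_divide_distrib[where A = ?A] sum_distrib_left[symmetric] times_divide_eq_right)
    then show ?thesis by (simp only: sum_distrib_left[symmetric] times_divide_eq_right[symmetric])
  qed
  \<comment> \<open>The weight \<open>3 ^ supp_size a\<close> is the inverse of the hit
    probability.\<close>
  also have "(\<Sum>a\<in>?A. 3 ^ supp_size a * (w a)\<^sup>2 * pair_prob ?G a a) = (\<Sum>a\<in>?A. (w a)\<^sup>2)"
    using sub by (intro sum.cong refl) (auto simp: pair_prob_local subset_iff)
  also have "4 ^ k / (2 ^ n)\<^sup>2 * (\<Sum>a\<in>?A. (w a)\<^sup>2) \<le> 4 ^ k / (2 ^ n)\<^sup>2 * (2 ^ n * (hs_norm ?O)\<^sup>2)"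
  proof (rule mult_left_mono)
    have "(\<Sum>a\<in>?A. (w a)\<^sup>2) \<le> (\<Sum>a\<in>pauli_labels n. (w a)\<^sup>2)"
      using sub by (intro sum_mono2) auto
    then show "(\<Sum>a\<in>?A. (w a)\<^sup>2) \<le> 2 ^ n * (hs_norm ?O)\<^sup>2"
      using pauli_parseval_norm[OF Obs] by (simp add: w_def)
  qed simp
  \<comment> \<open>Tensoring with the identity costs \<open>2 ^ (n - k)\<close> and the comparison
    of norms below costs \<open>2 ^ k\<close>; together they cancel the denominator
    \<open>2 ^ n\<close>.\<close>
  also have "\<dots> = 4 ^ k / 2 ^ n * (2 ^ (n - k) * (hs_norm Oloc)\<^sup>2)"
    unfolding hs_norm_kron_one[OF O] by (simp add: power2_eq_square)
  also have "\<dots> \<le> 4 ^ k / 2 ^ n * (2 ^ (n - k) * (2 ^ k * (spec_norm Oloc)\<^sup>2))"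
  proof (rule mult_left_mono[OF mult_left_mono])
    show "(hs_norm Oloc)\<^sup>2 \<le> 2 ^ k * (spec_norm Oloc)\<^sup>2"
      using hs_norm_le_spec_norm[OF O] by simp
  qed simp_all
  also have "\<dots> = 4 ^ k / 2 ^ n * ((2 ^ k * 2 ^ (n - k)) * (spec_norm Oloc)\<^sup>2)"
    by (simp only: mult_ac)
  also have "\<dots> = 4 ^ k * (spec_norm Oloc)\<^sup>2"
    unfolding pow(2) by simp
  finally show ?thesis .
qed

end

theorem theorem2:
  fixes n :: nat and \<rho> :: "complex mat" and \<Lambda> :: "complex mat \<Rightarrow> complex mat list"
  assumes rho: "density n \<rho>"
    and noise_global: "\<forall>g \<in> clifford n. kraus_channel n (\<Lambda> g)"
    and noise_local: "\<forall>g \<in> local_clifford n. kraus_channel n (\<Lambda> g)"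
  defines "d \<equiv> (2::nat) ^ n"
  shows
    "(\<forall>Obs. Obs \<in> carrier_mat d d \<and> hermitian Obs \<longrightarrow>
        est_var n (clifford n) \<Lambda> \<rho> Obs
          \<le> 2 * (real d + 1) / (real d + 2) * (stab_norm n (traceless_part n Obs))\<^sup>2
            + (real d + 1) / real d * (hs_norm (traceless_part n Obs))\<^sup>2)
   \<and> (\<forall>k Oloc. k \<le> n \<and> Oloc \<in> carrier_mat (2^k) (2^k) \<and> hermitian Oloc \<longrightarrow>
        est_var n (local_clifford n) \<Lambda> \<rho> (kron Oloc (1\<^sub>m (2^(n-k))))
          \<le> 4^k * (spec_norm Oloc)\<^sup>2)
   \<and> (\<forall>a \<in> pauli_labels n.
        est_var n (local_clifford n) \<Lambda> \<rho> (pauli a) \<le> 3 ^ supp_size a)"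
proof (intro conjI allI ballI impI)
  \<comment> \<open>For an infinite group the variance is 0 as a sum over an infinite set.\<close>
  have d: "real d = 2 ^ n" by (simp add: d_def)
  fix Obs assume Obs: "Obs \<in> carrier_mat d d \<and> hermitian Obs"
  show "est_var n (clifford n) \<Lambda> \<rho> Obs
          \<le> 2 * (real d + 1) / (real d + 2) * (stab_norm n (traceless_part n Obs))\<^sup>2
            + (real d + 1) / real d * (hs_norm (traceless_part n Obs))\<^sup>2"
  proof (cases "finite (clifford n)")
    case True
    then interpret finite_clifford n by unfold_locales
    show ?thesis unfolding d using est_var_global[OF rho noise_global] Obs by (simp add: d_def)
  next
    case False
    then have "est_var n (clifford n) \<Lambda> \<rho> Obs = 0" by (simp add: est_var_def)
    then show ?thesis by (simp add: add_nonneg_nonneg)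
  qed
next
  fix k Oloc assume O: "k \<le> n \<and> Oloc \<in> carrier_mat (2^k) (2^k) \<and> hermitian Oloc"
  show "est_var n (local_clifford n) \<Lambda> \<rho> (kron Oloc (1\<^sub>m (2^(n-k)))) \<le> 4^k * (spec_norm Oloc)\<^sup>2"
  proof (cases "finite (local_clifford n)")
    case True
    then interpret finite_local_clifford n by unfold_locales
    show ?thesis using est_var_k_local[OF rho noise_local] O by blast
  next
    case False
    then have "est_var n (local_clifford n) \<Lambda> \<rho> (kron Oloc (1\<^sub>m (2^(n-k)))) = 0"
      by (simp add: est_var_def)
    then show ?thesis by simp
  qed
next
  fix a assume a: "a \<in> pauli_labels n"
  show "est_var n (local_clifford n) \<Lambda> \<rho> (pauli a) \<le> 3 ^ supp_size a"
  proof (cases "finite (local_clifford n)")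
    case True
    then interpret finite_local_clifford n by unfold_locales
    show ?thesis using est_var_pauli[OF rho noise_local a] .
  next
    case False
    then have "est_var n (local_clifford n) \<Lambda> \<rho> (pauli a) = 0" by (simp add: est_var_def)
    then show ?thesis by simp
  qed
qed

end
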